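(* Let $\mathcal I=\mathbb R_+=[0,\infty)$, $x_0=0$, $x_n-x_{n-1}=d_n:=1/n$, $n\in\mathbb N$, $X=\{x_n\}_{n=1}^\infty$, and let $\alpha=\{\alpha_n\}_{n=1}^\infty\subset\mathbb R$ satisfy $$\alpha_n=a\left(n+\tfrac12\right)+O(n^{-1})\quad(n\to\infty),\qquad a\in(-4,0).$$ Then the operator $\mathrm H_A:=\mathrm H_{X,\alpha}=-\frac{\mathrm d^2}{\mathrm dx^2}+\sum_{n=1}^\infty\alpha_n\delta(x-x_n)$ is symmetric with $\mathrm n_\pm(\mathrm H_A)=1$.
   Context: $W^{2,2}(\mathcal I\setminus X)=\{f\in L^2(\mathcal I): f,f'\in AC_{loc}(\mathcal I\setminus X),\ f''\in L^2(\mathcal I)\}$, and $W^{2,2}_{\mathrm{comp}}(\mathcal I\setminus X)$ is the set of its elements with compact support in $\mathcal I=[0,\infty)$. The operator $\mathrm H_{X,\alpha}$ associated with the formal expression is the closure in $L^2(\mathcal I)$ of the symmetric operator $-\mathrm d^2/\mathrm dx^2$ with domain $$\{f\in W^{2,2}_{\mathrm{comp}}(\mathcal I\setminus X): f'(0)=0,\ f(x_n+)=f(x_n-),\ f'(x_n+)-f'(x_n-)=\alpha_nf(x_n),\ n\in\mathbb N\}.$$ $\mathrm n_\pm(T)=\dim\ker(T^*\mp\mathrm i)$ are the deficiency indices. *)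

theory Defs
  imports
    "HOL-Analysis.Analysis"
    "HOL-Library.Extended_Nat"
    "HOL-Library.Landau_Symbols"
begin

section \<open>The Hilbert space of square-integrable functions on the half-line\<close>

definition half_line :: "real set" where
  "half_line = {0..}"

abbreviation leb :: "real measure" where
  "leb \<equiv> lebesgue_on half_line"

definition sq_integrable :: "(real \<Rightarrow> complex) \<Rightarrow> bool" where
  "sq_integrable f \<longleftrightarrow> f \<in> borel_measurable leb \<and> integrable leb (\<lambda>x. (cmod (f x))\<^sup>2)"

lemma sq_integrable_zero: "sq_integrable (\<lambda>_. 0)"
  by (simp add: sq_integrable_def)

lemma sq_integrable_scale:
  assumes "sq_integrable f"
  shows "sq_integrable (\<lambda>x. c * f x)"
  using assms by (auto simp: sq_integrable_def norm_mult power_mult_distrib)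

lemma sq_integrable_add:
  assumes "sq_integrable f" "sq_integrable g"
  shows "sq_integrable (\<lambda>x. f x + g x)"
proof -
  have [measurable]: "f \<in> borel_measurable leb" "g \<in> borel_measurable leb"
    and i: "integrable leb (\<lambda>x. (cmod (f x))\<^sup>2)" "integrable leb (\<lambda>x. (cmod (g x))\<^sup>2)"
    using assms by (auto simp: sq_integrable_def)
  have bound: "(cmod (f x + g x))\<^sup>2 \<le> 2 * (cmod (f x))\<^sup>2 + 2 * (cmod (g x))\<^sup>2" for x
  proof -
    have "(cmod (f x + g x))\<^sup>2 \<le> (cmod (f x) + cmod (g x))\<^sup>2"
      by (intro power_mono norm_triangle_ineq) simp
    also have "\<dots> \<le> 2 * (cmod (f x))\<^sup>2 + 2 * (cmod (g x))\<^sup>2"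
      using zero_le_power2[of "cmod (f x) - cmod (g x)"]
      by (simp add: power2_eq_square algebra_simps)
    finally show ?thesis .
  qed
  have "integrable leb (\<lambda>x. (cmod (f x + g x))\<^sup>2)"
  proof (rule Bochner_Integration.integrable_bound)
    show "integrable leb (\<lambda>x. 2 * (cmod (f x))\<^sup>2 + 2 * (cmod (g x))\<^sup>2)"
      using i by simp
    show "AE x in leb. norm ((cmod (f x + g x))\<^sup>2) \<le> norm (2 * (cmod (f x))\<^sup>2 + 2 * (cmod (g x))\<^sup>2)"
      using bound by (intro AE_I2) simp
  qed measurable
  then show ?thesis
    by (auto simp: sq_integrable_def)
qed

lemma integrable_mult_cnj:
  assumes "sq_integrable f" "sq_integrable g"
  shows "integrable leb (\<lambda>x. f x * cnj (g x))"
proof (rule Bochner_Integration.integrable_bound)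
  have [measurable]: "f \<in> borel_measurable leb" "g \<in> borel_measurable leb"
    using assms by (auto simp: sq_integrable_def)
  have [measurable]: "(\<lambda>x. cnj (g x)) \<in> borel_measurable leb"
    by (intro borel_measurable_continuous_on[OF continuous_on_cnj[OF continuous_on_id]]) measurable
  show "(\<lambda>x. f x * cnj (g x)) \<in> borel_measurable leb"
    by measurable
  show "integrable leb (\<lambda>x. (cmod (f x))\<^sup>2 + (cmod (g x))\<^sup>2)"
    using assms by (auto simp: sq_integrable_def)
  have "cmod (f x) * cmod (g x) \<le> (cmod (f x))\<^sup>2 + (cmod (g x))\<^sup>2" for x
  proof -
    have "0 \<le> (cmod (f x) - cmod (g x))\<^sup>2 + (cmod (f x))\<^sup>2 + (cmod (g x))\<^sup>2"
      by simp
    then show ?thesis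
      by (simp add: power2_eq_square algebra_simps)
  qed
  then show "AE x in leb. norm (f x * cnj (g x)) \<le> norm ((cmod (f x))\<^sup>2 + (cmod (g x))\<^sup>2)"
    by (intro AE_I2) (simp add: norm_mult)
qed

definition l2_rel :: "(real \<Rightarrow> complex) \<Rightarrow> (real \<Rightarrow> complex) \<Rightarrow> bool" where
  "l2_rel f g \<longleftrightarrow> sq_integrable f \<and> sq_integrable g \<and> (AE x in leb. f x = g x)"

quotient_type l2 = "real \<Rightarrow> complex" / partial: l2_rel
proof (rule part_equivpI)
  show "\<exists>f. l2_rel f f"
    using sq_integrable_zero by (auto simp: l2_rel_def)
  show "symp l2_rel"
    by (rule sympI) (auto simp: l2_rel_def eq_commute)
  show "transp l2_rel"
    by (rule transpI) (auto simp: l2_rel_def)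
qed

text \<open>The \<open>L\<^sup>2\<close>-class of a square-integrable function is \<^term>\<open>abs_l2 f\<close>.\<close>

instantiation l2 :: ab_group_add
begin

lift_definition zero_l2 :: l2 is "\<lambda>_. 0"
  by (simp add: l2_rel_def sq_integrable_zero)

lift_definition plus_l2 :: "l2 \<Rightarrow> l2 \<Rightarrow> l2" is "\<lambda>f g x. f x + g x"
  by (auto simp: l2_rel_def sq_integrable_add)

lift_definition uminus_l2 :: "l2 \<Rightarrow> l2" is "\<lambda>f x. (- 1) * f x"
  using sq_integrable_scale[of _ "- 1"] by (auto simp: l2_rel_def)

definition minus_l2 :: "l2 \<Rightarrow> l2 \<Rightarrow> l2" where
  "minus_l2 f g = f + (- g)"

instance
proof
  fix a b c :: l2
  show "a + b + c = a + (b + c)"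
    by transfer (auto simp: l2_rel_def sq_integrable_add add.assoc)
  show "a + b = b + a"
    by transfer (auto simp: l2_rel_def sq_integrable_add add.commute)
  show "0 + a = a"
    by transfer (auto simp: l2_rel_def)
  show "- a + a = 0"
    by transfer (auto simp: l2_rel_def sq_integrable_zero)
  show "a - b = a + - b"
    by (simp add: minus_l2_def)
qed

end

lift_definition scaleC_l2 :: "complex \<Rightarrow> l2 \<Rightarrow> l2" (infixr "*\<^sub>C" 75) is "\<lambda>c f x. c * f x"
  by (auto simp: l2_rel_def sq_integrable_scale)

lemma vector_space_l2: "vector_space scaleC_l2"
proof
  fix a b :: complex and f g :: l2
  show "a *\<^sub>C (f + g) = a *\<^sub>C f + a *\<^sub>C g"
    by transfer (auto simp: l2_rel_def sq_integrable_add sq_integrable_scale distrib_left)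
  show "(a + b) *\<^sub>C f = a *\<^sub>C f + b *\<^sub>C f"
    by transfer (auto simp: l2_rel_def sq_integrable_add sq_integrable_scale distrib_right)
  show "a *\<^sub>C b *\<^sub>C f = (a * b) *\<^sub>C f"
    by transfer (auto simp: l2_rel_def sq_integrable_scale mult.assoc)
  show "1 *\<^sub>C f = f"
    by transfer (auto simp: l2_rel_def)
qed

interpretation l2: vector_space scaleC_l2
  by (rule vector_space_l2)

text \<open>The inner product is linear in its first argument.\<close>

lift_definition cinner_l2 :: "l2 \<Rightarrow> l2 \<Rightarrow> complex" is
  "\<lambda>f g. integral\<^sup>L leb (\<lambda>x. f x * cnj (g x))"
proof -
  fix f f' g g' :: "real \<Rightarrow> complex"
  assume "l2_rel f f'" "l2_rel g g'"
  then have i: "integrable leb (\<lambda>x. f x * cnj (g x))" "integrable leb (\<lambda>x. f' x * cnj (g' x))"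
    and ae: "AE x in leb. f x = f' x" "AE x in leb. g x = g' x"
    by (auto simp: l2_rel_def integrable_mult_cnj)
  have "AE x in leb. f x * cnj (g x) = f' x * cnj (g' x)"
    using ae by eventually_elim simp
  with i show "integral\<^sup>L leb (\<lambda>x. f x * cnj (g x)) = integral\<^sup>L leb (\<lambda>x. f' x * cnj (g' x))"
    by (intro integral_cong_AE) auto
qed

lemma cinner_commute: "cinner_l2 f g = cnj (cinner_l2 g f)"
proof (transfer, goal_cases)
  case (1 f g)
  have "(\<integral>x. f x * cnj (g x) \<partial>leb) = (\<integral>x. cnj (g x * cnj (f x)) \<partial>leb)"
    by (simp add: mult.commute)
  then show ?case
    by (simp only: Bochner_Integration.integral_cnj)
qed

lemma cinner_add_left: "cinner_l2 (f + g) h = cinner_l2 f h + cinner_l2 g h"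
  by transfer (auto simp: l2_rel_def integrable_mult_cnj distrib_right)

lemma cinner_scaleC_left: "cinner_l2 (c *\<^sub>C f) g = c * cinner_l2 f g"
  by transfer (simp add: mult.assoc)

lemma cinner_self:
  "0 \<le> Re (cinner_l2 f f)" "Re (cinner_l2 f f) = 0 \<longleftrightarrow> f = 0"
proof (transfer, goal_cases)
  case (1 f)
  have "(\<lambda>x. f x * cnj (f x)) = (\<lambda>x. complex_of_real ((cmod (f x))\<^sup>2))"
    by (simp only: complex_norm_square)
  then have "(\<integral>x. f x * cnj (f x) \<partial>leb) = complex_of_real (\<integral>x. (cmod (f x))\<^sup>2 \<partial>leb)"
    by (simp only: integral_complex_of_real)
  then show ?case by simp
next
  case 2
  show ?case
  proof (transfer, goal_cases)
    case (1 f)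
    then have sq: "sq_integrable f" by (simp add: l2_rel_def)
    have "(\<lambda>x. f x * cnj (f x)) = (\<lambda>x. complex_of_real ((cmod (f x))\<^sup>2))"
      by (simp only: complex_norm_square)
    then have "(\<integral>x. f x * cnj (f x) \<partial>leb) = complex_of_real (\<integral>x. (cmod (f x))\<^sup>2 \<partial>leb)"
      by (simp only: integral_complex_of_real)
    moreover have "(\<integral>x. (cmod (f x))\<^sup>2 \<partial>leb) = 0 \<longleftrightarrow> (AE x in leb. (cmod (f x))\<^sup>2 = 0)"
      using sq by (intro integral_nonneg_eq_0_iff_AE) (auto simp: sq_integrable_def)
    ultimately show ?case
      using sq by (auto simp: l2_rel_def sq_integrable_zero)
  qed
qed

instantiation l2 :: real_inner
begin

definition scaleR_l2 :: "real \<Rightarrow> l2 \<Rightarrow> l2" where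
  "scaleR_l2 r f = complex_of_real r *\<^sub>C f"

definition inner_l2 :: "l2 \<Rightarrow> l2 \<Rightarrow> real" where
  "inner_l2 f g = Re (cinner_l2 f g)"

definition norm_l2 :: "l2 \<Rightarrow> real" where
  "norm_l2 f = sqrt (inner f f)"

definition dist_l2 :: "l2 \<Rightarrow> l2 \<Rightarrow> real" where
  "dist_l2 f g = norm (f - g)"

definition sgn_l2 :: "l2 \<Rightarrow> l2" where
  "sgn_l2 f = inverse (norm f) *\<^sub>R f"

definition uniformity_l2 :: "(l2 \<times> l2) filter" where
  "uniformity_l2 = (INF e\<in>{0<..}. principal {(f, g). dist f g < e})"

definition open_l2 :: "l2 set \<Rightarrow> bool" where
  "open_l2 U \<longleftrightarrow> (\<forall>f\<in>U. eventually (\<lambda>(f', g). f' = f \<longrightarrow> g \<in> U) uniformity)"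

instance
proof
  fix r s :: real and f g h :: l2 and U :: "l2 set"
  show "r *\<^sub>R (f + g) = r *\<^sub>R f + r *\<^sub>R g" "(r + s) *\<^sub>R f = r *\<^sub>R f + s *\<^sub>R f"
    "r *\<^sub>R s *\<^sub>R f = (r * s) *\<^sub>R f" "1 *\<^sub>R f = f"
    by (simp_all add: scaleR_l2_def l2.scale_right_distrib l2.scale_left_distrib)
  show "dist f g = norm (f - g)" by (rule dist_l2_def)
  show "sgn f = inverse (norm f) *\<^sub>R f" by (rule sgn_l2_def)
  show "uniformity = (INF e\<in>{0<..}. principal {(f::l2, g). dist f g < e})"
    by (rule uniformity_l2_def)
  show "open U \<longleftrightarrow> (\<forall>f\<in>U. eventually (\<lambda>(f', g). f' = f \<longrightarrow> g \<in> U) uniformity)"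
    by (rule open_l2_def)
  show "inner f g = inner g f"
    using cinner_commute[of f g] by (simp add: inner_l2_def)
  show "inner (f + g) h = inner f h + inner g h"
    by (simp add: inner_l2_def cinner_add_left)
  show "inner (r *\<^sub>R f) g = r * inner f g"
    by (simp add: inner_l2_def scaleR_l2_def cinner_scaleC_left)
  show "0 \<le> inner f f" "inner f f = 0 \<longleftrightarrow> f = 0"
    by (simp_all add: inner_l2_def cinner_self)
  show "norm f = sqrt (inner f f)" by (rule norm_l2_def)
qed

end

section \<open>Unbounded operators and deficiency indices\<close>

text \<open>An operator is represented by its graph, so that its closure is the topological
  closure of the graph in the product space.\<close>

type_synonym l2_op = "(l2 \<times> l2) set"

definition linear_operator :: "l2_op \<Rightarrow> bool" where
  "linear_operator T \<longleftrightarrow> single_valued T \<and> (0, 0) \<in> T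
     \<and> (\<forall>f g f' g'. (f, g) \<in> T \<longrightarrow> (f', g') \<in> T \<longrightarrow> (f + f', g + g') \<in> T)
     \<and> (\<forall>c f g. (f, g) \<in> T \<longrightarrow> (c *\<^sub>C f, c *\<^sub>C g) \<in> T)"

definition symmetric_operator :: "l2_op \<Rightarrow> bool" where
  "symmetric_operator T \<longleftrightarrow> linear_operator T \<and> closure (Domain T) = UNIV
     \<and> (\<forall>(f, g)\<in>T. \<forall>(f', g')\<in>T. cinner_l2 g f' = cinner_l2 f g')"

definition adjoint_operator :: "l2_op \<Rightarrow> l2_op" where
  "adjoint_operator T = {(u, v). \<forall>(f, g)\<in>T. cinner_l2 g u = cinner_l2 f v}"

text \<open>\<open>ker (T - z)\<close>\<close>

definition ker_shift :: "l2_op \<Rightarrow> complex \<Rightarrow> l2 set" where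
  "ker_shift T z = {u. (u, z *\<^sub>C u) \<in> T}"

text \<open>The library's dimension is \<open>0\<close> on infinite-dimensional spaces.\<close>

definition cdimension :: "l2 set \<Rightarrow> enat" where
  "cdimension V =
     (if \<exists>B. finite B \<and> V \<subseteq> l2.span B then enat (l2.dim V) else \<infinity>)"

definition deficiency_plus :: "l2_op \<Rightarrow> enat" where
  "deficiency_plus T = cdimension (ker_shift (adjoint_operator T) \<i>)"

definition deficiency_minus :: "l2_op \<Rightarrow> enat" where
  "deficiency_minus T = cdimension (ker_shift (adjoint_operator T) (- \<i>))"

section \<open>Schroedinger operators with point interactions\<close>

definition abs_cont_on :: "real \<Rightarrow> real \<Rightarrow> (real \<Rightarrow> complex) \<Rightarrow> bool" where
  "abs_cont_on a b f \<longleftrightarrow>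
     (\<forall>\<epsilon>>0. \<exists>\<delta>>0. \<forall>S. finite S
        \<longrightarrow> (\<forall>(u, v)\<in>S. a \<le> u \<and> u < v \<and> v \<le> b)
        \<longrightarrow> disjoint_family_on (\<lambda>(u, v). {u<..<v}) S
        \<longrightarrow> (\<Sum>(u, v)\<in>S. v - u) < \<delta>
        \<longrightarrow> (\<Sum>(u, v)\<in>S. cmod (f v - f u)) < \<epsilon>)"

definition AC_loc :: "real set \<Rightarrow> (real \<Rightarrow> complex) \<Rightarrow> bool" where
  "AC_loc S f \<longleftrightarrow> (\<forall>a b. a \<le> b \<longrightarrow> {a..b} \<subseteq> S \<longrightarrow> abs_cont_on a b f)"

text \<open>\<^term>\<open>W22 X f f' f''\<close>: the function \<open>f\<close> belongs to \<open>W\<^sup>2\<^sup>,\<^sup>2(I \ X)\<close>, where \<open>I\<close> is the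
  half-line, and \<open>f'\<close>, \<open>f''\<close> are its first and second derivatives. As \<open>f'\<close> is (locally
  absolutely) continuous, the first derivative exists everywhere on \<open>I \ X\<close> (one-sided at
  \<open>0\<close>); the second exists only almost everywhere.\<close>

definition W22 ::
  "real set \<Rightarrow> (real \<Rightarrow> complex) \<Rightarrow> (real \<Rightarrow> complex) \<Rightarrow> (real \<Rightarrow> complex) \<Rightarrow> bool" where
  "W22 X f f' f'' \<longleftrightarrow>
     sq_integrable f \<and> AC_loc (half_line - X) f \<and> AC_loc (half_line - X) f'
     \<and> (\<forall>t\<in>half_line - X. (f has_vector_derivative f' t) (at t within half_line))
     \<and> (AE t in leb. (f' has_vector_derivative f'' t) (at t within half_line))
     \<and> sq_integrable f''"

definition W22_comp ::
  "real set \<Rightarrow> (real \<Rightarrow> complex) \<Rightarrow> (real \<Rightarrow> complex) \<Rightarrow> (real \<Rightarrow> complex) \<Rightarrow> bool" where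
  "W22_comp X f f' f'' \<longleftrightarrow> W22 X f f' f'' \<and> compact (closure {t\<in>half_line. f t \<noteq> 0})"

text \<open>\<open>f(t+) = f(t-)\<close> and \<open>f'(t+) - f'(t-) = \<beta> f(t)\<close>, where \<open>f(t)\<close> denotes the
  common one-sided limit (\<open>f\<close> itself is determined only off the interaction points).\<close>

definition delta_condition ::
  "real \<Rightarrow> real \<Rightarrow> (real \<Rightarrow> complex) \<Rightarrow> (real \<Rightarrow> complex) \<Rightarrow> bool" where
  "delta_condition \<beta> t f f' \<longleftrightarrow>
     (\<exists>y p q. (f \<longlongrightarrow> y) (at_right t) \<and> (f \<longlongrightarrow> y) (at_left t)
        \<and> (f' \<longlongrightarrow> p) (at_right t) \<and> (f' \<longlongrightarrow> q) (at_left t)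
        \<and> p - q = complex_of_real \<beta> * y)"

text \<open>Interaction centres \<open>x\<^sub>n\<close> and strengths \<open>\<alpha>\<^sub>n\<close> are indexed by \<open>n \<ge> 1\<close>.\<close>

definition delta_op_pre :: "(nat \<Rightarrow> real) \<Rightarrow> (nat \<Rightarrow> real) \<Rightarrow> l2_op" where
  "delta_op_pre x \<alpha> =
     {(abs_l2 f, abs_l2 (\<lambda>t. - f'' t)) | f f' f''.
        W22_comp (x ` {1..}) f f' f'' \<and> f' 0 = 0
        \<and> (\<forall>n\<ge>1. delta_condition (\<alpha> n) (x n) f f')}"

definition delta_op :: "(nat \<Rightarrow> real) \<Rightarrow> (nat \<Rightarrow> real) \<Rightarrow> l2_op" where
  "delta_op x \<alpha> = closure (delta_op_pre x \<alpha>)"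

end

theory Submission
  imports Defs "HOL-Real_Asymp.Real_Asymp"
begin

text \<open>For \<open>k\<^sup>2 = z\<close>, the solutions of \<open>- f'' = z f\<close> satisfying the interface conditions are piecewise
  trigonometric. Their values \<open>u\<^sub>n\<close> at the interaction points obey a three-term recurrence, and
  \<open>v\<^sub>n = sqrt n u\<^sub>n\<close> satisfies \<open>v\<^sub>n\<^sub>+\<^sub>2 = (2 + a) v\<^sub>n\<^sub>+\<^sub>1 - v\<^sub>n\<close> up to coefficient errors of order \<open>1/n\<^sup>2\<close>.
  As \<open>|2 + a| < 2\<close>, a quadratic form that is positive definite and nearly conserved bounds \<open>v\<close>, so
  that \<open>|f t|\<^sup>2 = O (1/n) = O (exp (- t))\<close> near \<open>x\<^sub>n\<close>: every solution is square integrable (the limit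
  circle case). Let \<open>\<phi>\<close> be the solution with \<open>\<phi> 0 = 1\<close>, \<open>\<phi>' 0 = 0\<close>. Green's formula puts \<open>\<phi>\<close> into the
  kernel of the adjoint minus \<open>z\<close>. Conversely, variation of constants shows that every continuous
  compactly supported \<open>h\<close> orthogonal to \<open>\<phi>\<close> lies in the range of the minimal operator minus \<open>cnj z\<close>,
  so an element of that kernel is orthogonal to all such \<open>h\<close>; by density it is a multiple of \<open>\<phi>\<close>.\<close>

section \<open>Absolutely continuous functions\<close>

text \<open>Consecutive spacings have ratio (n+1)/(n+2) = 1 - 1/(n+2), so the recurrence for the
  values themselves deviates from constant coefficients by terms of order 1/n, which are not
  summable. The factor sqrt n absorbs this deviation, and the shift by 1/2 in the strengths leaves
  only second order errors in the middle coefficient. An error O(1/n) in the strengths is harmless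
  because it is multiplied by a spacing of order 1/n. The decay in t reflects that the interaction
  points are the harmonic numbers, which grow like ln n. Elements of the kernel of the adjoint are
  never shown to be regular or to solve a differential equation; they are only tested against the
  range of the minimal operator. The domain of that operator, however, contains functions whose
  derivative is merely locally absolutely continuous off the interaction points. Green's formula
  therefore rests on the fundamental theorem of calculus for absolutely continuous functions,
  applied between neighbouring points, with one-sided limits at the points themselves.\<close>

lemma abs_cont_on_dominated:
  assumes f: "abs_cont_on a b f" and g: "abs_cont_on a b g"
    and "0 \<le> M"
    and le: "\<And>u v. a \<le> u \<Longrightarrow> u < v \<Longrightarrow> v \<le> b
      \<Longrightarrow> cmod (h v - h u) \<le> M * (cmod (f v - f u) + cmod (g v - g u))"
  shows "abs_cont_on a b h"
  unfolding abs_cont_on_def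
proof (intro allI impI)
  fix e :: real assume "e > 0"
  \<comment> \<open>Both variations are kept below \<open>e'\<close>, so the total is at most
    \<open>2 * M * e'\<close>; the \<open>+ 1\<close> covers \<open>M = 0\<close> and makes the
    final inequality strict.\<close>
  define e' where "e' = e / (2 * (M + 1))"
  have "e' > 0" using \<open>e > 0\<close> \<open>0 \<le> M\<close> by (simp add: e'_def)
  obtain \<delta>1 where "\<delta>1 > 0" and \<delta>1: "\<And>S. finite S \<Longrightarrow> (\<forall>(u, v)\<in>S. a \<le> u \<and> u < v \<and> v \<le> b)
        \<Longrightarrow> disjoint_family_on (\<lambda>(u, v). {u<..<v}) S
        \<Longrightarrow> (\<Sum>(u, v)\<in>S. v - u) < \<delta>1 \<Longrightarrow> (\<Sum>(u, v)\<in>S. cmod (f v - f u)) < e'"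
    using f \<open>e' > 0\<close> unfolding abs_cont_on_def by blast
  obtain \<delta>2 where "\<delta>2 > 0" and \<delta>2: "\<And>S. finite S \<Longrightarrow> (\<forall>(u, v)\<in>S. a \<le> u \<and> u < v \<and> v \<le> b)
        \<Longrightarrow> disjoint_family_on (\<lambda>(u, v). {u<..<v}) S
        \<Longrightarrow> (\<Sum>(u, v)\<in>S. v - u) < \<delta>2 \<Longrightarrow> (\<Sum>(u, v)\<in>S. cmod (g v - g u)) < e'"
    using g \<open>e' > 0\<close> unfolding abs_cont_on_def by blast
  show "\<exists>\<delta>>0. \<forall>S. finite S \<longrightarrow> (\<forall>(u, v)\<in>S. a \<le> u \<and> u < v \<and> v \<le> b)
        \<longrightarrow> disjoint_family_on (\<lambda>(u, v). {u<..<v}) S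
        \<longrightarrow> (\<Sum>(u, v)\<in>S. v - u) < \<delta> \<longrightarrow> (\<Sum>(u, v)\<in>S. cmod (h v - h u)) < e"
  proof (intro exI[of _ "min \<delta>1 \<delta>2"] conjI allI impI)
    fix S :: "(real \<times> real) set"
    assume S: "finite S" "\<forall>(u, v)\<in>S. a \<le> u \<and> u < v \<and> v \<le> b"
      "disjoint_family_on (\<lambda>(u, v). {u<..<v}) S" "(\<Sum>(u, v)\<in>S. v - u) < min \<delta>1 \<delta>2"
    have 1: "(\<Sum>(u, v)\<in>S. cmod (f v - f u)) < e'" using S by (intro \<delta>1) auto
    have 2: "(\<Sum>(u, v)\<in>S. cmod (g v - g u)) < e'" using S by (intro \<delta>2) auto
    have "(\<Sum>(u, v)\<in>S. cmod (h v - h u)) \<le> (\<Sum>(u, v)\<in>S. M * (cmod (f v - f u) + cmod (g v - g u)))"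
      using S(2) by (intro sum_mono) (auto intro!: le)
    also have "\<dots> = M * ((\<Sum>(u, v)\<in>S. cmod (f v - f u)) + (\<Sum>(u, v)\<in>S. cmod (g v - g u)))"
      by (simp add: split_def sum_distrib_left sum.distrib distrib_left)
    also have "\<dots> \<le> M * (2 * e')"
      using 1 2 \<open>0 \<le> M\<close> by (intro mult_left_mono) auto
    also have "\<dots> < e"
      using \<open>e > 0\<close> \<open>0 \<le> M\<close> by (simp add: e'_def field_simps)
    finally show "(\<Sum>(u, v)\<in>S. cmod (h v - h u)) < e" .
  qed (use \<open>\<delta>1 > 0\<close> \<open>\<delta>2 > 0\<close> in auto)
qed

lemma abs_cont_on_imp_continuous_on:
  assumes "abs_cont_on a b f"
  shows "continuous_on {a..b} f"
  unfolding continuous_on_iff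
proof (intro ballI allI impI)
  fix x e :: real assume x: "x \<in> {a..b}" and "0 < e"
  then obtain \<delta> where "\<delta> > 0" and \<delta>: "\<And>S. finite S \<Longrightarrow> (\<forall>(u, v)\<in>S. a \<le> u \<and> u < v \<and> v \<le> b)
        \<Longrightarrow> disjoint_family_on (\<lambda>(u, v). {u<..<v}) S
        \<Longrightarrow> (\<Sum>(u, v)\<in>S. v - u) < \<delta> \<Longrightarrow> (\<Sum>(u, v)\<in>S. cmod (f v - f u)) < e"
    using assms unfolding abs_cont_on_def by blast
  have *: "cmod (f v - f u) < e" if "a \<le> u" "u < v" "v \<le> b" "v - u < \<delta>" for u v
    using \<delta>[of "{(u, v)}"] that by (simp add: disjoint_family_on_def)
  show "\<exists>d>0. \<forall>x'\<in>{a..b}. dist x' x < d \<longrightarrow> dist (f x') (f x) < e"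
  proof (intro exI[of _ \<delta>] conjI ballI impI \<open>\<delta> > 0\<close>)
    fix y assume y: "y \<in> {a..b}" "dist y x < \<delta>"
    consider "y < x" | "y = x" | "x < y" by linarith
    then show "dist (f y) (f x) < e"
      using *[of x y] *[of y x] x y \<open>0 < e\<close>
      by cases (auto simp: dist_real_def dist_norm norm_minus_commute)
  qed
qed

lemma abs_cont_on_Lipschitz:
  assumes "\<And>u v. a \<le> u \<Longrightarrow> u < v \<Longrightarrow> v \<le> b \<Longrightarrow> cmod (f v - f u) \<le> L * (v - u)"
  shows "abs_cont_on a b f"
  unfolding abs_cont_on_def
proof (intro allI impI)
  fix e :: real assume "e > 0"
  show "\<exists>\<delta>>0. \<forall>S. finite S \<longrightarrow> (\<forall>(u, v)\<in>S. a \<le> u \<and> u < v \<and> v \<le> b)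
        \<longrightarrow> disjoint_family_on (\<lambda>(u, v). {u<..<v}) S
        \<longrightarrow> (\<Sum>(u, v)\<in>S. v - u) < \<delta> \<longrightarrow> (\<Sum>(u, v)\<in>S. cmod (f v - f u)) < e"
  proof (intro exI[of _ "e / (\<bar>L\<bar> + 1)"] conjI allI impI)
    fix S :: "(real \<times> real) set"
    assume S: "finite S" "\<forall>(u, v)\<in>S. a \<le> u \<and> u < v \<and> v \<le> b"
      "(\<Sum>(u, v)\<in>S. v - u) < e / (\<bar>L\<bar> + 1)"
    have pos: "0 \<le> (\<Sum>(u, v)\<in>S. v - u)" using S(2) by (intro sum_nonneg) auto
    have "(\<Sum>(u, v)\<in>S. cmod (f v - f u)) \<le> (\<Sum>(u, v)\<in>S. L * (v - u))"
      using S(2) assms by (intro sum_mono) auto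
    also have "\<dots> = L * (\<Sum>(u, v)\<in>S. v - u)"
      by (simp add: split_def sum_distrib_left)
    also have "\<dots> \<le> (\<bar>L\<bar> + 1) * (\<Sum>(u, v)\<in>S. v - u)"
      using pos by (intro mult_right_mono) auto
    also have "\<dots> < e"
      using S(3) by (simp add: field_simps add_pos_nonneg)
    finally show "(\<Sum>(u, v)\<in>S. cmod (f v - f u)) < e" .
  qed (use \<open>e > 0\<close> in auto)
qed

lemma abs_cont_on_C1:
  assumes der: "\<And>t. t \<in> {a..b} \<Longrightarrow> (f has_vector_derivative f' t) (at t within {a..b})"
    and cont: "continuous_on {a..b} f'"
  shows "abs_cont_on a b f"
proof -
  have "bounded (f' ` {a..b})"
    by (intro compact_imp_bounded compact_continuous_image cont) auto
  then obtain L where L: "\<And>t. t \<in> {a..b} \<Longrightarrow> cmod (f' t) \<le> L"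
    unfolding bounded_iff by blast
  show ?thesis
  proof (rule abs_cont_on_Lipschitz)
    fix u v assume uv: "a \<le> u" "u < v" "v \<le> b"
    have "norm (f v - f u) \<le> L * norm (v - u)"
    proof (rule differentiable_bound[of "{a..b}" f "\<lambda>t h. h *\<^sub>R f' t"])
      show "onorm (\<lambda>h. h *\<^sub>R f' t) \<le> L" if "t \<in> {a..b}" for t
        using L[OF that] by (intro onorm_le) (simp add: mult.commute[of L] mult_left_mono)
    qed (use der uv in \<open>auto simp: has_vector_derivative_def\<close>)
    then show "cmod (f v - f u) \<le> L * (v - u)" using uv by simp
  qed
qed

lemma abs_cont_on_const: "abs_cont_on a b (\<lambda>_. c)"
  by (rule abs_cont_on_Lipschitz[of _ _ _ 0]) auto

lemma abs_cont_on_add: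
  assumes "abs_cont_on a b f" "abs_cont_on a b g"
  shows "abs_cont_on a b (\<lambda>t. f t + g t)"
proof (rule abs_cont_on_dominated[OF assms, of 1])
  show "cmod (f v + g v - (f u + g u)) \<le> 1 * (cmod (f v - f u) + cmod (g v - g u))" for u v
    using norm_triangle_ineq[of "f v - f u" "g v - g u"] by (simp add: algebra_simps)
qed simp

lemma abs_cont_on_mult:
  assumes f: "abs_cont_on a b f" and g: "abs_cont_on a b g"
  shows "abs_cont_on a b (\<lambda>t. f t * g t)"
proof -
  have "bounded (f ` {a..b})" "bounded (g ` {a..b})"
    by (intro compact_imp_bounded compact_continuous_image abs_cont_on_imp_continuous_on f g compact_Icc)+
  then obtain M1 M2 where M1: "\<And>t. t \<in> {a..b} \<Longrightarrow> cmod (f t) \<le> M1"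
    and M2: "\<And>t. t \<in> {a..b} \<Longrightarrow> cmod (g t) \<le> M2"
    unfolding bounded_iff by blast
  define M where "M = max 0 (max M1 M2)"
  have M: "cmod (f t) \<le> M" "cmod (g t) \<le> M" if "t \<in> {a..b}" for t
    using M1[OF that] M2[OF that] by (auto simp: M_def)
  show ?thesis
  proof (rule abs_cont_on_dominated[OF f g, of M])
    fix u v assume uv: "a \<le> u" "u < v" "v \<le> b"
    have "f v * g v - f u * g u = (f v - f u) * g v + f u * (g v - g u)"
      by (simp add: algebra_simps)
    also have "cmod \<dots> \<le> cmod (f v - f u) * cmod (g v) + cmod (f u) * cmod (g v - g u)"
      by (metis norm_mult norm_triangle_ineq)
    also have "\<dots> \<le> cmod (f v - f u) * M + M * cmod (g v - g u)"
      using uv by (intro add_mono mult_left_mono mult_right_mono M) auto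
    finally show "cmod (f v * g v - f u * g u) \<le> M * (cmod (f v - f u) + cmod (g v - g u))"
      by (simp add: algebra_simps)
  qed (simp add: M_def)
qed

lemma abs_cont_on_cnj:
  assumes "abs_cont_on a b f"
  shows "abs_cont_on a b (\<lambda>t. cnj (f t))"
  by (rule abs_cont_on_dominated[OF assms assms, of 1])
    (auto simp flip: complex_cnj_diff)

lemma abs_cont_on_diff:
  assumes "abs_cont_on a b f" "abs_cont_on a b g"
  shows "abs_cont_on a b (\<lambda>t. f t - g t)"
  using abs_cont_on_add[OF assms(1) abs_cont_on_mult[OF abs_cont_on_const[of a b "-1"] assms(2)]]
  by simp

text \<open>The tags in the exceptional null set are controlled by covering that set by an open set of
  small measure, on which absolute continuity bounds the variation.\<close>

theorem fundamental_theorem_of_calculus_abs_cont: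
  fixes F :: "real \<Rightarrow> complex"
  assumes "a \<le> b" and ac: "abs_cont_on a b F" and N: "negligible N"
    and der: "\<And>t. t \<in> {a..b} - N \<Longrightarrow> (F has_vector_derivative h t) (at t within {a..b})"
  shows "(h has_integral (F b - F a)) {a..b}"
proof -
  \<comment> \<open>On \<open>N\<close> the values of \<open>h\<close> are arbitrary. With zero
    there, a tag in \<open>N\<close> contributes only the increment of \<open>F\<close> to the
    error; the change is undone at the end, since \<open>N\<close> is negligible.\<close>
  define h0 where "h0 t = (if t \<in> N then 0 else h t)" for t
  have "(h0 has_integral (F b - F a)) {a..b}"
    unfolding has_integral_factor_content box_real[symmetric]
  proof safe
    fix e :: real assume "e > 0"
    show "\<exists>d. gauge d \<and> (\<forall>p. p tagged_division_of (cbox a b) \<and> d fine p \<longrightarrow>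
      norm ((\<Sum>(x, k)\<in>p. measure lborel k *\<^sub>R h0 x) - (F b - F a)) \<le> e * measure lborel (cbox a b))"
    proof (cases "a = b")
      case True
      show ?thesis
        using has_integral_refl(1)[of h0 b, unfolded has_integral_factor_content] \<open>e > 0\<close>
        by (auto simp: True)
    next
      case False
      with \<open>a \<le> b\<close> have "a < b" by simp
      have "e / 2 > 0" using \<open>e > 0\<close> by simp
      then have "\<exists>d>0. x \<in> {a..b} - N \<longrightarrow>
           (\<forall>y\<in>{a..b}. norm (y-x) < d \<longrightarrow> norm (F y - F x - (y-x) *\<^sub>R h x) \<le> e / 2 * norm (y-x))" for x
        using der[of x, unfolded has_vector_derivative_def has_derivative_within_alt]
        by (cases "x \<in> {a..b} - N") (blast intro: zero_less_one)+
      then obtain d where "\<forall>x. 0 < d x \<and> (x \<in> {a..b} - N \<longrightarrow>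
           (\<forall>y\<in>{a..b}. norm (y-x) < d x \<longrightarrow> norm (F y - F x - (y-x) *\<^sub>R h x) \<le> e / 2 * norm (y-x)))"
        using choice[of "\<lambda>x d. 0 < d \<and> (x \<in> {a..b} - N \<longrightarrow>
           (\<forall>y\<in>{a..b}. norm (y-x) < d \<longrightarrow> norm (F y - F x - (y-x) *\<^sub>R h x) \<le> e / 2 * norm (y-x)))"] by blast
      then have d0: "\<And>x. 0 < d x" and
        d: "\<And>x y. \<lbrakk>x \<in> {a..b} - N; y \<in> {a..b}; norm (y-x) < d x\<rbrakk>
            \<Longrightarrow> norm (F y - F x - (y-x) *\<^sub>R h x) \<le> e / 2 * norm (y-x)"
        by auto
      \<comment> \<open>The admissible error \<open>e * (b - a)\<close> is shared equally between
        the tags outside \<open>N\<close> and the tags in \<open>N\<close>.\<close>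
      have "e / 2 * (b - a) > 0" using \<open>e > 0\<close> \<open>a < b\<close> by simp
      then obtain \<delta> where "\<delta> > 0" and \<delta>: "\<And>S. finite S \<Longrightarrow> (\<forall>(u, v)\<in>S. a \<le> u \<and> u < v \<and> v \<le> b)
        \<Longrightarrow> disjoint_family_on (\<lambda>(u, v). {u<..<v}) S
        \<Longrightarrow> (\<Sum>(u, v)\<in>S. v - u) < \<delta> \<Longrightarrow> (\<Sum>(u, v)\<in>S. cmod (F v - F u)) < e / 2 * (b - a)"
        using ac unfolding abs_cont_on_def by blast
      have N0: "N \<in> null_sets lebesgue" using N negligible_iff_null_sets by blast
      obtain U where U: "open U" "N \<subseteq> U" "U - N \<in> lmeasurable" "emeasure lebesgue (U - N) < ennreal \<delta>"
        using sets_lebesgue_outer_open[of N \<delta>] N0 \<open>\<delta> > 0\<close> by blast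
      have "U = (U - N) \<union> N" using U by auto
      then have eU: "emeasure lebesgue U < ennreal \<delta>"
        using emeasure_Un_null_set[of "U - N" lebesgue N] U(3,4) N0 by auto
      have Us: "U \<in> sets lebesgue" using U(1) by auto
      define \<gamma> where "\<gamma> x = (if x \<in> N then U else ball x (d x))" for x
      have gauge: "gauge \<gamma>"
        unfolding gauge_def \<gamma>_def using d0 U by auto
      have est: "norm ((\<Sum>(x, k)\<in>p. measure lborel k *\<^sub>R h0 x) - (F b - F a)) \<le> e * measure lborel (cbox a b)"
        if p: "p tagged_division_of (cbox a b)" and fine: "\<gamma> fine p" for p
      proof -
        have "finite p" using p by blast
        have ba: "b - a = (\<Sum>(x,K)\<in>p. Sup K - Inf K)" "F b - F a = (\<Sum>(x,K)\<in>p. F(Sup K) - F(Inf K))"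
          using additive_tagged_division_1[where f= "\<lambda>x. x"] additive_tagged_division_1[where f= F]
            \<open>a \<le> b\<close> p by auto
        have K: "\<exists>u v. K = {u..v} \<and> u \<le> v \<and> a \<le> u \<and> v \<le> b \<and> u \<le> x \<and> x \<le> v" if "(x, K) \<in> p" for x K
        proof -
          obtain u v where "K = cbox u v" using p \<open>(x, K) \<in> p\<close> by blast
          moreover have "x \<in> K" "K \<subseteq> cbox a b" using p \<open>(x, K) \<in> p\<close> by blast+
          ultimately show ?thesis by (intro exI[of _ u] exI[of _ v]) auto
        qed
        define P where "P = {xK \<in> p. fst xK \<in> N}"
        define Q where "Q = {xK \<in> p. fst xK \<notin> N}"
        have pPQ: "p = P \<union> Q" "P \<inter> Q = {}" "finite P" "finite Q" "P \<subseteq> p" "Q \<subseteq> p"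
          using \<open>finite p\<close> by (auto simp: P_def Q_def)
        have nQ: "norm (\<Sum>(x, K)\<in>Q. measure lborel K *\<^sub>R h0 x - (F (Sup K) - F (Inf K))) \<le> e / 2 * (b - a)"
        proof -
          have "norm (\<Sum>(x, K) \<in> Q. (measure lborel K *\<^sub>R h0 x) - (F (Sup K) - F (Inf K)))
              \<le> (\<Sum>n\<in>Q. e / 2 * (case n of (x, k) \<Rightarrow> Sup k - Inf k))"
          proof (rule sum_norm_le, safe)
            fix x K assume xK: "(x, K) \<in> Q"
            then have "(x, K) \<in> p" "x \<notin> N" by (auto simp: Q_def)
            then obtain u v where k: "K = {u..v}" "u \<le> v" "a \<le> u" "v \<le> b" "u \<le> x" "x \<le> v" using K by blast
            have ball: "K \<subseteq> ball x (d x)"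
              using fineD[OF fine \<open>(x, K) \<in> p\<close>] \<open>x \<notin> N\<close> by (simp add: \<gamma>_def)
            have uvK: "u \<in> ball x (d x)" "v \<in> ball x (d x)" using k ball by (metis atLeastAtMost_iff order_refl subsetD)+
            have "norm ((v - u) *\<^sub>R h x - (F v - F u)) = norm (F u - F x - (u - x) *\<^sub>R h x - (F v - F x - (v - x) *\<^sub>R h x))"
              by (auto simp: algebra_simps)
            also have "\<dots> \<le> norm (F u - F x - (u - x) *\<^sub>R h x) + norm (F v - F x - (v - x) *\<^sub>R h x)"
              by (rule norm_triangle_ineq4)
            also have "\<dots> \<le> e / 2 * norm (u - x) + e / 2 * norm (v - x)"
              using uvK k \<open>x \<notin> N\<close> by (intro add_mono d) (auto simp: dist_real_def)
            also have "\<dots> = e / 2 * (v - u)" using k by (simp add: field_simps)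
            finally show "norm (measure lborel K *\<^sub>R h0 x - (F (Sup K) - F (Inf K))) \<le> e / 2 * (Sup K - Inf K)"
              using k \<open>x \<notin> N\<close> by (simp add: h0_def)
          qed
          also have "\<dots> = e / 2 * (\<Sum>n\<in>Q. (case n of (x, k) \<Rightarrow> Sup k - Inf k))"
            by (simp add: sum_distrib_left)
          also have "\<dots> \<le> e / 2 * (\<Sum>n\<in>p. (case n of (x, k) \<Rightarrow> Sup k - Inf k))"
            using \<open>e > 0\<close> \<open>finite p\<close> pPQ K by (intro mult_left_mono sum_mono2) fastforce+
          finally show ?thesis using ba by simp
        qed
        have nP: "norm (\<Sum>(x, K)\<in>P. measure lborel K *\<^sub>R h0 x - (F (Sup K) - F (Inf K))) \<le> e / 2 * (b - a)"
        proof -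
          \<comment> \<open>\<open>abs_cont_on\<close> speaks of intervals with
            \<open>u < v\<close>, so degenerate members of the division, whose increments are zero,
            are dropped. On the others the end points determine the tagged interval, because two
            members with the same nondegenerate interval would have overlapping interiors.\<close>
          define P' where "P' = {(x, K) \<in> P. Inf K < Sup K}"
          have P'p: "P' \<subseteq> P" "P' \<subseteq> p" "finite P'" using pPQ by (auto simp: P'_def intro: finite_subset)
          define S where "S = (\<lambda>(x, K). (Inf K, Sup K)) ` P'"
          have P': "\<exists>u v. K = {u..v} \<and> u < v \<and> a \<le> u \<and> v \<le> b \<and> x \<in> N \<and> K \<subseteq> U" if "(x, K) \<in> P'" for x K
          proof -
            have "(x, K) \<in> p" "x \<in> N" "Inf K < Sup K" using that by (auto simp: P'_def P_def)
            moreover have "K \<subseteq> U" using fineD[OF fine \<open>(x, K) \<in> p\<close>] \<open>x \<in> N\<close> by (simp add: \<gamma>_def)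
            ultimately show ?thesis using K[OF \<open>(x, K) \<in> p\<close>] by auto
          qed
          have disj: "{Inf K<..<Sup K} \<inter> {Inf K'<..<Sup K'} = {}"
            if xK: "(x, K) \<in> P'" "(x', K') \<in> P'" "(x, K) \<noteq> (x', K')" for x K x' K'
          proof -
            have "interior K \<inter> interior K' = {}"
              by (rule tagged_division_ofD(5)[OF p]) (use xK P'p in auto)
            moreover obtain u v u' v' where "K = {u..v}" "u < v" "K' = {u'..v'}" "u' < v'"
              using P'[OF xK(1)] P'[OF xK(2)] by blast
            ultimately show ?thesis by simp
          qed
          have inj: "inj_on (\<lambda>(x, K). (Inf K, Sup K)) P'"
          proof (rule inj_onI, safe)
            fix x K x' K'
            assume *: "(x, K) \<in> P'" "(x', K') \<in> P'" "Inf K = Inf K'" "Sup K = Sup K'"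
            then have "(x, K) = (x', K')"
              using disj[of x K x' K'] P'[of x K] by fastforce
            then show "x = x'" "y \<in> K \<Longrightarrow> y \<in> K'" "y \<in> K' \<Longrightarrow> y \<in> K" for y by auto
          qed
          have S1: "finite S" using P'p by (simp add: S_def)
          have S2: "\<forall>(u, v)\<in>S. a \<le> u \<and> u < v \<and> v \<le> b"
            unfolding S_def using P' by fastforce
          have S3: "disjoint_family_on (\<lambda>(u, v). {u<..<v}) S"
            unfolding disjoint_family_on_def S_def
          proof (intro ballI impI)
            fix i j assume ij: "i \<in> (\<lambda>(x, K). (Inf K, Sup K)) ` P'" "j \<in> (\<lambda>(x, K). (Inf K, Sup K)) ` P'" "i \<noteq> j"
            then obtain x K x' K' where xK: "(x, K) \<in> P'" "i = (Inf K, Sup K)"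
              "(x', K') \<in> P'" "j = (Inf K', Sup K')" by auto
            with ij(3) have "(x, K) \<noteq> (x', K')" by auto
            then show "(case i of (u, v) \<Rightarrow> {u<..<v}) \<inter> (case j of (u, v) \<Rightarrow> {u<..<v}) = {}"
              using disj[of x K x' K'] xK by simp
          qed
          have "(\<Sum>(u, v)\<in>S. v - u) = (\<Sum>i\<in>S. measure lebesgue (case i of (u, v) \<Rightarrow> {u<..<v}))"
            using S2 by (intro sum.cong) auto
          also have "\<dots> = measure lebesgue (\<Union>i\<in>S. (case i of (u, v) \<Rightarrow> {u<..<v}))"
            by (subst measure_finite_Union[OF S1 _ S3]) (use S2 in auto)
          also have "\<dots> < \<delta>"
          proof -
            have "(\<Union>i\<in>S. (case i of (u, v) \<Rightarrow> {u<..<v})) \<subseteq> U"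
              unfolding S_def using P' by fastforce
            then have "emeasure lebesgue (\<Union>i\<in>S. (case i of (u, v) \<Rightarrow> {u<..<v})) < ennreal \<delta>"
              using emeasure_mono[OF _ Us] eU by (meson order.strict_trans1)
            then show ?thesis
              by (metis \<open>\<delta> > 0\<close> emeasure_eq_ennreal_measure ennreal_less_iff ennreal_less_top less_trans measure_nonneg less_irrefl top.not_eq_extremum)
          qed
          finally have less: "(\<Sum>(u, v)\<in>S. cmod (F v - F u)) < e / 2 * (b - a)"
            by (intro \<delta> S1 S2 S3)
          have "(\<Sum>(x, K)\<in>P. measure lborel K *\<^sub>R h0 x - (F (Sup K) - F (Inf K))) = (\<Sum>(x, K)\<in>P. F (Inf K) - F (Sup K))"
            by (intro sum.cong) (auto simp: P_def h0_def)
          also have "\<dots> = (\<Sum>(x, K)\<in>P'. F (Inf K) - F (Sup K))"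
          proof (intro sum.mono_neutral_right P'p pPQ ballI)
            fix i assume i: "i \<in> P - P'"
            obtain x K where xK: "i = (x, K)" by (cases i)
            have "(x, K) \<in> p" using i pPQ xK by auto
            then obtain u v where k: "K = {u..v}" "u \<le> v" using K by blast
            moreover have "\<not> Inf K < Sup K" using i xK by (auto simp: P'_def)
            ultimately show "(case i of (x, K) \<Rightarrow> F (Inf K) - F (Sup K)) = 0" using xK by auto
          qed
          also have "cmod \<dots> \<le> (\<Sum>(x, K)\<in>P'. cmod (F (Sup K) - F (Inf K)))"
            by (rule sum_norm_le) (auto simp: norm_minus_commute)
          also have "\<dots> = (\<Sum>(u, v)\<in>S. cmod (F v - F u))"
            unfolding S_def by (subst sum.reindex[OF inj]) (auto simp: o_def split_def)
          finally show ?thesis using less by simp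
        qed
        have "(\<Sum>(x, k)\<in>p. measure lborel k *\<^sub>R h0 x) - (F b - F a)
          = (\<Sum>(x, K)\<in>p. measure lborel K *\<^sub>R h0 x - (F (Sup K) - F (Inf K)))"
          by (simp add: ba split_def sum_subtractf)
        also have "\<dots> = (\<Sum>(x, K)\<in>P. measure lborel K *\<^sub>R h0 x - (F (Sup K) - F (Inf K)))
            + (\<Sum>(x, K)\<in>Q. measure lborel K *\<^sub>R h0 x - (F (Sup K) - F (Inf K)))"
          unfolding pPQ(1) by (intro sum.union_disjoint pPQ)
        also have "norm \<dots> \<le> e / 2 * (b - a) + e / 2 * (b - a)"
          by (rule norm_triangle_le[OF add_mono[OF nP nQ]])
        finally show ?thesis using \<open>a < b\<close> by simp
      qed
      show ?thesis
        by (rule exI[of _ \<gamma>], rule conjI[OF gauge], intro allI impI est) auto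
    qed
  qed
  then show ?thesis
    by (rule has_integral_spike[OF N, rotated]) (auto simp: h0_def)
qed

section \<open>Functions satisfying the interface conditions\<close>

lemma AE_leb_negligible:
  assumes "AE t in leb. P t"
  obtains N where "negligible N" "\<And>t. t \<in> half_line - N \<Longrightarrow> P t"
proof -
  have "half_line \<inter> space lebesgue \<in> sets lebesgue"
    by (auto simp: half_line_def)
  then have "AE t in lebesgue. t \<in> half_line \<longrightarrow> P t"
    using assms by (simp add: AE_restrict_space_iff)
  then obtain N where "N \<in> null_sets lebesgue" "{t. \<not> (t \<in> half_line \<longrightarrow> P t)} \<subseteq> N"
    by (auto simp: eventually_ae_filter)
  then show ?thesis
    by (intro that[of N]) (auto simp: negligible_iff_null_sets)
qed

lemma negligible_AE_leb:
  assumes "negligible N" "\<And>t. t \<in> half_line - N \<Longrightarrow> P t"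
  shows "AE t in leb. P t"
proof -
  have "half_line \<inter> space lebesgue \<in> sets lebesgue"
    by (auto simp: half_line_def)
  moreover have "AE t in lebesgue. t \<notin> N"
    using assms(1) by (intro AE_not_in) (simp add: negligible_iff_null_sets)
  then have "AE t in lebesgue. t \<in> half_line \<longrightarrow> P t"
    by eventually_elim (use assms(2) in blast)
  ultimately show ?thesis
    by (simp add: AE_restrict_space_iff)
qed

lemma has_vector_derivative_cnj:
  "(f has_vector_derivative f') F \<Longrightarrow> ((\<lambda>t. cnj (f t)) has_vector_derivative cnj f') F"
  by (rule bounded_linear.has_vector_derivative[OF bounded_linear_cnj])

lemma has_vector_derivative_eq_zero:
  fixes f :: "real \<Rightarrow> complex"
  assumes f: "(f has_vector_derivative D) (at t within half_line)" and "t > 0"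
    and U: "open U" "t \<in> U" and zero: "\<And>s. s \<in> U \<Longrightarrow> f s = 0"
  shows "D = 0"
proof -
  have "t \<in> interior half_line"
    unfolding half_line_def interior_real_atLeast using \<open>t > 0\<close> by (rule greaterThan_iff[THEN iffD2])
  then have 1: "(f has_vector_derivative D) (at t)"
    using f by (simp only: at_within_interior)
  have 2: "(f has_vector_derivative 0) (at t)"
    by (rule has_vector_derivative_transform_within_open[OF has_vector_derivative_const U zero[symmetric]])
  show ?thesis by (rule vector_derivative_unique_at[OF 1 2])
qed

text \<open>The results about general strengths and general solutions use only that the points
  increase from 0 to infinity; the harmonic spacing comes in later as an instance.
  \<open>x 0\<close> is the end point of the half-line and not an interaction centre.\<close>

locale interaction_points =
  fixes x :: "nat \<Rightarrow> real"
  assumes x_0: "x 0 = 0"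
    and x_less_Suc: "x n < x (Suc n)"
    and x_unbounded: "\<exists>n. t < x n"
begin

abbreviation X :: "real set" where "X \<equiv> x ` {1..}"

lemma x_strict_mono: "strict_mono x"
  using x_less_Suc by (simp add: strict_mono_Suc_iff)

lemma x_less_iff [simp]: "x m < x n \<longleftrightarrow> m < n"
  using x_strict_mono by (simp add: strict_mono_less)

lemma x_le_iff [simp]: "x m \<le> x n \<longleftrightarrow> m \<le> n"
  using x_strict_mono by (simp add: strict_mono_less_eq)

lemma x_eq_iff [simp]: "x m = x n \<longleftrightarrow> m = n"
  using x_strict_mono by (simp add: strict_mono_eq)

lemma x_nonneg [simp]: "0 \<le> x n"
  using x_le_iff[of 0 n] x_0 by simp

lemma x_pos: "n \<ge> 1 \<Longrightarrow> 0 < x n"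
  using x_less_iff[of 0 n] x_0 by simp

lemma negligible_X: "negligible X"
  using countable_imp_null_set_lborel[of X] by (simp add: negligible_iff_null_sets null_sets_completionI)

lemma zero_notin_X: "0 \<notin> X"
  using x_pos by force

lemma interval_disjoint_X: "{x n<..<x (Suc n)} \<inter> X = {}"
proof -
  have False if "x n < x m" "x m < x (Suc n)" for m
    using that by simp
  then show ?thesis by fastforce
qed

lemma interval_subset: "{x n<..<x (Suc n)} \<subseteq> half_line - X"
  using interval_disjoint_X[of n] by (auto simp: half_line_def intro: order_trans[OF x_nonneg[of n]])

lemma initial_interval_subset: "{0..<x 1} \<subseteq> half_line - X"
proof
  fix t assume t: "t \<in> {0..<x 1}"
  show "t \<in> half_line - X"
  proof (cases "t = 0")
    case True then show ?thesis using zero_notin_X by (simp add: half_line_def)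
  next
    case False then show ?thesis using interval_subset[of 0] t x_0 by (simp add: subset_iff)
  qed
qed

lemma interval_of_point:
  assumes "t \<ge> 0"
  obtains n where "x n \<le> t" "t < x (Suc n)"
proof -
  define m where "m = (LEAST m. t < x m)"
  have m: "t < x m"
    unfolding m_def using x_unbounded[of t] by (rule LeastI_ex)
  have "m \<noteq> 0"
    using m assms x_0 by (intro notI) simp
  then obtain n where n: "m = Suc n"
    using not0_implies_Suc by blast
  moreover have "\<not> t < x n"
    using not_less_Least[of n "\<lambda>m. t < x m"] n by (simp flip: m_def)
  ultimately show ?thesis using m that[of n] by simp
qed

lemma interval_of_regular_point:
  assumes "t \<in> half_line - X" "t > 0"
  obtains n where "t \<in> {x n<..<x (Suc n)}"
proof -
  obtain n where n: "x n \<le> t" "t < x (Suc n)"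
    by (rule interval_of_point[OF less_imp_le[OF assms(2)]])
  have "t \<noteq> x n"
  proof (cases "n = 0")
    case True
    then show ?thesis using assms(2) x_0 by simp
  next
    case False
    then have "x n \<in> X" by simp
    then show ?thesis using assms(1) by blast
  qed
  with n that[of n] show ?thesis by simp
qed

text \<open>The conditions of \<open>delta_op_pre\<close> except compact support, so that the
  solution \<open>\<phi>\<close> belongs to it as soon as it is square integrable.\<close>

definition delta_domain ::
  "(nat \<Rightarrow> real) \<Rightarrow> (real \<Rightarrow> complex) \<Rightarrow> (real \<Rightarrow> complex) \<Rightarrow> (real \<Rightarrow> complex) \<Rightarrow> bool" where
  "delta_domain \<alpha> f f' f'' \<longleftrightarrow>
     W22 X f f' f'' \<and> f' 0 = 0 \<and> (\<forall>n\<ge>1. delta_condition (\<alpha> n) (x n) f f')"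

text \<open>The bracket \<open>G\<close> has equal one-sided limits at every interaction point and
  limit 0 at the origin, so the integral of its derivative telescopes. Bounded support of
  \<open>f\<close> alone removes the term at infinity, which allows \<open>g\<close> to be a
  solution with unbounded support.\<close>

theorem delta_domain_Green:
  assumes f: "delta_domain \<alpha> f f' f''" and g: "delta_domain \<alpha> g g' g''"
    and supp: "\<And>t. t > R \<Longrightarrow> f t = 0"
  shows "(\<integral>t. f'' t * cnj (g t) \<partial>leb) = (\<integral>t. f t * cnj (g'' t) \<partial>leb)"
proof -
  have fW: "W22 X f f' f''" and gW: "W22 X g g' g''"
    and f0: "f' 0 = 0" and g0: "g' 0 = 0"
    and fd: "\<And>n. n \<ge> 1 \<Longrightarrow> delta_condition (\<alpha> n) (x n) f f'"
    and gd: "\<And>n. n \<ge> 1 \<Longrightarrow> delta_condition (\<alpha> n) (x n) g g'"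
    using f g unfolding delta_domain_def by blast+
  define h where "h t = f'' t * cnj (g t) - f t * cnj (g'' t)" for t
  define G where "G t = f' t * cnj (g t) - f t * cnj (g' t)" for t
  have i: "integrable leb (\<lambda>t. f'' t * cnj (g t))" "integrable leb (\<lambda>t. f t * cnj (g'' t))"
    using fW gW unfolding W22_def by (blast intro: integrable_mult_cnj)+
  have "integrable leb h"
    unfolding h_def using i by auto
  then have hI: "(h has_integral (\<integral>t. h t \<partial>leb)) half_line"
    by (rule has_integral_integral_lebesgue_on) (auto simp: half_line_def)
  have h_int: "h integrable_on {c..d}" if "0 \<le> c" for c d
    using integrable_on_subinterval[of h half_line c d] hI that
    by (auto simp: half_line_def has_integral_integrable)
  obtain N1 where N1: "negligible N1"
    "\<And>t. t \<in> half_line - N1 \<Longrightarrow> (f' has_vector_derivative f'' t) (at t within half_line)"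
  proof -
    have "AE t in leb. (f' has_vector_derivative f'' t) (at t within half_line)"
      using fW by (simp add: W22_def)
    then show thesis by (rule AE_leb_negligible) (use that in blast)
  qed
  obtain N2 where N2: "negligible N2"
    "\<And>t. t \<in> half_line - N2 \<Longrightarrow> (g' has_vector_derivative g'' t) (at t within half_line)"
  proof -
    have "AE t in leb. (g' has_vector_derivative g'' t) (at t within half_line)"
      using gW by (simp add: W22_def)
    then show thesis by (rule AE_leb_negligible) (use that in blast)
  qed
  have FTC: "(h has_integral (G d - G c)) {c..d}" if cd: "c \<le> d" "{c..d} \<subseteq> half_line - X" for c d
  proof (rule fundamental_theorem_of_calculus_abs_cont[of c d G "N1 \<union> N2"])
    have "abs_cont_on c d f" "abs_cont_on c d f'" "abs_cont_on c d g" "abs_cont_on c d g'"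
      using fW gW cd by (auto simp: W22_def AC_loc_def)
    then show "abs_cont_on c d G"
      unfolding G_def by (intro abs_cont_on_diff abs_cont_on_mult abs_cont_on_cnj)
    fix t assume t: "t \<in> {c..d} - (N1 \<union> N2)"
    have sub: "{c..d} \<subseteq> half_line" using cd by auto
    have d: "(f has_vector_derivative f' t) (at t within {c..d})"
      "(g has_vector_derivative g' t) (at t within {c..d})"
      "(f' has_vector_derivative f'' t) (at t within {c..d})"
      "(g' has_vector_derivative g'' t) (at t within {c..d})"
      using fW gW N1(2)[of t] N2(2)[of t] t cd
      by (auto simp: W22_def intro!: has_vector_derivative_within_subset[OF _ sub])
    have "(G has_vector_derivative (f' t * cnj (g' t) + f'' t * cnj (g t))
        - (f t * cnj (g'' t) + f' t * cnj (g' t))) (at t within {c..d})"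
      unfolding G_def
      by (intro has_vector_derivative_mult has_vector_derivative_diff has_vector_derivative_cnj d)
    then show "(G has_vector_derivative h t) (at t within {c..d})"
      by (simp add: h_def)
  qed (use cd N1 N2 in auto)

  \<comment> \<open>One number \<open>L n\<close> serves for both sides of \<open>x n\<close>. At
    \<open>x 0\<close> there is no left side, and the limit is 0 by the Neumann conditions on
    \<open>f\<close> and \<open>g\<close>.\<close>
  have Lex: "\<forall>n. \<exists>L. (G \<longlongrightarrow> L) (at_right (x n)) \<and> (if n = 0 then L = 0 else (G \<longlongrightarrow> L) (at_left (x n)))"
  proof
    fix n
    show "\<exists>L. (G \<longlongrightarrow> L) (at_right (x n)) \<and> (if n = 0 then L = 0 else (G \<longlongrightarrow> L) (at_left (x n)))"
  proof (cases "n = 0")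
    case True
    define c where "c = x 1 / 2"
    have c: "0 < c" "{0..c} \<subseteq> half_line - X"
      using x_pos[of 1] initial_interval_subset by (auto simp: c_def subset_iff)
    have "abs_cont_on 0 c f" "abs_cont_on 0 c f'" "abs_cont_on 0 c g" "abs_cont_on 0 c g'"
      using fW gW c by (auto simp: W22_def AC_loc_def)
    then have "abs_cont_on 0 c G"
      unfolding G_def by (intro abs_cont_on_diff abs_cont_on_mult abs_cont_on_cnj)
    then have "(G \<longlongrightarrow> G 0) (at 0 within {0..c})"
      using abs_cont_on_imp_continuous_on[of 0 c G] c(1) by (simp add: continuous_on_def)
    then have "(G \<longlongrightarrow> 0) (at_right 0)"
      using c(1) f0 g0 by (simp add: at_within_Icc_at_right G_def)
    then show ?thesis using True x_0 by auto
  next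
    case False
    then have "n \<ge> 1" by simp
    obtain y p q where f: "(f \<longlongrightarrow> y) (at_right (x n))" "(f \<longlongrightarrow> y) (at_left (x n))"
      "(f' \<longlongrightarrow> p) (at_right (x n))" "(f' \<longlongrightarrow> q) (at_left (x n))" "p - q = complex_of_real (\<alpha> n) * y"
      using fd[OF \<open>n \<ge> 1\<close>] by (auto simp: delta_condition_def)
    obtain y2 p2 q2 where g: "(g \<longlongrightarrow> y2) (at_right (x n))" "(g \<longlongrightarrow> y2) (at_left (x n))"
      "(g' \<longlongrightarrow> p2) (at_right (x n))" "(g' \<longlongrightarrow> q2) (at_left (x n))" "p2 - q2 = complex_of_real (\<alpha> n) * y2"
      using gd[OF \<open>n \<ge> 1\<close>] by (auto simp: delta_condition_def)
    have R: "(G \<longlongrightarrow> p * cnj y2 - y * cnj p2) (at_right (x n))"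
      unfolding G_def by (intro tendsto_intros f g)
    have L: "(G \<longlongrightarrow> q * cnj y2 - y * cnj q2) (at_left (x n))"
      unfolding G_def by (intro tendsto_intros f g)
    have "p = q + complex_of_real (\<alpha> n) * y" "p2 = q2 + complex_of_real (\<alpha> n) * y2"
      using f(5) g(5) by (simp_all add: algebra_simps)
    \<comment> \<open>Both jumps contribute the same term \<open>\<alpha> n * y * cnj y2\<close>,
      because \<open>\<alpha> n\<close> is real; in the difference they cancel.\<close>
    then have "p * cnj y2 - y * cnj p2 = q * cnj y2 - y * cnj q2"
      by (simp add: algebra_simps)
    with R L False show ?thesis by auto
  qed
  qed
  from choice[OF Lex] obtain L where L: "\<forall>n. (G \<longlongrightarrow> L n) (at_right (x n)) \<and> (if n = 0 then L n = 0 else (G \<longlongrightarrow> L n) (at_left (x n)))"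
    by blast
  have LR: "(G \<longlongrightarrow> L n) (at_right (x n))" and L0: "L 0 = 0"
    and LL: "n \<noteq> 0 \<Longrightarrow> (G \<longlongrightarrow> L n) (at_left (x n))" for n
    using L by (auto split: if_splits)
  \<comment> \<open>\<open>FTC\<close> applies only to closed intervals that avoid \<open>X\<close>.
    The end points are reached by two limits, the right one with \<open>c\<close> fixed and then the
    left one, using that the indefinite integral \<open>I\<close> is continuous.\<close>
  have step: "integral {x n..x (Suc n)} h = L (Suc n) - L n" for n
  proof -
    define I where "I t = integral {x n..t} h" for t
    have lt: "x n < x (Suc n)" by simp
    have "continuous_on {x n..x (Suc n)} I"
      unfolding I_def by (intro indefinite_integral_continuous_1 h_int) simp
    then have "(I \<longlongrightarrow> I (x (Suc n))) (at (x (Suc n)) within {x n..x (Suc n)})"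
      "(I \<longlongrightarrow> I (x n)) (at (x n) within {x n..x (Suc n)})"
      by (auto simp: continuous_on_def)
    then have Icont: "(I \<longlongrightarrow> I (x (Suc n))) (at_left (x (Suc n)))" "(I \<longlongrightarrow> I (x n)) (at_right (x n))"
      using lt by (simp_all add: at_within_Icc_at_right at_within_Icc_at_left)
    have inc: "I d - I c = G d - G c" if "x n < c" "c \<le> d" "d < x (Suc n)" for c d
    proof -
      have "integral {x n..c} h + integral {c..d} h = integral {x n..d} h"
        using that by (intro Henstock_Kurzweil_Integration.integral_combine h_int) auto
      moreover have "{c..d} \<subseteq> half_line - X"
        using that interval_subset[of n] by (auto simp: subset_iff)
      then have "integral {c..d} h = G d - G c"
        using FTC that by blast
      ultimately show ?thesis by (simp add: I_def algebra_simps)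
    qed
    have 1: "I (x (Suc n)) - I c = L (Suc n) - G c" if c: "x n < c" "c < x (Suc n)" for c
    proof (rule tendsto_unique[of "at_left (x (Suc n))"])
      show "((\<lambda>d. I d - I c) \<longlongrightarrow> I (x (Suc n)) - I c) (at_left (x (Suc n)))"
        by (intro tendsto_intros Icont)
      have "((\<lambda>d. G d - G c) \<longlongrightarrow> L (Suc n) - G c) (at_left (x (Suc n)))"
        by (intro tendsto_intros LL) simp
      moreover have "\<forall>\<^sub>F d in at_left (x (Suc n)). G d - G c = I d - I c"
        using eventually_at_left_real[OF c(2)] by eventually_elim (use inc c in auto)
      ultimately show "((\<lambda>d. I d - I c) \<longlongrightarrow> L (Suc n) - G c) (at_left (x (Suc n)))"
        by (rule Lim_transform_eventually)
    qed simp
    have "I (x (Suc n)) - I (x n) = L (Suc n) - L n"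
    proof (rule tendsto_unique[of "at_right (x n)"])
      show "((\<lambda>c. I (x (Suc n)) - I c) \<longlongrightarrow> I (x (Suc n)) - I (x n)) (at_right (x n))"
        by (intro tendsto_intros Icont)
      have "((\<lambda>c. L (Suc n) - G c) \<longlongrightarrow> L (Suc n) - L n) (at_right (x n))"
        by (intro tendsto_intros LR)
      moreover have "\<forall>\<^sub>F c in at_right (x n). L (Suc n) - G c = I (x (Suc n)) - I c"
        using eventually_at_right_real[OF lt] by eventually_elim (use 1 in auto)
      ultimately show "((\<lambda>c. I (x (Suc n)) - I c) \<longlongrightarrow> L (Suc n) - L n) (at_right (x n))"
        by (rule Lim_transform_eventually)
    qed simp
    then show ?thesis by (simp add: I_def)
  qed
  have total: "integral {0..x n} h = L n" for n
  proof (induction n)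
    case 0 then show ?case by (simp add: x_0 L0)
  next
    case (Suc n)
    have "integral {0..x n} h + integral {x n..x (Suc n)} h = integral {0..x (Suc n)} h"
      by (intro Henstock_Kurzweil_Integration.integral_combine h_int) auto
    with Suc step[of n] show ?case by simp
  qed
  obtain n where n: "R < x n" using x_unbounded[of R] by auto
  have f'0: "f' t = 0" if t: "t > x n" "t \<notin> X" for t
  proof (rule has_vector_derivative_eq_zero[of f _ t "{R<..}"])
    have "t > 0" using t x_nonneg[of n] by linarith
    with t show "(f has_vector_derivative f' t) (at t within half_line)" "0 < t"
      using fW by (auto simp: W22_def half_line_def)
  qed (use n t supp in auto)
  have "L n = 0"
  proof (rule tendsto_unique[of "at_right (x n)", OF _ LR])
    have "\<forall>\<^sub>F t in at_right (x n). 0 = G t"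
      using eventually_at_right_real[OF x_less_Suc[of n]]
    proof eventually_elim
      case (elim t)
      then have "t > x n" "t \<notin> X" using interval_subset[of n] by auto
      moreover have "f t = 0" using elim n supp by auto
      ultimately show ?case using f'0 by (simp add: G_def)
    qed
    then show "(G \<longlongrightarrow> 0) (at_right (x n))"
      by (rule Lim_transform_eventually[OF tendsto_const])
  qed simp
  \<comment> \<open>\<open>f''\<close> is tied to \<open>f'\<close> only off the null set
    \<open>N1\<close>, so \<open>h\<close> is shown to vanish beyond \<open>x n\<close> almost
    everywhere, which is enough for its integral.\<close>
  have h0: "h t = 0" if t: "t \<in> half_line - (N1 \<union> X)" "t > x n" for t
  proof -
    have "t > 0" using t x_nonneg[of n] by linarith
    have "t \<in> half_line - X" using t by blast
    then obtain m where m: "t \<in> {x m<..<x (Suc m)}"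
      using \<open>t > 0\<close> by (rule interval_of_regular_point)
    have "f'' t = 0"
    proof (rule has_vector_derivative_eq_zero[of f' _ t "{x m<..<x (Suc m)} \<inter> {x n<..}"])
      show "f' s = 0" if "s \<in> {x m<..<x (Suc m)} \<inter> {x n<..}" for s
        using that interval_subset[of m] by (intro f'0) auto
    qed (use t m N1 \<open>t > 0\<close> in auto)
    moreover have "f t = 0" using supp t n by auto
    ultimately show ?thesis by (simp add: h_def)
  qed
  have "((\<lambda>t. if t \<in> {0..x n} then h t else 0) has_integral (\<integral>t. h t \<partial>leb)) half_line"
    by (rule has_integral_spike[OF _ _ hI, of "N1 \<union> X"])
      (use h0 N1 negligible_X in \<open>auto simp: half_line_def\<close>)
  then have "(h has_integral (\<integral>t. h t \<partial>leb)) {0..x n}"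
    by (subst (asm) has_integral_restrict) (auto simp: half_line_def)
  then have "(\<integral>t. h t \<partial>leb) = 0"
    using total[of n] \<open>L n = 0\<close> by (simp add: integral_unique)
  then show ?thesis
    unfolding h_def using i by simp
qed

end

section \<open>The Hilbert space structure\<close>

lemma l2_rel_refl_iff: "l2_rel f f \<longleftrightarrow> sq_integrable f"
  by (simp add: l2_rel_def)

lemma l2_cases:
  obtains f where "sq_integrable f" "u = abs_l2 f"
proof -
  have "l2_rel (rep_l2 u) (rep_l2 u)" by (rule Quotient3_rep_reflp[OF Quotient3_l2])
  moreover have "u = abs_l2 (rep_l2 u)" by (rule Quotient3_abs_rep[OF Quotient3_l2, symmetric])
  ultimately show ?thesis using that[of "rep_l2 u"] by (simp add: l2_rel_refl_iff)
qed

lemma abs_l2_eq_iff: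
  assumes "sq_integrable f" "sq_integrable g"
  shows "abs_l2 f = abs_l2 g \<longleftrightarrow> (AE t in leb. f t = g t)"
proof -
  have "abs_l2 f = abs_l2 g \<longleftrightarrow> l2_rel f g"
    using Quotient3_rel[OF Quotient3_l2, of f g] assms by (auto simp: l2_rel_refl_iff)
  then show ?thesis using assms by (simp add: l2_rel_def)
qed

lemma abs_l2_add:
  "sq_integrable f \<Longrightarrow> sq_integrable g \<Longrightarrow> abs_l2 f + abs_l2 g = abs_l2 (\<lambda>t. f t + g t)"
  by (rule plus_l2.abs_eq) (simp_all add: l2_rel_refl_iff)

lemma abs_l2_scale: "sq_integrable f \<Longrightarrow> c *\<^sub>C abs_l2 f = abs_l2 (\<lambda>t. c * f t)"
  by (rule scaleC_l2.abs_eq) (simp add: l2_rel_refl_iff)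

lemma abs_l2_zero: "abs_l2 (\<lambda>_. 0) = 0"
  by (rule zero_l2.abs_eq[symmetric])

lemma cinner_abs_l2:
  "sq_integrable f \<Longrightarrow> sq_integrable g \<Longrightarrow> cinner_l2 (abs_l2 f) (abs_l2 g) = (\<integral>t. f t * cnj (g t) \<partial>leb)"
  by (rule cinner_l2.abs_eq) (simp_all add: l2_rel_refl_iff)

lemma sq_integrable_diff:
  assumes "sq_integrable f" "sq_integrable g"
  shows "sq_integrable (\<lambda>t. f t - g t)"
  using sq_integrable_add[OF assms(1) sq_integrable_scale[OF assms(2), of "-1"]] by simp

lemma abs_l2_diff:
  assumes "sq_integrable f" "sq_integrable g"
  shows "abs_l2 f - abs_l2 g = abs_l2 (\<lambda>t. f t - g t)"
proof -
  have "abs_l2 f = abs_l2 (\<lambda>t. f t - g t) + abs_l2 g"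
    using assms by (simp add: abs_l2_add sq_integrable_diff)
  then show ?thesis by simp
qed

lemma norm_abs_l2:
  assumes "sq_integrable f"
  shows "(norm (abs_l2 f))\<^sup>2 = (\<integral>t. (cmod (f t))\<^sup>2 \<partial>leb)"
proof -
  have "(\<lambda>t. f t * cnj (f t)) = (\<lambda>t. complex_of_real ((cmod (f t))\<^sup>2))"
    by (simp only: complex_norm_square)
  then have "inner (abs_l2 f) (abs_l2 f) = (\<integral>t. (cmod (f t))\<^sup>2 \<partial>leb)"
    using assms by (simp add: inner_l2_def cinner_abs_l2 integral_complex_of_real del: of_real_power)
  then show ?thesis by (simp add: power2_norm_eq_inner)
qed

text \<open>Reduces continuity of the complex inner product to that of the real one.\<close>

lemma cinner_eq_Complex: "cinner_l2 f u = Complex (inner f u) (inner f (\<i> *\<^sub>C u))"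
proof -
  have "cinner_l2 f (\<i> *\<^sub>C u) = - \<i> * cinner_l2 f u"
    using cinner_commute[of f "\<i> *\<^sub>C u"] cinner_commute[of f u] by (simp add: cinner_scaleC_left)
  then show ?thesis by (simp add: inner_l2_def complex_eq_iff)
qed

lemma cinner_scaleC_right: "cinner_l2 f (c *\<^sub>C g) = cnj c * cinner_l2 f g"
  by (subst (1 2) cinner_commute) (simp add: cinner_scaleC_left)

lemma cinner_diff_left: "cinner_l2 (f - g) h = cinner_l2 f h - cinner_l2 g h"
  using cinner_add_left[of "f - g" g h] by simp

lemma cinner_diff_right: "cinner_l2 h (f - g) = cinner_l2 h f - cinner_l2 h g"
  by (subst (1 2 3) cinner_commute) (simp add: cinner_diff_left)

lemma cinner_zero_left: "cinner_l2 0 u = 0"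
  using cinner_diff_left[of 0 0 u] by simp

lemma continuous_on_cinner_left: "continuous_on UNIV (\<lambda>f. cinner_l2 f u)"
  unfolding cinner_eq_Complex by (intro continuous_intros)

lemma norm_scaleC_l2: "norm (c *\<^sub>C f) = cmod c * norm (f :: l2)"
proof -
  have "(norm (c *\<^sub>C f))\<^sup>2 = Re (c * cnj c * cinner_l2 f f)"
    by (simp only: power2_norm_eq_inner inner_l2_def cinner_scaleC_left cinner_scaleC_right mult.assoc mult.left_commute)
  also have "\<dots> = (cmod c)\<^sup>2 * (norm f)\<^sup>2"
    by (simp add: complex_norm_square[symmetric] power2_norm_eq_inner inner_l2_def flip: of_real_power)
  finally show ?thesis
    by (metis norm_ge_zero power2_eq_imp_eq power_mult_distrib zero_le_mult_iff)
qed

lemma continuous_on_scaleC: "continuous_on UNIV (\<lambda>f. c *\<^sub>C f)"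
proof (rule bounded_linear.continuous_on[OF _ continuous_on_id], rule bounded_linear_intro)
  show "c *\<^sub>C (f + g) = c *\<^sub>C f + c *\<^sub>C g" for f g
    by (rule l2.scale_right_distrib)
  show "c *\<^sub>C (r *\<^sub>R f) = r *\<^sub>R (c *\<^sub>C f)" for r f
    by (simp add: scaleR_l2_def mult.commute)
  show "norm (c *\<^sub>C f) \<le> norm f * cmod c" for f
    by (simp add: norm_scaleC_l2)
qed

lemma orthogonal_dense_eq_zero:
  assumes dense: "closure D = UNIV" and orth: "\<And>f. f \<in> D \<Longrightarrow> cinner_l2 f w = 0"
  shows "w = 0"
proof -
  have "closure D \<subseteq> {f. cinner_l2 f w = 0}"
  proof (rule closure_minimal)
    show "closed {f. cinner_l2 f w = 0}"
      by (intro closed_Collect_eq continuous_on_cinner_left continuous_on_const)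
  qed (use orth in auto)
  then have "cinner_l2 w w = 0" using dense by auto
  then show ?thesis using cinner_self(2)[of w] by simp
qed

section \<open>Adjoints and closures of operators given by graphs\<close>

lemma closed_adjoint_relation: "closed {(f, g). cinner_l2 g u = cinner_l2 f v}"
proof -
  have "closed {p. cinner_l2 (snd p) u = cinner_l2 (fst p) v}"
    by (intro closed_Collect_eq continuous_on_compose2[OF continuous_on_cinner_left]
        continuous_intros) auto
  then show ?thesis by (simp add: split_def)
qed

lemma adjoint_relation_closure:
  assumes "\<And>f g. (f, g) \<in> T \<Longrightarrow> cinner_l2 g u = cinner_l2 f v" and "(f, g) \<in> closure T"
  shows "cinner_l2 g u = cinner_l2 f v"
proof -
  have "closure T \<subseteq> {(f, g). cinner_l2 g u = cinner_l2 f v}"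
    by (rule closure_minimal[OF _ closed_adjoint_relation]) (use assms(1) in auto)
  then show ?thesis using assms(2) by blast
qed

text \<open>Allows the deficiency spaces to be computed with the explicit functions of
  \<open>delta_op_pre\<close>, although \<open>delta_op\<close> is its closure.\<close>

lemma adjoint_operator_closure: "adjoint_operator (closure T) = adjoint_operator T"
proof (rule set_eqI)
  fix p :: "l2 \<times> l2"
  obtain u v where p: "p = (u, v)" by (cases p)
  have "(\<forall>(f, g)\<in>closure T. cinner_l2 g u = cinner_l2 f v) \<longleftrightarrow> (\<forall>(f, g)\<in>T. cinner_l2 g u = cinner_l2 f v)"
    using closure_subset[of T] adjoint_relation_closure[of T u v] by blast
  then show "p \<in> adjoint_operator (closure T) \<longleftrightarrow> p \<in> adjoint_operator T"
    by (simp add: adjoint_operator_def p)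
qed

text \<open>A densely defined symmetric operator is closable: if \<open>(0, g)\<close> lies in the
  closed graph, then \<open>g\<close> is orthogonal to the dense domain. Symmetry itself passes to
  the closure in one argument at a time.\<close>

lemma symmetric_operator_closure:
  fixes T :: l2_op
  assumes zero: "(0, 0) \<in> T"
    and add: "\<And>f g f' g'. (f, g) \<in> T \<Longrightarrow> (f', g') \<in> T \<Longrightarrow> (f + f', g + g') \<in> T"
    and scale: "\<And>c f g. (f, g) \<in> T \<Longrightarrow> (c *\<^sub>C f, c *\<^sub>C g) \<in> T"
    and dense: "closure (Domain T) = UNIV"
    and sym: "\<And>f g f' g'. (f, g) \<in> T \<Longrightarrow> (f', g') \<in> T \<Longrightarrow> cinner_l2 g f' = cinner_l2 f g'"
  shows "symmetric_operator (closure T)"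
proof -
  have zero': "(0, 0) \<in> closure T"
    using zero closure_subset by blast
  have add': "(f + f', g + g') \<in> closure T" if fg: "(f, g) \<in> closure T" "(f', g') \<in> closure T" for f g f' g'
  proof -
    obtain p where p: "\<And>n. p n \<in> T" "p \<longlonglongrightarrow> (f, g)" using fg(1) unfolding closure_sequential by blast
    obtain q where q: "\<And>n. q n \<in> T" "q \<longlonglongrightarrow> (f', g')" using fg(2) unfolding closure_sequential by blast
    have "p n + q n \<in> T" for n
      using add[of "fst (p n)" "snd (p n)" "fst (q n)" "snd (q n)"] p(1)[of n] q(1)[of n]
      by (simp add: plus_prod_def)
    moreover have "(\<lambda>n. p n + q n) \<longlonglongrightarrow> (f, g) + (f', g')"
      by (intro tendsto_add p q)
    ultimately show ?thesis
      unfolding closure_sequential by (intro exI[of _ "\<lambda>n. p n + q n"]) simp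
  qed
  have scale': "(c *\<^sub>C f, c *\<^sub>C g) \<in> closure T" if "(f, g) \<in> closure T" for c f g
  proof -
    have "(\<lambda>p. (c *\<^sub>C fst p, c *\<^sub>C snd p)) ` closure T \<subseteq> closure T"
    proof (rule image_closure_subset)
      show "continuous_on (closure T) (\<lambda>p. (c *\<^sub>C fst p, c *\<^sub>C snd p))"
        by (intro continuous_intros continuous_on_compose2[OF continuous_on_scaleC]) auto
      show "(\<lambda>p. (c *\<^sub>C fst p, c *\<^sub>C snd p)) ` T \<subseteq> closure T"
        using scale closure_subset[of T] by force
    qed simp
    with that show ?thesis by force
  qed
  have dense': "closure (Domain (closure T)) = UNIV"
    using closure_mono[OF Domain_mono[OF closure_subset[of T]]] dense by auto
  have sym1: "cinner_l2 g f' = cinner_l2 f g'" if "(f, g) \<in> closure T" "(f', g') \<in> T" for f g f' g'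
    by (rule adjoint_relation_closure[OF _ that(1)]) (use sym that(2) in blast)
  have sym': "cinner_l2 g f' = cinner_l2 f g'" if "(f, g) \<in> closure T" "(f', g') \<in> closure T" for f g f' g'
  proof -
    have "cinner_l2 g' f = cinner_l2 f' g"
    proof (rule adjoint_relation_closure[OF _ that(2)])
      fix f1 g1 assume "(f1, g1) \<in> T"
      from sym1[OF that(1) this] show "cinner_l2 g1 f = cinner_l2 f1 g"
        using cinner_commute[of g f1] cinner_commute[of f g1] by simp
    qed
    then show ?thesis
      using cinner_commute[of g f'] cinner_commute[of f g'] by simp
  qed
  have "single_valued (closure T)"
  proof (rule single_valuedI)
    fix f g g' assume *: "(f, g) \<in> closure T" "(f, g') \<in> closure T"
    have "(f + (- 1) *\<^sub>C f, g + (- 1) *\<^sub>C g') \<in> closure T"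
      by (intro add' scale' *)
    then have 0: "(0, g - g') \<in> closure T"
      by (simp add: l2.scale_minus_left)
    have "g - g' = 0"
    proof (rule orthogonal_dense_eq_zero[OF dense])
      fix h assume "h \<in> Domain T"
      then obtain k where "(h, k) \<in> T" by auto
      then have "cinner_l2 (g - g') h = 0"
        using sym1[OF 0] by (simp add: cinner_zero_left)
      then show "cinner_l2 h (g - g') = 0"
        using cinner_commute[of h "g - g'"] by simp
    qed
    then show "g = g'" by simp
  qed
  with zero' add' scale' dense' sym' show ?thesis
    unfolding symmetric_operator_def linear_operator_def by blast
qed

lemma cdimension_span_singleton:
  assumes "w \<noteq> 0"
  shows "cdimension (l2.span {w}) = 1"
proof -
  have "l2.independent {w}"
    using assms by (simp add: l2.independent_insert)
  then have "l2.dim (l2.span {w}) = 1"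
    by (simp add: l2.dim_eq_card_independent)
  moreover have "\<exists>B. finite B \<and> l2.span {w} \<subseteq> l2.span B"
    by (intro exI[of _ "{w}"]) simp
  ultimately show ?thesis
    by (simp add: cdimension_def one_enat_def)
qed

text \<open>Serves both approximations in the density proof: truncating an arbitrary element and
  smoothing a bounded one. The differences are dominated in square by
  \<open>2 * w^2 + 2 * |f|^2\<close>.\<close>

lemma l2_dominated_convergence:
  assumes f: "sq_integrable f" and w: "integrable leb (\<lambda>t. (w t)\<^sup>2)"
    and s: "\<And>n. s n \<in> borel_measurable leb" "\<And>n t. t \<in> half_line \<Longrightarrow> cmod (s n t) \<le> w t"
    and lim: "AE t in leb. (\<lambda>n. s n t) \<longlonglongrightarrow> f t"
  shows "\<And>n. sq_integrable (s n)" and "(\<lambda>n. abs_l2 (s n)) \<longlonglongrightarrow> abs_l2 f"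
proof -
  have [measurable]: "f \<in> borel_measurable leb" "\<And>n. s n \<in> borel_measurable leb"
    and fi: "integrable leb (\<lambda>t. (cmod (f t))\<^sup>2)"
    using f s by (auto simp: sq_integrable_def)
  have space: "t \<in> half_line" if "t \<in> space leb" for t using that by simp
  show sq: "sq_integrable (s n)" for n
    unfolding sq_integrable_def
  proof
    show "integrable leb (\<lambda>t. (cmod (s n t))\<^sup>2)"
    proof (rule Bochner_Integration.integrable_bound[OF w])
      show "AE t in leb. norm ((cmod (s n t))\<^sup>2) \<le> norm ((w t)\<^sup>2)"
        using s(2) by (intro AE_I2) (simp add: power_mono)
    qed measurable
  qed (rule s)
  have "(\<lambda>n. \<integral>t. (cmod (s n t - f t))\<^sup>2 \<partial>leb) \<longlonglongrightarrow> (\<integral>t. 0 \<partial>leb)"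
  proof (rule integral_dominated_convergence[where w = "\<lambda>t. 2 * (w t)\<^sup>2 + 2 * (cmod (f t))\<^sup>2"])
    show "AE t in leb. (\<lambda>n. (cmod (s n t - f t))\<^sup>2) \<longlonglongrightarrow> 0"
      using lim
    proof eventually_elim
      case (elim t)
      then have "(\<lambda>n. (cmod (s n t - f t))\<^sup>2) \<longlonglongrightarrow> (cmod (f t - f t))\<^sup>2"
        by (intro tendsto_intros)
      then show ?case by simp
    qed
    show "AE t in leb. norm ((cmod (s n t - f t))\<^sup>2) \<le> 2 * (w t)\<^sup>2 + 2 * (cmod (f t))\<^sup>2" for n
    proof (rule AE_I2)
      fix t assume t: "t \<in> space leb"
      have "(cmod (s n t - f t))\<^sup>2 \<le> (w t + cmod (f t))\<^sup>2"
        using s(2)[OF space[OF t], of n] norm_triangle_ineq4[of "s n t" "f t"]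
        by (intro power_mono) auto
      also have "\<dots> \<le> 2 * (w t)\<^sup>2 + 2 * (cmod (f t))\<^sup>2"
        using zero_le_power2[of "w t - cmod (f t)"] by (simp add: power2_eq_square algebra_simps)
      finally show "norm ((cmod (s n t - f t))\<^sup>2) \<le> 2 * (w t)\<^sup>2 + 2 * (cmod (f t))\<^sup>2" by simp
    qed
  qed (use w fi in auto)
  then have "(\<lambda>n. (norm (abs_l2 (s n) - abs_l2 f))\<^sup>2) \<longlonglongrightarrow> 0"
    using sq f by (simp add: abs_l2_diff norm_abs_l2 sq_integrable_diff)
  then have "(\<lambda>n. sqrt ((norm (abs_l2 (s n) - abs_l2 f))\<^sup>2)) \<longlonglongrightarrow> sqrt 0"
    by (rule tendsto_real_sqrt)
  then show "(\<lambda>n. abs_l2 (s n)) \<longlonglongrightarrow> abs_l2 f"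
    by (simp add: tendsto_norm_zero_iff LIM_zero_iff)
qed

section \<open>The minimal operator\<close>

lemma half_line_sets [simp]: "half_line \<in> sets lebesgue"
  by (simp add: half_line_def)

lemma integrable_truncate:
  fixes u :: "real \<Rightarrow> 'b::euclidean_space"
  assumes "continuous_on {0..R} u"
  shows "integrable leb (\<lambda>t. if t \<le> R then u t else 0)"
proof -
  have "integrable (lebesgue_on {0..R}) u"
    using assms continuous_imp_integrable[of 0 R u] by simp
  then have "integrable lebesgue (\<lambda>t. indicat_real {0..R} t *\<^sub>R u t)"
    by (subst (asm) integrable_restrict_space) auto
  also have "(\<lambda>t. indicat_real {0..R} t *\<^sub>R u t)
      = (\<lambda>t. indicat_real half_line t *\<^sub>R (if t \<le> R then u t else 0))"
    by (auto simp: half_line_def indicator_def)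
  finally show ?thesis
    by (subst integrable_restrict_space) auto
qed

lemma sq_integrable_truncate:
  assumes "continuous_on {0..R} u"
  shows "sq_integrable (\<lambda>t. if t \<le> R then u t else 0)"
  unfolding sq_integrable_def
proof
  show "(\<lambda>t. if t \<le> R then u t else 0) \<in> borel_measurable leb"
    using integrable_truncate[OF assms] by (rule borel_measurable_integrable)
  have "integrable leb (\<lambda>t. if t \<le> R then (cmod (u t))\<^sup>2 else 0)"
    by (intro integrable_truncate continuous_intros assms)
  then show "integrable leb (\<lambda>t. (cmod (if t \<le> R then u t else 0))\<^sup>2)"
    by (rule back_subst[of "integrable leb"]) auto
qed

lemma AC_loc_add: "AC_loc S f \<Longrightarrow> AC_loc S g \<Longrightarrow> AC_loc S (\<lambda>t. f t + g t)"
  by (simp add: AC_loc_def abs_cont_on_add)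

lemma AC_loc_scale: "AC_loc S f \<Longrightarrow> AC_loc S (\<lambda>t. c * f t)"
  by (simp add: AC_loc_def abs_cont_on_mult[OF abs_cont_on_const])

lemma W22_add:
  assumes "W22 S f f' f''" "W22 S g g' g''"
  shows "W22 S (\<lambda>t. f t + g t) (\<lambda>t. f' t + g' t) (\<lambda>t. f'' t + g'' t)"
  unfolding W22_def
proof (intro conjI ballI)
  have "AE t in leb. (f' has_vector_derivative f'' t) (at t within half_line)"
    "AE t in leb. (g' has_vector_derivative g'' t) (at t within half_line)"
    using assms by (auto simp: W22_def)
  then show "AE t in leb. ((\<lambda>t. f' t + g' t) has_vector_derivative f'' t + g'' t) (at t within half_line)"
    by eventually_elim (rule has_vector_derivative_add)
qed (use assms in \<open>auto simp: W22_def intro: sq_integrable_add AC_loc_add has_vector_derivative_add\<close>)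

lemma has_vector_derivative_cmult:
  fixes f :: "real \<Rightarrow> complex"
  shows "(f has_vector_derivative f') F \<Longrightarrow> ((\<lambda>t. c * f t) has_vector_derivative c * f') F"
  by (rule bounded_linear.has_vector_derivative[OF bounded_linear_mult_right])

lemma W22_scale:
  assumes "W22 S f f' f''"
  shows "W22 S (\<lambda>t. c * f t) (\<lambda>t. c * f' t) (\<lambda>t. c * f'' t)"
  unfolding W22_def
proof (intro conjI ballI)
  have "AE t in leb. (f' has_vector_derivative f'' t) (at t within half_line)"
    using assms by (auto simp: W22_def)
  then show "AE t in leb. ((\<lambda>t. c * f' t) has_vector_derivative c * f'' t) (at t within half_line)"
    by eventually_elim (rule has_vector_derivative_cmult)
qed (use assms in \<open>auto simp: W22_def intro: sq_integrable_scale AC_loc_scale has_vector_derivative_cmult\<close>)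

lemma AC_loc_C1:
  assumes "\<And>t. t \<in> S \<Longrightarrow> (f has_vector_derivative f' t) (at t within half_line)"
    and "continuous_on S f'" "S \<subseteq> half_line"
  shows "AC_loc S f"
  unfolding AC_loc_def
proof (intro allI impI)
  fix a b :: real assume ab: "{a..b} \<subseteq> S"
  show "abs_cont_on a b f"
  proof (rule abs_cont_on_C1[of _ _ _ f'])
    show "(f has_vector_derivative f' t) (at t within {a..b})" if "t \<in> {a..b}" for t
      by (rule has_vector_derivative_within_subset[OF assms(1)]) (use ab assms(3) that in auto)
  qed (use ab assms(2) continuous_on_subset in blast)
qed

lemma continuous_on_vector_derivative_within:
  assumes "\<And>t. t \<in> S \<Longrightarrow> (f has_vector_derivative f' t) (at t within half_line)" "S \<subseteq> half_line"
  shows "continuous_on S f"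
proof -
  have "continuous (at t within S) f" if "t \<in> S" for t
    by (rule has_vector_derivative_continuous, rule has_vector_derivative_within_subset[OF assms(1)[OF that] assms(2)])
  then show ?thesis by (simp add: continuous_on_eq_continuous_within)
qed

text \<open>The functions constructed below have continuous second derivatives off the interaction
  points. The C1 criterion on compact subintervals then gives local absolute continuity, and the
  exceptional points form a null set.\<close>

lemma W22_classical:
  assumes sq: "sq_integrable f" "sq_integrable f''"
    and f': "\<And>t. t \<in> half_line - S \<Longrightarrow> (f has_vector_derivative f' t) (at t within half_line)"
    and f'': "\<And>t. t \<in> half_line - S \<Longrightarrow> (f' has_vector_derivative f'' t) (at t within half_line)"
    and cont: "continuous_on (half_line - S) f''" and S: "negligible S"
  shows "W22 S f f' f''"
proof -
  have "continuous_on (half_line - S) f'"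
    by (rule continuous_on_vector_derivative_within[OF f'']) auto
  then have "AC_loc (half_line - S) f"
    by (intro AC_loc_C1[where f' = f'] f') auto
  moreover have "AC_loc (half_line - S) f'"
    by (intro AC_loc_C1[where f' = f''] f'' cont) auto
  moreover have "AE t in leb. (f' has_vector_derivative f'' t) (at t within half_line)"
    by (rule negligible_AE_leb[OF S f''])
  ultimately show ?thesis
    using sq f' by (simp add: W22_def)
qed

lemma delta_condition_add:
  assumes "delta_condition \<beta> t f f'" "delta_condition \<beta> t g g'"
  shows "delta_condition \<beta> t (\<lambda>s. f s + g s) (\<lambda>s. f' s + g' s)"
proof -
  obtain y p q where f: "(f \<longlongrightarrow> y) (at_right t)" "(f \<longlongrightarrow> y) (at_left t)"
    "(f' \<longlongrightarrow> p) (at_right t)" "(f' \<longlongrightarrow> q) (at_left t)" "p - q = complex_of_real \<beta> * y"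
    using assms(1) by (auto simp: delta_condition_def)
  obtain y2 p2 q2 where g: "(g \<longlongrightarrow> y2) (at_right t)" "(g \<longlongrightarrow> y2) (at_left t)"
    "(g' \<longlongrightarrow> p2) (at_right t)" "(g' \<longlongrightarrow> q2) (at_left t)" "p2 - q2 = complex_of_real \<beta> * y2"
    using assms(2) by (auto simp: delta_condition_def)
  have eq: "p + p2 - (q + q2) = complex_of_real \<beta> * (y + y2)"
    using f(5) g(5) by (simp add: algebra_simps)
  show ?thesis
    unfolding delta_condition_def
    by (intro exI[of _ "y + y2"] exI[of _ "p + p2"] exI[of _ "q + q2"] conjI tendsto_add f(1-4) g(1-4) eq)
qed

lemma delta_condition_scale:
  assumes "delta_condition \<beta> t f f'"
  shows "delta_condition \<beta> t (\<lambda>s. c * f s) (\<lambda>s. c * f' s)"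
proof -
  obtain y p q where f: "(f \<longlongrightarrow> y) (at_right t)" "(f \<longlongrightarrow> y) (at_left t)"
    "(f' \<longlongrightarrow> p) (at_right t)" "(f' \<longlongrightarrow> q) (at_left t)" "p - q = complex_of_real \<beta> * y"
    using assms(1) by (auto simp: delta_condition_def)
  have eq: "c * p - c * q = complex_of_real \<beta> * (c * y)"
    using f(5) by (simp add: algebra_simps flip: right_diff_distrib)
  show ?thesis
    unfolding delta_condition_def
    by (intro exI[of _ "c * y"] exI[of _ "c * p"] exI[of _ "c * q"] conjI tendsto_mult_left f(1-4) eq)
qed

lemma compact_support_iff:
  "compact (closure {t \<in> half_line. f t \<noteq> 0}) \<longleftrightarrow> (\<exists>R. \<forall>t>R. 0 \<le> t \<longrightarrow> f t = 0)" for f :: "real \<Rightarrow> complex"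
proof
  assume "compact (closure {t \<in> half_line. f t \<noteq> 0})"
  then have "bounded {t \<in> half_line. f t \<noteq> 0}" by simp
  then obtain R where R: "\<forall>t\<in>{t \<in> half_line. f t \<noteq> 0}. norm t \<le> R"
    unfolding bounded_iff by blast
  show "\<exists>R. \<forall>t>R. 0 \<le> t \<longrightarrow> f t = 0"
  proof (intro exI[of _ R] allI impI)
    fix t assume t: "R < t" "0 \<le> t"
    then show "f t = 0" using bspec[OF R, of t] by (force simp: half_line_def)
  qed
next
  assume "\<exists>R. \<forall>t>R. 0 \<le> t \<longrightarrow> f t = 0"
  then obtain R where R: "\<And>t. R < t \<Longrightarrow> 0 \<le> t \<Longrightarrow> f t = 0" by blast
  have "{t \<in> half_line. f t \<noteq> 0} \<subseteq> {0..R}"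
    using R by (force simp: half_line_def not_less[symmetric])
  then have "bounded {t \<in> half_line. f t \<noteq> 0}"
    by (rule bounded_subset[rotated]) simp
  then show "compact (closure {t \<in> half_line. f t \<noteq> 0})" by simp
qed

section \<open>Linearity and symmetry of the operator before closing\<close>

context interaction_points
begin

lemma delta_domain_add:
  "delta_domain \<alpha> f f' f'' \<Longrightarrow> delta_domain \<alpha> g g' g'' \<Longrightarrow>
    delta_domain \<alpha> (\<lambda>t. f t + g t) (\<lambda>t. f' t + g' t) (\<lambda>t. f'' t + g'' t)"
  by (simp add: delta_domain_def W22_add delta_condition_add)

lemma delta_domain_scale:
  "delta_domain \<alpha> f f' f'' \<Longrightarrow> delta_domain \<alpha> (\<lambda>t. c * f t) (\<lambda>t. c * f' t) (\<lambda>t. c * f'' t)"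
  by (simp add: delta_domain_def W22_scale delta_condition_scale)

lemma delta_op_pre_iff:
  "p \<in> delta_op_pre x \<alpha> \<longleftrightarrow> (\<exists>f f' f'' R. p = (abs_l2 f, abs_l2 (\<lambda>t. - f'' t))
     \<and> delta_domain \<alpha> f f' f'' \<and> R \<ge> 0 \<and> (\<forall>t>R. f t = 0))"
proof
  assume "p \<in> delta_op_pre x \<alpha>"
  then obtain f f' f'' where *: "p = (abs_l2 f, abs_l2 (\<lambda>t. - f'' t))" "delta_domain \<alpha> f f' f''"
    "compact (closure {t \<in> half_line. f t \<noteq> 0})"
    by (auto simp: delta_op_pre_def W22_comp_def delta_domain_def)
  then obtain R where R: "\<forall>t>R. 0 \<le> t \<longrightarrow> f t = 0"
    unfolding compact_support_iff by blast
  \<comment> \<open>Compact support controls \<open>f\<close> on the half-line only; with a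
    nonnegative bound, the side condition \<open>0 \<le> t\<close> holds automatically.\<close>
  then have "max R 0 \<ge> 0" "\<forall>t>max R 0. f t = 0"
    by simp_all
  with *(1,2) show "\<exists>f f' f'' R. p = (abs_l2 f, abs_l2 (\<lambda>t. - f'' t))
     \<and> delta_domain \<alpha> f f' f'' \<and> R \<ge> 0 \<and> (\<forall>t>R. f t = 0)" by blast
next
  assume "\<exists>f f' f'' R. p = (abs_l2 f, abs_l2 (\<lambda>t. - f'' t))
     \<and> delta_domain \<alpha> f f' f'' \<and> R \<ge> 0 \<and> (\<forall>t>R. f t = 0)"
  then obtain f f' f'' R where *: "p = (abs_l2 f, abs_l2 (\<lambda>t. - f'' t))" "delta_domain \<alpha> f f' f''"
    "\<forall>t>R. f t = 0" by blast
  then have "compact (closure {t \<in> half_line. f t \<noteq> 0})"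
    unfolding compact_support_iff by blast
  with * show "p \<in> delta_op_pre x \<alpha>"
    unfolding delta_op_pre_def W22_comp_def delta_domain_def by blast
qed

lemma delta_op_preI:
  "delta_domain \<alpha> f f' f'' \<Longrightarrow> R \<ge> 0 \<Longrightarrow> (\<And>t. t > R \<Longrightarrow> f t = 0) \<Longrightarrow>
    (abs_l2 f, abs_l2 (\<lambda>t. - f'' t)) \<in> delta_op_pre x \<alpha>"
  unfolding delta_op_pre_iff by blast

lemma delta_op_preE:
  assumes "(u, v) \<in> delta_op_pre x \<alpha>"
  obtains f f' f'' R where "u = abs_l2 f" "v = abs_l2 (\<lambda>t. - f'' t)" "delta_domain \<alpha> f f' f''"
    "R \<ge> 0" "\<And>t. t > R \<Longrightarrow> f t = 0" "sq_integrable f" "sq_integrable (\<lambda>t. - f'' t)"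
proof -
  obtain f f' f'' R where f: "u = abs_l2 f" "v = abs_l2 (\<lambda>t. - f'' t)" "delta_domain \<alpha> f f' f''"
    "R \<ge> 0" "\<forall>t>R. f t = 0"
    using assms unfolding delta_op_pre_iff by blast
  moreover from f(3) have "sq_integrable f" "sq_integrable (\<lambda>t. - f'' t)"
    using sq_integrable_scale[of f'' "-1"] by (simp_all add: delta_domain_def W22_def)
  ultimately show ?thesis using that[of f f'' f' R] by blast
qed

lemma delta_op_pre_zero: "(0, 0) \<in> delta_op_pre x \<alpha>"
proof -
  have "W22 X (\<lambda>_. 0) (\<lambda>_. 0) (\<lambda>_. 0)"
    by (rule W22_classical) (auto simp only: sq_integrable_zero has_vector_derivative_const continuous_on_const negligible_X)
  moreover have "delta_condition (\<alpha> n) (x n) (\<lambda>_. 0) (\<lambda>_. 0)" for n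
    unfolding delta_condition_def by (rule exI[of _ 0])+ simp
  ultimately have "delta_domain \<alpha> (\<lambda>_. 0) (\<lambda>_. 0) (\<lambda>_. 0)"
    by (simp add: delta_domain_def)
  from delta_op_preI[OF this, of 0] show ?thesis by (simp add: abs_l2_zero)
qed

lemma delta_op_pre_add:
  assumes "(u, v) \<in> delta_op_pre x \<alpha>" "(u', v') \<in> delta_op_pre x \<alpha>"
  shows "(u + u', v + v') \<in> delta_op_pre x \<alpha>"
proof -
  obtain f f' f'' R where f: "u = abs_l2 f" "v = abs_l2 (\<lambda>t. - f'' t)" "delta_domain \<alpha> f f' f''"
    "R \<ge> 0" "\<And>t. t > R \<Longrightarrow> f t = 0" "sq_integrable f" "sq_integrable (\<lambda>t. - f'' t)"
    by (rule delta_op_preE[OF assms(1)], rule that)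
  obtain g g' g'' R' where g: "u' = abs_l2 g" "v' = abs_l2 (\<lambda>t. - g'' t)" "delta_domain \<alpha> g g' g''"
    "R' \<ge> 0" "\<And>t. t > R' \<Longrightarrow> g t = 0" "sq_integrable g" "sq_integrable (\<lambda>t. - g'' t)"
    by (rule delta_op_preE[OF assms(2)], rule that)
  have "(abs_l2 (\<lambda>t. f t + g t), abs_l2 (\<lambda>t. - (f'' t + g'' t))) \<in> delta_op_pre x \<alpha>"
    by (rule delta_op_preI[OF delta_domain_add[OF f(3) g(3)], of "max R R'"]) (use f g in auto)
  then show ?thesis
    by (simp add: f(1,2) g(1,2) abs_l2_add[OF f(6) g(6)] abs_l2_add[OF f(7) g(7)] algebra_simps)
qed

lemma delta_op_pre_scale:
  assumes "(u, v) \<in> delta_op_pre x \<alpha>"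
  shows "(c *\<^sub>C u, c *\<^sub>C v) \<in> delta_op_pre x \<alpha>"
proof -
  obtain f f' f'' R where f: "u = abs_l2 f" "v = abs_l2 (\<lambda>t. - f'' t)" "delta_domain \<alpha> f f' f''"
    "R \<ge> 0" "\<And>t. t > R \<Longrightarrow> f t = 0" "sq_integrable f" "sq_integrable (\<lambda>t. - f'' t)"
    by (rule delta_op_preE[OF assms(1)], rule that)
  have "(abs_l2 (\<lambda>t. c * f t), abs_l2 (\<lambda>t. - (c * f'' t))) \<in> delta_op_pre x \<alpha>"
    by (rule delta_op_preI[OF delta_domain_scale[OF f(3)], of R]) (use f in auto)
  then show ?thesis
    by (simp add: f(1,2) abs_l2_scale[OF f(6)] abs_l2_scale[OF f(7)])
qed

text \<open>Used in two ways: with compactly supported \<open>g\<close> it is the symmetry of the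
  operator, and with \<open>g = \<phi>\<close> it places the solution in the kernel of the adjoint
  minus \<open>z\<close>.\<close>

lemma delta_op_pre_Green:
  assumes "(u, v) \<in> delta_op_pre x \<alpha>" and g: "delta_domain \<alpha> g g' g''"
  shows "cinner_l2 v (abs_l2 g) = cinner_l2 u (abs_l2 (\<lambda>t. - g'' t))"
proof -
  obtain f f' f'' R where f: "u = abs_l2 f" "v = abs_l2 (\<lambda>t. - f'' t)" "delta_domain \<alpha> f f' f''"
    "R \<ge> 0" "\<And>t. t > R \<Longrightarrow> f t = 0" "sq_integrable f" "sq_integrable (\<lambda>t. - f'' t)"
    by (rule delta_op_preE[OF assms(1)], rule that)
  have sq: "sq_integrable g" "sq_integrable (\<lambda>t. - g'' t)"
    using g sq_integrable_scale[of g'' "-1"] by (simp_all add: delta_domain_def W22_def)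
  have "(\<integral>t. f'' t * cnj (g t) \<partial>leb) = (\<integral>t. f t * cnj (g'' t) \<partial>leb)"
    using delta_domain_Green[OF f(3) g f(5)] .
  then show ?thesis
    by (simp add: f(1,2) cinner_abs_l2 f(6,7) sq)
qed

lemma delta_op_pre_symmetric:
  assumes "(u, v) \<in> delta_op_pre x \<alpha>" "(u', v') \<in> delta_op_pre x \<alpha>"
  shows "cinner_l2 v u' = cinner_l2 u v'"
proof -
  obtain g g' g'' R' where g: "u' = abs_l2 g" "v' = abs_l2 (\<lambda>t. - g'' t)" "delta_domain \<alpha> g g' g''"
    "R' \<ge> 0" "\<And>t. t > R' \<Longrightarrow> g t = 0" "sq_integrable g" "sq_integrable (\<lambda>t. - g'' t)"
    by (rule delta_op_preE[OF assms(2)], rule that)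
  show ?thesis using delta_op_pre_Green[OF assms(1) g(3)] g(1,2) by simp
qed

end

section \<open>Density of the domain\<close>

text \<open>Double zeros at \<open>x 0, ..., x N\<close> make a function satisfy the Neumann
  condition and the delta conditions there whatever the strengths, since value and jump are both
  zero. They also permit cutting it off to zero beyond \<open>x N\<close> while the first derivative
  stays continuous.\<close>

definition C2_zeros :: "real set \<Rightarrow> (real \<Rightarrow> complex) \<Rightarrow> bool" where
  "C2_zeros A F \<longleftrightarrow> (\<exists>F' F''. (\<forall>t. (F has_vector_derivative F' t) (at t))
     \<and> (\<forall>t. (F' has_vector_derivative F'' t) (at t)) \<and> continuous_on UNIV F''
     \<and> (\<forall>c\<in>A. F c = 0 \<and> F' c = 0))"

lemma C2_zerosE:
  assumes "C2_zeros A F"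
  obtains F' F'' where "\<And>t. (F has_vector_derivative F' t) (at t)"
    "\<And>t. (F' has_vector_derivative F'' t) (at t)" "continuous_on UNIV F''"
    "\<And>c. c \<in> A \<Longrightarrow> F c = 0" "\<And>c. c \<in> A \<Longrightarrow> F' c = 0"
proof -
  obtain F' F'' where F: "(\<forall>t. (F has_vector_derivative F' t) (at t))
     \<and> (\<forall>t. (F' has_vector_derivative F'' t) (at t)) \<and> continuous_on UNIV F''
     \<and> (\<forall>c\<in>A. F c = 0 \<and> F' c = 0)"
    using assms unfolding C2_zeros_def by (elim exE)
  show ?thesis by (rule that[of F' F'']) (use F in simp_all)
qed

lemma continuous_on_vector_derivative:
  assumes "\<And>t. (f has_vector_derivative f' t) (at t)"
  shows "continuous_on UNIV f"
  by (intro continuous_at_imp_continuous_on ballI has_vector_derivative_continuous[OF assms])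

lemma C2_zeros_mult:
  assumes "C2_zeros A F" "C2_zeros B G"
  shows "C2_zeros (A \<union> B) (\<lambda>t. F t * G t)"
proof -
  obtain F' F'' where F: "\<And>t. (F has_vector_derivative F' t) (at t)"
    "\<And>t. (F' has_vector_derivative F'' t) (at t)" "continuous_on UNIV F''"
    "\<And>c. c \<in> A \<Longrightarrow> F c = 0" "\<And>c. c \<in> A \<Longrightarrow> F' c = 0"
    by (rule C2_zerosE[OF assms(1)], rule that)
  obtain G' G'' where G: "\<And>t. (G has_vector_derivative G' t) (at t)"
    "\<And>t. (G' has_vector_derivative G'' t) (at t)" "continuous_on UNIV G''"
    "\<And>c. c \<in> B \<Longrightarrow> G c = 0" "\<And>c. c \<in> B \<Longrightarrow> G' c = 0"
    by (rule C2_zerosE[OF assms(2)], rule that)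
  have cont: "continuous_on UNIV F" "continuous_on UNIV F'" "continuous_on UNIV G" "continuous_on UNIV G'"
    by (rule continuous_on_vector_derivative, rule F G)+
  show ?thesis
    unfolding C2_zeros_def
  proof (intro exI conjI allI ballI)
    show "((\<lambda>t. F t * G t) has_vector_derivative F t * G' t + F' t * G t) (at t)" for t
      by (intro has_vector_derivative_mult F G)
    show "((\<lambda>t. F t * G' t + F' t * G t) has_vector_derivative
        (F t * G'' t + F' t * G' t) + (F' t * G' t + F'' t * G t)) (at t)" for t
      by (intro has_vector_derivative_add has_vector_derivative_mult F G)
    show "continuous_on UNIV (\<lambda>t. (F t * G'' t + F' t * G' t) + (F' t * G' t + F'' t * G t))"
      by (intro continuous_intros F G cont)
    show "F c * G c = 0" "F c * G' c + F' c * G c = 0" if "c \<in> A \<union> B" for c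
      using that F(4,5)[of c] G(4,5)[of c] by auto
  qed
qed

lemma C2_zeros_polynomial:
  fixes p :: "real \<Rightarrow> complex"
  assumes "polynomial_function p"
  shows "C2_zeros {} p"
proof -
  obtain p' where p': "polynomial_function p'" "\<And>t. (p has_vector_derivative p' t) (at t)"
    using has_vector_derivative_polynomial_function[OF assms] by blast
  obtain p'' where p'': "polynomial_function p''" "\<And>t. (p' has_vector_derivative p'' t) (at t)"
    using has_vector_derivative_polynomial_function[OF p'(1)] by blast
  show ?thesis
    unfolding C2_zeros_def using p'(2) p'' continuous_on_polymonial_function[of p'' UNIV]
    by (intro exI[of _ p'] exI[of _ p'']) auto
qed

text \<open>A rational function with a double zero at 0 and values in [0,1] that converges to 1 away
  from 0 as \<open>r\<close> grows. Multiplying by shifted copies forces double zeros at finitely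
  many points at an \<open>L^2\<close> cost that tends to zero.\<close>

definition bump :: "real \<Rightarrow> real \<Rightarrow> real" where
  "bump r t = 1 - 1 / (1 + r\<^sup>2 * t\<^sup>2)"

lemma bump_bounds: "0 \<le> bump r t" "bump r t \<le> 1"
  by (simp_all add: bump_def divide_simps add_nonneg_eq_0_iff not_less add_pos_nonneg)

lemma bump_tendsto:
  assumes "t \<noteq> 0"
  shows "(\<lambda>n. bump (real n) t) \<longlonglongrightarrow> 1"
proof -
  have "t\<^sup>2 > 0" using assms by simp
  then have "(\<lambda>n. 1 - 1 / (1 + (real n)\<^sup>2 * t\<^sup>2)) \<longlonglongrightarrow> 1"
    by real_asymp
  then show ?thesis by (simp add: bump_def)
qed

lemma has_vector_derivative_complex_of_real:
  assumes "(f has_real_derivative f') (at t)"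
  shows "((\<lambda>t. complex_of_real (f t)) has_vector_derivative complex_of_real f') (at t)"
  by (rule bounded_linear.has_vector_derivative[OF bounded_linear_of_real])
    (use assms in \<open>simp add: has_real_derivative_iff_has_vector_derivative\<close>)

lemma C2_zeros_bump: "C2_zeros {c} (\<lambda>t. complex_of_real (bump r (t - c)))"
proof -
  define D where "D t = 1 + r\<^sup>2 * (t - c)\<^sup>2" for t
  have D: "D t \<noteq> 0" for t
    unfolding D_def by (metis add_nonneg_eq_0_iff mult_nonneg_nonneg zero_le_one zero_le_power2 zero_neq_one)
  have D': "(D has_real_derivative 2 * r\<^sup>2 * (t - c)) (at t)" for t
    unfolding D_def by (auto intro!: derivative_eq_intros)
  have Dc: "continuous_on UNIV D"
    unfolding D_def by (intro continuous_intros)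
  have "((\<lambda>t. 1 - 1 / D t) has_real_derivative 2 * r\<^sup>2 * (t - c) / (D t)\<^sup>2) (at t)" for t
    by (rule derivative_eq_intros D' D refl | simp add: D power2_eq_square)+
  then have 1: "((\<lambda>t. bump r (t - c)) has_real_derivative 2 * r\<^sup>2 * (t - c) / (D t)\<^sup>2) (at t)" for t
    by (simp add: bump_def D_def)
  have 2: "((\<lambda>t. 2 * r\<^sup>2 * (t - c) / (D t)\<^sup>2) has_real_derivative
      (2 * r\<^sup>2 * (D t)\<^sup>2 - 2 * r\<^sup>2 * (t - c) * (2 * D t * (2 * r\<^sup>2 * (t - c)))) / ((D t)\<^sup>2 * (D t)\<^sup>2)) (at t)" for t
    by (rule derivative_eq_intros D' D refl | simp add: D)+
  show ?thesis
    unfolding C2_zeros_def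
  proof (intro exI conjI allI)
    show "((\<lambda>t. complex_of_real (bump r (t - c))) has_vector_derivative
        complex_of_real (2 * r\<^sup>2 * (t - c) / (D t)\<^sup>2)) (at t)" for t
      by (rule has_vector_derivative_complex_of_real[OF 1])
    show "((\<lambda>t. complex_of_real (2 * r\<^sup>2 * (t - c) / (D t)\<^sup>2)) has_vector_derivative
        complex_of_real ((2 * r\<^sup>2 * (D t)\<^sup>2 - 2 * r\<^sup>2 * (t - c) * (2 * D t * (2 * r\<^sup>2 * (t - c)))) / ((D t)\<^sup>2 * (D t)\<^sup>2))) (at t)" for t
      by (rule has_vector_derivative_complex_of_real[OF 2])
    show "continuous_on UNIV (\<lambda>t. complex_of_real ((2 * r\<^sup>2 * (D t)\<^sup>2
        - 2 * r\<^sup>2 * (t - c) * (2 * D t * (2 * r\<^sup>2 * (t - c)))) / ((D t)\<^sup>2 * (D t)\<^sup>2)))"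
      using D by (intro continuous_intros Dc) auto
  qed (simp add: bump_def)
qed

lemma C2_zeros_bump_prod:
  "C2_zeros (c ` {..N}) (\<lambda>t. complex_of_real (\<Prod>k\<le>N. bump r (t - c k)))" for c :: "nat \<Rightarrow> real"
proof (induction N)
  case 0
  then show ?case using C2_zeros_bump[of "c 0" r] by simp
next
  case (Suc N)
  have "c ` {..Suc N} = c ` {..N} \<union> {c (Suc N)}" by (auto simp: atMost_Suc)
  then show ?case
    using C2_zeros_mult[OF Suc C2_zeros_bump[of "c (Suc N)" r]] by simp
qed

context interaction_points
begin

lemma C2_zeros_delta_domain:
  assumes "C2_zeros (x ` {..N}) F" "N \<ge> 1"
  shows "\<exists>f' f''. delta_domain \<alpha> (\<lambda>t. if t \<le> x N then F t else 0) f' f''"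
    and "continuous_on half_line (\<lambda>t. if t \<le> x N then F t else 0)"
proof -
  obtain F' F'' where F: "\<And>t. (F has_vector_derivative F' t) (at t)"
    "\<And>t. (F' has_vector_derivative F'' t) (at t)" "continuous_on UNIV F''"
    "\<And>c. c \<in> x ` {..N} \<Longrightarrow> F c = 0" "\<And>c. c \<in> x ` {..N} \<Longrightarrow> F' c = 0"
    by (rule C2_zerosE[OF assms(1)], rule that)
  have cont: "continuous_on UNIV F" "continuous_on UNIV F'"
    by (rule continuous_on_vector_derivative, rule F)+
  define f where "f t = (if t \<le> x N then F t else 0)" for t
  define f' where "f' t = (if t \<le> x N then F' t else 0)" for t
  define f'' where "f'' t = (if t \<le> x N then F'' t else 0)" for t
  \<comment> \<open>The cut is made at an interaction point because \<open>f''\<close> may jump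
    there, and \<open>W22\<close> demands nothing at points of \<open>X\<close>. This is where
    \<open>N \<ge> 1\<close> matters, as \<open>x 0\<close> is not in \<open>X\<close>.\<close>
  have xN: "x N \<in> X" using assms(2) by simp
  have der: "((\<lambda>t. if t \<le> x N then H t else 0) has_vector_derivative (if t \<le> x N then H' t else 0)) (at t)"
    if H: "\<And>t. (H has_vector_derivative H' t) (at t)" and t: "t \<noteq> x N" for H H' :: "real \<Rightarrow> complex" and t
  proof (cases "t < x N")
    case True
    show ?thesis
      by (rule has_vector_derivative_transform_within_open[of H _ _ "{..<x N}"])
        (use H[of t] True in auto)
  next
    case False
    show ?thesis
      by (rule has_vector_derivative_transform_within_open[of "\<lambda>_. 0" _ _ "{x N<..}"])
        (use False t in auto)
  qed
  have contU: "continuous_on UNIV f" "continuous_on UNIV f'"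
    unfolding f_def f'_def
    by (rule continuous_on_cases_le; use F(4,5) in \<open>auto intro: continuous_on_subset[OF cont(1)] continuous_on_subset[OF cont(2)]\<close>)+
  have "continuous_on ({..<x N} \<union> {x N<..}) f''"
  proof (rule continuous_on_open_Un)
    show "continuous_on {..<x N} f''"
      by (rule continuous_on_eq[OF continuous_on_subset[OF F(3)]]) (auto simp: f''_def)
    show "continuous_on {x N<..} f''"
      by (rule continuous_on_eq[OF continuous_on_const[of _ 0]]) (auto simp: f''_def)
  qed auto
  then have contf'': "continuous_on (half_line - X) f''"
    by (rule continuous_on_subset) (use xN in auto)
  have W: "W22 X f f' f''"
  proof (rule W22_classical[OF _ _ _ _ contf'' negligible_X])
    show "sq_integrable f" "sq_integrable f''"
      unfolding f_def f''_def
      by (intro sq_integrable_truncate continuous_on_subset[OF cont(1)] continuous_on_subset[OF F(3)] subset_UNIV)+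
    fix t assume "t \<in> half_line - X"
    then have t: "t \<noteq> x N" using xN by auto
    show "(f has_vector_derivative f' t) (at t within half_line)"
      unfolding f_def f'_def by (rule has_vector_derivative_at_within, rule der[OF F(1) t])
    show "(f' has_vector_derivative f'' t) (at t within half_line)"
      unfolding f'_def f''_def by (rule has_vector_derivative_at_within, rule der[OF F(2) t])
  qed
  have "delta_condition (\<alpha> n) (x n) f f'" for n
  proof -
    have lim: "(f \<longlongrightarrow> f (x n)) (at (x n))" "(f' \<longlongrightarrow> f' (x n)) (at (x n))"
      using contU by (auto simp: continuous_on_eq_continuous_at isCont_def)
    have "f (x n) = 0"
      using F(4)[of "x n"] by (auto simp: f_def)
    then have eq: "f' (x n) - f' (x n) = complex_of_real (\<alpha> n) * f (x n)" by simp
    have "(f \<longlongrightarrow> f (x n)) (at_right (x n))" "(f \<longlongrightarrow> f (x n)) (at_left (x n))"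
      "(f' \<longlongrightarrow> f' (x n)) (at_right (x n))" "(f' \<longlongrightarrow> f' (x n)) (at_left (x n))"
      using lim by (simp_all add: filterlim_at_split)
    with eq show ?thesis
      unfolding delta_condition_def by (intro exI conjI)
  qed
  moreover have "f' 0 = 0" using F(5)[of "x 0"] x_0 by (simp add: f'_def)
  ultimately have "delta_domain \<alpha> f f' f''" using W by (simp add: delta_domain_def)
  then show "\<exists>f' f''. delta_domain \<alpha> (\<lambda>t. if t \<le> x N then F t else 0) f' f''"
    unfolding f_def by blast
  show "continuous_on half_line (\<lambda>t. if t \<le> x N then F t else 0)"
    using continuous_on_subset[OF contU(1)] unfolding f_def by blast
qed

text \<open>Continuity of the representative is recorded so that the same dense set can supply the
  right-hand sides \<open>h\<close> for variation of constants.\<close>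

definition test_functions :: "(nat \<Rightarrow> real) \<Rightarrow> l2 set" where
  "test_functions \<alpha> = {abs_l2 f | f f' f'' R. delta_domain \<alpha> f f' f'' \<and> 0 \<le> R
     \<and> (\<forall>t>R. f t = 0) \<and> continuous_on half_line f}"

lemma test_functions_Domain: "test_functions \<alpha> \<subseteq> Domain (delta_op_pre x \<alpha>)"
  unfolding test_functions_def by (auto intro: delta_op_preI)

text \<open>Almost everywhere, \<open>g\<close> is a limit of continuous functions. These are
  clipped to the bound \<open>M\<close>, replaced by polynomials up to \<open>1 / (n + 1)\<close>,
  multiplied by bumps to obtain double zeros, and cut off at an interaction point beyond the
  support. Dominated convergence turns pointwise into \<open>L^2\<close> convergence.\<close>

lemma bounded_in_closure_test_functions:
  assumes g: "g \<in> borel_measurable leb" and M: "M > 0" "\<And>t. cmod (g t) \<le> M" and R: "\<And>t. t > R \<Longrightarrow> g t = 0"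
  shows "abs_l2 g \<in> closure (test_functions \<alpha>)"
proof -
  obtain N where N: "R < x N" using x_unbounded[of R] by blast
  define N' where "N' = Suc N"
  have N': "N' \<ge> 1" "R < x N'" using N x_less_Suc[of N] by (auto simp: N'_def intro: less_trans)
  have "g measurable_on half_line"
    using g by (simp add: measurable_on_iff_borel_measurable)
  then obtain Z c where Z: "negligible Z" and c: "\<And>n. continuous_on UNIV (c n)"
    and clim: "\<And>t. t \<notin> Z \<Longrightarrow> (\<lambda>n. c n t) \<longlonglongrightarrow> (if t \<in> half_line then g t else 0)"
    unfolding measurable_on_def by blast
  \<comment> \<open>The radial retraction onto the disc of radius \<open>M\<close>. It is continuous
    and fixes the values of \<open>g\<close>, and it supplies the uniform bound that the
    approximants \<open>c n\<close> may lack.\<close>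
  define clip where "clip z = complex_of_real (M / max M (cmod z)) * z" for z
  have clip_le: "cmod (clip z) \<le> M" for z
    using M(1) by (auto simp: clip_def norm_mult norm_divide max_def divide_simps)
  have clip_id: "clip z = z" if "cmod z \<le> M" for z
    using that M(1) by (simp add: clip_def max_def)
  have clip_cont: "continuous_on UNIV clip"
    unfolding clip_def using M(1) by (intro continuous_intros) auto
  have "\<exists>p. polynomial_function p \<and> (\<forall>t\<in>{0..x N'}. norm (clip (c n t) - p t) < 1 / real (Suc n))" for n
    by (rule Stone_Weierstrass_polynomial_function)
      (auto intro!: continuous_on_compose2[OF clip_cont] continuous_on_subset[OF c])
  then obtain p where p: "\<And>n. polynomial_function (p n)"
    and papp: "\<And>n t. t \<in> {0..x N'} \<Longrightarrow> norm (clip (c n t) - p n t) < 1 / real (Suc n)"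
    by metis
  define q where "q n t = complex_of_real (\<Prod>k\<le>N'. bump (real n) (t - x k)) * p n t" for n t
  define s where "s n t = (if t \<le> x N' then q n t else 0)" for n t
  have C2: "C2_zeros (x ` {..N'}) (q n)" for n
    using C2_zeros_mult[OF C2_zeros_bump_prod[of x N' "real n"] C2_zeros_polynomial[OF p[of n]]]
    unfolding q_def by simp
  have s_test: "abs_l2 (s n) \<in> test_functions \<alpha>" for n
  proof -
    obtain f' f'' where "delta_domain \<alpha> (s n) f' f''"
      using C2_zeros_delta_domain(1)[OF C2 N'(1), of \<alpha> n] unfolding s_def by blast
    moreover have "continuous_on half_line (s n)"
      using C2_zeros_delta_domain(2)[OF C2 N'(1), of n] unfolding s_def by blast
    moreover have "\<forall>t>x N'. s n t = 0" by (simp add: s_def)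
    ultimately show ?thesis
      unfolding test_functions_def using x_nonneg by blast
  qed
  have qc: "continuous_on UNIV (q n)" for n
    using C2[of n] by (rule C2_zerosE) (rule continuous_on_vector_derivative)
  \<comment> \<open>The \<open>+ 1\<close> accounts for the error of the polynomial approximation;
    the bump factors are at most 1.\<close>
  define w where "w t = (if t \<le> x N' then M + 1 else 0)" for t
  have prod1: "\<bar>\<Prod>k\<le>N'. bump (real n) (t - x k)\<bar> \<le> 1" for n t
    unfolding abs_prod using bump_bounds by (intro prod_le_1) (auto simp: abs_of_nonneg)
  have "(\<lambda>n. abs_l2 (s n)) \<longlonglongrightarrow> abs_l2 g"
  proof (rule l2_dominated_convergence(2)[where w = w])
    have "integrable leb (\<lambda>t. if t \<le> x N' then (M + 1)\<^sup>2 else 0)"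
      by (intro integrable_truncate continuous_intros)
    then show w2: "integrable leb (\<lambda>t. (w t)\<^sup>2)"
      by (rule back_subst[of "integrable leb"]) (auto simp: w_def)
    have gw: "cmod (g t) \<le> w t" for t
    proof (cases "t \<le> x N'")
      case True
      then show ?thesis using M(2)[of t] by (simp add: w_def)
    next
      case False
      then have "g t = 0" using N'(2) by (intro R) simp
      then show ?thesis using False by (simp add: w_def)
    qed
    have "integrable leb (\<lambda>t. (cmod (g t))\<^sup>2)"
    proof (rule Bochner_Integration.integrable_bound[OF w2])
      show "AE t in leb. norm ((cmod (g t))\<^sup>2) \<le> norm ((w t)\<^sup>2)"
        using gw by (intro AE_I2) (simp add: power_mono)
      show "(\<lambda>t. (cmod (g t))\<^sup>2) \<in> borel_measurable leb" using g by measurable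
    qed
    with g show "sq_integrable g"
      by (simp add: sq_integrable_def)
    show "s n \<in> borel_measurable leb" for n
      using sq_integrable_truncate[OF continuous_on_subset[OF qc[of n]], of "x N'"]
      unfolding s_def sq_integrable_def by simp
    show "cmod (s n t) \<le> w t" if "t \<in> half_line" for n t
    proof (cases "t \<le> x N'")
      case True
      then have t: "t \<in> {0..x N'}" using that by (simp add: half_line_def)
      have "cmod (p n t) \<le> cmod (clip (c n t)) + cmod (clip (c n t) - p n t)"
        by (metis norm_triangle_sub norm_minus_commute)
      also have "\<dots> \<le> M + 1 / real (Suc n)"
        using clip_le[of "c n t"] papp[OF t, of n] by linarith
      also have "\<dots> \<le> M + 1" by simp
      finally have "cmod (p n t) \<le> M + 1" .
      then have "\<bar>\<Prod>k\<le>N'. bump (real n) (t - x k)\<bar> * cmod (p n t) \<le> 1 * (M + 1)"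
        by (intro mult_mono prod1) auto
      then show ?thesis using True by (simp add: s_def q_def w_def norm_mult del: of_real_prod)
    qed (simp add: s_def w_def)
    show "AE t in leb. (\<lambda>n. s n t) \<longlonglongrightarrow> g t"
    proof (rule negligible_AE_leb)
      show "negligible (Z \<union> (X \<union> {0}))"
        using Z negligible_X by auto
      fix t assume t: "t \<in> half_line - (Z \<union> (X \<union> {0}))"
      have tx: "t - x k \<noteq> 0" for k
        using t x_0 by (cases "k = 0") auto
      show "(\<lambda>n. s n t) \<longlonglongrightarrow> g t"
      proof (cases "t \<le> x N'")
        case True
        then have t': "t \<in> {0..x N'}" using t by (simp add: half_line_def)
        have "(\<lambda>n. clip (c n t)) \<longlonglongrightarrow> clip (g t)"
          using clim[of t] t by (intro continuous_on_tendsto_compose[OF clip_cont]) auto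
        then have 1: "(\<lambda>n. clip (c n t)) \<longlonglongrightarrow> g t"
          using clip_id M(2) by simp
        have "(\<lambda>n. clip (c n t) - p n t) \<longlonglongrightarrow> 0"
        proof (rule tendsto_norm_zero_cancel, rule tendsto_sandwich[of "\<lambda>_. 0" _ _ "\<lambda>n. 1 / real (Suc n)"])
          show "(\<lambda>n. 1 / real (Suc n)) \<longlonglongrightarrow> 0" by real_asymp
          show "\<forall>\<^sub>F n in sequentially. cmod (clip (c n t) - p n t) \<le> 1 / real (Suc n)"
            using papp[OF t'] by (intro always_eventually allI less_imp_le)
        qed auto
        from tendsto_diff[OF 1 this] have 2: "(\<lambda>n. p n t) \<longlonglongrightarrow> g t" by simp
        have "(\<lambda>n. \<Prod>k\<le>N'. bump (real n) (t - x k)) \<longlonglongrightarrow> (\<Prod>k\<le>N'. 1)"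
          by (intro tendsto_prod bump_tendsto tx)
        then have "(\<lambda>n. complex_of_real (\<Prod>k\<le>N'. bump (real n) (t - x k))) \<longlonglongrightarrow> complex_of_real 1"
          by (intro tendsto_of_real) simp
        from tendsto_mult[OF this 2] show ?thesis
          using True by (simp add: s_def q_def)
      next
        case False
        then have "g t = 0" using N'(2) by (intro R) simp
        then show ?thesis using False by (simp add: s_def)
      qed
    qed
  qed
  then show ?thesis
    unfolding closure_sequential using s_test by (intro exI[of _ "\<lambda>n. abs_l2 (s n)"] conjI allI)
qed

text \<open>Truncation in both the argument and the value reduces an arbitrary element to bounded
  functions with bounded support, and a closed set contains the limits of its sequences.\<close>

theorem closure_test_functions: "closure (test_functions \<alpha>) = UNIV"
proof (intro equalityI subset_UNIV subsetI)
  fix u :: l2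
  obtain f where f: "sq_integrable f" and u: "u = abs_l2 f" by (rule l2_cases)
  define s where "s n t = (if t \<le> real n \<and> cmod (f t) \<le> real n then f t else 0)" for n t
  have [measurable]: "f \<in> borel_measurable leb" using f by (simp add: sq_integrable_def)
  have id: "(\<lambda>t. t) \<in> borel_measurable leb"
    by (intro measurable_restrict_space1 measurable_completion) simp
  have meas: "s n \<in> borel_measurable leb" for n
  proof -
    note id[measurable]
    show ?thesis unfolding s_def by measurable
  qed
  have "(\<lambda>n. abs_l2 (s n)) \<longlonglongrightarrow> u"
    unfolding u
  proof (rule l2_dominated_convergence(2)[where w = "\<lambda>t. cmod (f t)", OF f _ meas])
    show "integrable leb (\<lambda>t. (cmod (f t))\<^sup>2)" using f by (simp add: sq_integrable_def)
    show "cmod (s n t) \<le> cmod (f t)" for n t by (simp add: s_def)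
    show "AE t in leb. (\<lambda>n. s n t) \<longlonglongrightarrow> f t"
    proof (rule AE_I2)
      fix t
      have "\<forall>\<^sub>F n in sequentially. max t (cmod (f t)) \<le> real n"
        by (rule eventually_at_top_linorderI[of "nat \<lceil>max t (cmod (f t))\<rceil>"]) linarith
      then have "\<forall>\<^sub>F n in sequentially. f t = s n t"
        by eventually_elim (simp add: s_def)
      then show "(\<lambda>n. s n t) \<longlonglongrightarrow> f t"
        by (rule Lim_transform_eventually[OF tendsto_const])
    qed
  qed
  moreover have "abs_l2 (s n) \<in> closure (test_functions \<alpha>)" for n
    by (rule bounded_in_closure_test_functions[OF meas, of "real n + 1" _ "real n"]) (auto simp: s_def)
  ultimately show "u \<in> closure (test_functions \<alpha>)"
    using closed_sequentially[OF closed_closure, of "\<lambda>n. abs_l2 (s n)" "test_functions \<alpha>" u] by simp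
qed

theorem symmetric_operator_delta_op: "symmetric_operator (delta_op x \<alpha>)"
  unfolding delta_op_def
proof (rule symmetric_operator_closure)
  show "closure (Domain (delta_op_pre x \<alpha>)) = UNIV"
    using closure_mono[OF test_functions_Domain[of \<alpha>]] closure_test_functions[of \<alpha>] by auto
qed (fact delta_op_pre_zero delta_op_pre_add delta_op_pre_scale delta_op_pre_symmetric)+

end

section \<open>The deficiency space\<close>

lemma sq_integrable_compact_support:
  assumes "continuous_on half_line f" "\<And>t. t > R \<Longrightarrow> f t = 0"
  shows "sq_integrable f"
proof -
  have "sq_integrable (\<lambda>t. if t \<le> R then f t else 0)"
    by (rule sq_integrable_truncate[OF continuous_on_subset[OF assms(1)]]) (auto simp: half_line_def)
  also have "(\<lambda>t. if t \<le> R then f t else 0) = f"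
    using assms(2) by (intro ext) simp
  finally show ?thesis .
qed

lemma has_vector_derivative_integral_half_line:
  fixes u :: "real \<Rightarrow> complex"
  assumes "continuous_on half_line u" "t \<in> half_line"
  shows "((\<lambda>t. integral {0..t} u) has_vector_derivative u t) (at t within half_line)"
proof -
  have "((\<lambda>t. integral {0..t} u) has_vector_derivative u t) (at t within {0..t + 1})"
    by (rule integral_has_vector_derivative[OF continuous_on_subset[OF assms(1)]])
      (use assms(2) in \<open>auto simp: half_line_def\<close>)
  moreover have "at t within {0..t + 1} = at t within half_line"
    by (rule at_within_nhd[of t "{..<t + 1}"]) (auto simp: half_line_def)
  ultimately show ?thesis by simp
qed

text \<open>The factor \<open>C\<close> is not differentiated in the second slot: in variation of
  constants the terms containing the derivatives of the varied constants cancel, so the derivative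
  of the solution has exactly this shape.\<close>

lemma delta_condition_mult:
  assumes "delta_condition \<beta> t f f'" "(C \<longlongrightarrow> c) (at t)"
  shows "delta_condition \<beta> t (\<lambda>s. f s * C s) (\<lambda>s. f' s * C s)"
proof -
  obtain y p q where f: "(f \<longlongrightarrow> y) (at_right t)" "(f \<longlongrightarrow> y) (at_left t)"
    "(f' \<longlongrightarrow> p) (at_right t)" "(f' \<longlongrightarrow> q) (at_left t)" "p - q = complex_of_real \<beta> * y"
    using assms(1) by (auto simp: delta_condition_def)
  have C: "(C \<longlongrightarrow> c) (at_right t)" "(C \<longlongrightarrow> c) (at_left t)"
    using assms(2) by (simp_all add: filterlim_at_split)
  have eq: "p * c - q * c = complex_of_real \<beta> * (y * c)"
    using f(5) by (simp flip: left_diff_distrib)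
  show ?thesis
    unfolding delta_condition_def
    by (intro exI[of _ "y * c"] exI[of _ "p * c"] exI[of _ "q * c"] conjI tendsto_mult f(1-4) C eq)
qed

lemma delta_condition_cnj:
  assumes "delta_condition \<beta> t f f'"
  shows "delta_condition \<beta> t (\<lambda>s. cnj (f s)) (\<lambda>s. cnj (f' s))"
proof -
  obtain y p q where f: "(f \<longlongrightarrow> y) (at_right t)" "(f \<longlongrightarrow> y) (at_left t)"
    "(f' \<longlongrightarrow> p) (at_right t)" "(f' \<longlongrightarrow> q) (at_left t)" "p - q = complex_of_real \<beta> * y"
    using assms(1) by (auto simp: delta_condition_def)
  have eq: "cnj p - cnj q = complex_of_real \<beta> * cnj y"
    using arg_cong[OF f(5), of cnj] by simp
  show ?thesis
    unfolding delta_condition_def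
    by (intro exI[of _ "cnj y"] exI[of _ "cnj p"] exI[of _ "cnj q"] conjI tendsto_cnj f(1-4) eq)
qed

context interaction_points
begin

text \<open>Neither square integrability nor a condition at 0 is included, so that the companion
  solution \<open>\<theta>\<close>, which violates the Neumann condition, is covered as well.
  Continuity fixes the values at the interaction points, which \<open>delta_condition\<close> leaves
  open.\<close>

definition delta_solution ::
  "(nat \<Rightarrow> real) \<Rightarrow> complex \<Rightarrow> (real \<Rightarrow> complex) \<Rightarrow> (real \<Rightarrow> complex) \<Rightarrow> bool" where
  "delta_solution \<alpha> z f f' \<longleftrightarrow>
     (\<forall>t\<in>half_line - X. (f has_vector_derivative f' t) (at t within half_line)
        \<and> (f' has_vector_derivative - (z * f t)) (at t within half_line))
     \<and> continuous_on half_line f \<and> (\<forall>n\<ge>1. delta_condition (\<alpha> n) (x n) f f')"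

text \<open>The strengths are real. The conjugate solutions are wanted because the kernel of the
  adjoint minus \<open>z\<close> consists of the vectors orthogonal to the range of the operator
  minus \<open>cnj z\<close>.\<close>

lemma delta_solution_cnj:
  assumes "delta_solution \<alpha> z f f'"
  shows "delta_solution \<alpha> (cnj z) (\<lambda>t. cnj (f t)) (\<lambda>t. cnj (f' t))"
proof -
  have "((\<lambda>t. cnj (f' t)) has_vector_derivative - (cnj z * cnj (f t))) (at t within half_line)"
    if "t \<in> half_line - X" for t
    using has_vector_derivative_cnj[of f' "- (z * f t)"] that assms by (simp add: delta_solution_def)
  then show ?thesis
    using assms by (auto simp: delta_solution_def intro: has_vector_derivative_cnj
        delta_condition_cnj continuous_on_cnj)
qed

text \<open>Variation of constants, with the constants chosen so that the solution vanishes for large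
  arguments.\<close>

lemma inhomogeneous_solution:
  assumes \<phi>: "delta_solution \<alpha> z \<phi> \<phi>'" "\<phi>' 0 = 0"
    and \<theta>: "delta_solution \<alpha> z \<theta> \<theta>'"
    and W: "\<And>t. t \<in> half_line - X \<Longrightarrow> \<phi> t * \<theta>' t - \<phi>' t * \<theta> t = 1"
    and h: "continuous_on half_line h" "\<And>t. t > R \<Longrightarrow> h t = 0" and "R \<ge> 0"
    and orth: "integral {0..R} (\<lambda>t. \<phi> t * h t) = 0"
  obtains f f' where "delta_domain \<alpha> f f' (\<lambda>t. - (z * f t) - h t)" "\<And>t. t > R \<Longrightarrow> f t = 0"
proof -
  \<comment> \<open>The constant subtracted here makes \<open>C\<close> vanish beyond
    \<open>R\<close>, while \<open>D\<close> vanishes there by the orthogonality of \<open>h\<close>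
    to the first solution; hence \<open>f\<close> vanishes beyond \<open>R\<close>. At the origin
    \<open>D\<close> is 0, so \<open>f\<close> inherits the Neumann condition from
    \<open>\<phi>\<close>.\<close>
  define C where "C t = integral {0..t} (\<lambda>t. \<theta> t * h t) - integral {0..R} (\<lambda>t. \<theta> t * h t)" for t
  define D where "D t = integral {0..t} (\<lambda>t. \<phi> t * h t)" for t
  have cont: "continuous_on half_line \<phi>" "continuous_on half_line \<theta>"
    using \<phi> \<theta> by (auto simp: delta_solution_def)
  have Cd: "(C has_vector_derivative \<theta> t * h t) (at t within half_line)" if "t \<in> half_line" for t
    using has_vector_derivative_diff[OF has_vector_derivative_integral_half_line has_vector_derivative_const]
      continuous_on_mult[OF cont(2) h(1)] that unfolding C_def by fastforce
  have Dd: "(D has_vector_derivative \<phi> t * h t) (at t within half_line)" if "t \<in> half_line" for t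
    unfolding D_def
    by (rule has_vector_derivative_integral_half_line[OF continuous_on_mult[OF cont(1) h(1)] that])
  have Cc: "continuous_on half_line C" and Dc: "continuous_on half_line D"
    by (rule continuous_on_vector_derivative_within[OF Cd subset_refl], simp)
      (rule continuous_on_vector_derivative_within[OF Dd subset_refl], simp)
  have tail: "integral {0..t} u = integral {0..R} u"
    if u: "continuous_on half_line u" "\<And>t. t > R \<Longrightarrow> u t = 0" and "t > R" for u :: "real \<Rightarrow> complex" and t
  proof -
    have "u integrable_on {0..t}"
      by (rule integrable_continuous_real[OF continuous_on_subset[OF u(1)]]) (auto simp: half_line_def)
    then have "integral {0..R} u + integral {R..t} u = integral {0..t} u"
      using \<open>R \<ge> 0\<close> \<open>t > R\<close> by (intro Henstock_Kurzweil_Integration.integral_combine) auto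
    moreover have "integral {R..t} u = integral {R..t} (\<lambda>_. 0)"
      by (rule integral_spike[of "{R}"]) (use u(2) in auto)
    ultimately show ?thesis by simp
  qed
  define f where "f t = (if t > R then 0 else \<phi> t * C t - \<theta> t * D t)" for t
  define f' where "f' t = \<phi>' t * C t - \<theta>' t * D t" for t
  have CD0: "C t = 0" "D t = 0" if "t > R" for t
  proof -
    show "C t = 0"
      using tail[OF continuous_on_mult[OF cont(2) h(1)] _ that] h(2) by (simp add: C_def)
    show "D t = 0"
      using tail[OF continuous_on_mult[OF cont(1) h(1)] _ that] h(2) orth by (simp add: D_def)
  qed
  have f_eq: "f = (\<lambda>t. \<phi> t * C t - \<theta> t * D t)"
    using CD0 by (intro ext) (simp add: f_def)
  have fc: "continuous_on half_line f"
    unfolding f_eq by (intro continuous_intros cont Cc Dc)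
  have W22: "W22 X f f' (\<lambda>t. - (z * f t) - h t)"
  proof (rule W22_classical[OF _ _ _ _ _ negligible_X])
    show sq: "sq_integrable f"
      by (rule sq_integrable_compact_support[OF fc, of R]) (simp add: f_def)
    have "sq_integrable h"
      by (rule sq_integrable_compact_support[OF h])
    from sq_integrable_diff[OF sq_integrable_scale[OF sq, of "- z"] this]
    show "sq_integrable (\<lambda>t. - (z * f t) - h t)" by simp
    show "continuous_on (half_line - X) (\<lambda>t. - (z * f t) - h t)"
      by (intro continuous_intros continuous_on_subset[OF fc] continuous_on_subset[OF h(1)]) auto
    fix t assume t: "t \<in> half_line - X"
    then have t': "t \<in> half_line" by simp
    have d: "(\<phi> has_vector_derivative \<phi>' t) (at t within half_line)"
      "(\<phi>' has_vector_derivative - (z * \<phi> t)) (at t within half_line)"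
      "(\<theta> has_vector_derivative \<theta>' t) (at t within half_line)"
      "(\<theta>' has_vector_derivative - (z * \<theta> t)) (at t within half_line)"
      using \<phi> \<theta> t by (simp_all add: delta_solution_def)
    have "((\<lambda>t. \<phi> t * C t - \<theta> t * D t) has_vector_derivative
        (\<phi> t * (\<theta> t * h t) + \<phi>' t * C t) - (\<theta> t * (\<phi> t * h t) + \<theta>' t * D t)) (at t within half_line)"
      by (intro has_vector_derivative_diff has_vector_derivative_mult d Cd Dd t')
    then show "(f has_vector_derivative f' t) (at t within half_line)"
      unfolding f_eq f'_def by (simp add: algebra_simps)
    have "((\<lambda>t. \<phi>' t * C t - \<theta>' t * D t) has_vector_derivative
        (\<phi>' t * (\<theta> t * h t) + - (z * \<phi> t) * C t) - (\<theta>' t * (\<phi> t * h t) + - (z * \<theta> t) * D t)) (at t within half_line)"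
      by (intro has_vector_derivative_diff has_vector_derivative_mult d Cd Dd t')
    moreover have "(\<phi>' t * (\<theta> t * h t) + - (z * \<phi> t) * C t) - (\<theta>' t * (\<phi> t * h t) + - (z * \<theta> t) * D t)
        = - (z * f t) - (\<phi> t * \<theta>' t - \<phi>' t * \<theta> t) * h t"
      unfolding f_eq by (simp add: algebra_simps)
    ultimately show "(f' has_vector_derivative - (z * f t) - h t) (at t within half_line)"
      using W[OF t] unfolding f'_def by simp
  qed
  have "delta_condition (\<alpha> n) (x n) f f'" if "n \<ge> 1" for n
  proof -
    have int: "x n \<in> interior half_line" using x_pos[OF that] by (simp add: half_line_def)
    have "(C \<longlongrightarrow> C (x n)) (at (x n))" "(D \<longlongrightarrow> D (x n)) (at (x n))"
      using continuous_on_interior[OF Cc int] continuous_on_interior[OF Dc int] by (simp_all add: isCont_def)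
    moreover have "delta_condition (\<alpha> n) (x n) \<phi> \<phi>'" "delta_condition (\<alpha> n) (x n) \<theta> \<theta>'"
      using \<phi> \<theta> that by (simp_all add: delta_solution_def)
    ultimately have "delta_condition (\<alpha> n) (x n) (\<lambda>t. \<phi> t * C t + (- 1) * (\<theta> t * D t)) (\<lambda>t. \<phi>' t * C t + (- 1) * (\<theta>' t * D t))"
      by (intro delta_condition_add delta_condition_scale delta_condition_mult)
    then show ?thesis unfolding f_eq f'_def by simp
  qed
  moreover have "f' 0 = 0"
    using \<phi>(2) by (simp add: f'_def D_def)
  ultimately have "delta_domain \<alpha> f f' (\<lambda>t. - (z * f t) - h t)"
    using W22 by (simp add: delta_domain_def)
  then show ?thesis by (rule that) (simp add: f_def)
qed

lemma abs_l2_solution_nonzero: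
  assumes \<phi>: "delta_solution \<alpha> z \<phi> \<phi>'" "\<phi> 0 = 1" and sq: "sq_integrable \<phi>"
  shows "abs_l2 \<phi> \<noteq> 0"
proof
  assume "abs_l2 \<phi> = 0"
  then have "AE t in leb. \<phi> t = 0"
    using abs_l2_eq_iff[OF sq sq_integrable_zero] by (simp add: abs_l2_zero)
  then obtain N where N: "negligible N" "\<And>t. t \<in> half_line - N \<Longrightarrow> \<phi> t = 0"
    by (rule AE_leb_negligible) (rule that)
  have "continuous_on half_line \<phi>" using \<phi> by (simp add: delta_solution_def)
  then obtain d where d: "d > 0" "\<And>t. t \<in> half_line \<Longrightarrow> dist t 0 < d \<Longrightarrow> dist (\<phi> t) (\<phi> 0) < 1"
    unfolding continuous_on_iff by (metis atLeast_iff half_line_def order_refl zero_less_one)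
  have "{0<..<d} \<subseteq> N"
  proof
    fix t assume t: "t \<in> {0<..<d}"
    have "\<phi> t \<noteq> 0"
      using d(2)[of t] t \<phi>(2) by (auto simp: half_line_def dist_norm)
    then show "t \<in> N" using N(2)[of t] t by (auto simp: half_line_def)
  qed
  then have "negligible {0<..<d}" using N(1) negligible_subset by blast
  then show False using open_not_negligible[of "{0<..<d}"] d(1) by simp
qed

theorem deficiency_space:
  assumes \<phi>: "delta_solution \<alpha> z \<phi> \<phi>'" "\<phi> 0 = 1" "\<phi>' 0 = 0"
    and \<theta>: "delta_solution \<alpha> z \<theta> \<theta>'"
    and W: "\<And>t. t \<in> half_line - X \<Longrightarrow> \<phi> t * \<theta>' t - \<phi>' t * \<theta> t = 1"
    and sq: "sq_integrable \<phi>"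
  shows "cdimension (ker_shift (adjoint_operator (delta_op x \<alpha>)) z) = 1"
proof -
  define w where "w = abs_l2 \<phi>"
  have "w \<noteq> 0" unfolding w_def by (rule abs_l2_solution_nonzero[OF \<phi>(1,2) sq])
  have "W22 X \<phi> \<phi>' (\<lambda>t. - (z * \<phi> t))"
  proof (rule W22_classical[OF sq _ _ _ _ negligible_X])
    show "sq_integrable (\<lambda>t. - (z * \<phi> t))"
      using sq_integrable_scale[OF sq, of "- z"] by simp
    show "continuous_on (half_line - X) (\<lambda>t. - (z * \<phi> t))"
      using \<phi>(1) unfolding delta_solution_def
      by (intro continuous_intros) (auto intro: continuous_on_subset)
  qed (use \<phi>(1) in \<open>auto simp: delta_solution_def\<close>)
  then have \<phi>dom: "delta_domain \<alpha> \<phi> \<phi>' (\<lambda>t. - (z * \<phi> t))"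
    using \<phi> by (simp add: delta_domain_def delta_solution_def)
  have w_adj: "cinner_l2 g w = cinner_l2 f (z *\<^sub>C w)" if "(f, g) \<in> delta_op_pre x \<alpha>" for f g
    using delta_op_pre_Green[OF that \<phi>dom] by (simp add: w_def abs_l2_scale[OF sq])
  have orth: "cinner_l2 (abs_l2 h) u = 0"
    if u: "(u, z *\<^sub>C u) \<in> adjoint_operator (delta_op_pre x \<alpha>)"
      and h: "continuous_on half_line h" "\<And>t. t > R \<Longrightarrow> h t = 0" "R \<ge> 0" and hw: "cinner_l2 (abs_l2 h) w = 0"
    for u h R
  proof -
    have sqh: "sq_integrable h" by (rule sq_integrable_compact_support[OF h(1,2)])
    have "((\<lambda>t. h t * cnj (\<phi> t)) has_integral (\<integral>t. h t * cnj (\<phi> t) \<partial>leb)) half_line"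
      by (intro has_integral_integral_lebesgue_on integrable_mult_cnj sqh sq half_line_sets)
    then have "((\<lambda>t. h t * cnj (\<phi> t)) has_integral 0) half_line"
      using hw by (simp add: w_def cinner_abs_l2 sqh sq)
    then have "((\<lambda>t. if t \<in> {0..R} then h t * cnj (\<phi> t) else 0) has_integral 0) half_line"
      by (rule has_integral_eq[rotated]) (use h(2) in \<open>auto simp: half_line_def not_le\<close>)
    then have "((\<lambda>t. h t * cnj (\<phi> t)) has_integral 0) {0..R}"
      by (subst (asm) has_integral_restrict) (auto simp: half_line_def)
    then have i0: "integral {0..R} (\<lambda>t. cnj (\<phi> t) * h t) = 0"
      by (simp add: integral_unique mult.commute)
    have W': "cnj (\<phi> t) * cnj (\<theta>' t) - cnj (\<phi>' t) * cnj (\<theta> t) = 1" if "t \<in> half_line - X" for t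
      using arg_cong[OF W[OF that], of cnj] by simp
    have \<phi>0: "cnj (\<phi>' 0) = 0" using \<phi>(3) by simp
    obtain f f' where f: "delta_domain \<alpha> f f' (\<lambda>t. - (cnj z * f t) - h t)" "\<And>t. t > R \<Longrightarrow> f t = 0"
      by (rule inhomogeneous_solution[OF delta_solution_cnj[OF \<phi>(1)] \<phi>0 delta_solution_cnj[OF \<theta>] W' h(1,2,3) i0], assumption, assumption, rule that)
    have sqf: "sq_integrable f" using f(1) by (simp add: delta_domain_def W22_def)
    \<comment> \<open>The operator maps \<open>f\<close> to \<open>cnj z * f + h\<close>. Pairing
      with \<open>u\<close>, the two terms containing \<open>z\<close> cancel by sesquilinearity,
      and what remains is the orthogonality of \<open>h\<close> and \<open>u\<close>.\<close>
    have "(abs_l2 f, abs_l2 (\<lambda>t. - (- (cnj z * f t) - h t))) \<in> delta_op_pre x \<alpha>"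
      by (rule delta_op_preI[OF f(1) h(3) f(2)])
    moreover have "abs_l2 (\<lambda>t. - (- (cnj z * f t) - h t)) = cnj z *\<^sub>C abs_l2 f + abs_l2 h"
      by (simp add: abs_l2_scale sqf sqh abs_l2_add sq_integrable_scale add.commute)
    ultimately have "(abs_l2 f, cnj z *\<^sub>C abs_l2 f + abs_l2 h) \<in> delta_op_pre x \<alpha>" by simp
    with u have "cinner_l2 (cnj z *\<^sub>C abs_l2 f + abs_l2 h) u = cinner_l2 (abs_l2 f) (z *\<^sub>C u)"
      unfolding adjoint_operator_def by blast
    then show ?thesis
      by (simp add: cinner_add_left cinner_scaleC_left cinner_scaleC_right)
  qed
  \<comment> \<open>Subtracting a multiple of one fixed test function not orthogonal to
    \<open>w\<close> makes any other one orthogonal to \<open>w\<close> without leaving the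
    continuous functions of bounded support.\<close>
  have "\<exists>v\<in>test_functions \<alpha>. cinner_l2 v w \<noteq> 0"
    using orthogonal_dense_eq_zero[OF closure_test_functions[of \<alpha>], of w] \<open>w \<noteq> 0\<close> by blast
  then obtain h0 R0 where h0: "continuous_on half_line h0" "\<And>t. t > R0 \<Longrightarrow> h0 t = 0" "R0 \<ge> 0"
    and h0w: "cinner_l2 (abs_l2 h0) w \<noteq> 0"
    unfolding test_functions_def by blast
  have sqh0: "sq_integrable h0" by (rule sq_integrable_compact_support[OF h0(1,2)])
  have sub: "u \<in> range (\<lambda>c. c *\<^sub>C w)" if u: "(u, z *\<^sub>C u) \<in> adjoint_operator (delta_op_pre x \<alpha>)" for u
  proof -
    \<comment> \<open>Once the functional given by \<open>u\<close> vanishes wherever that of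
      \<open>w\<close> does, it is a multiple of the latter; the factor is read off at
      \<open>h0\<close>. The conjugate below appears because the inner product is conjugate linear
      in its second argument.\<close>
    define \<kappa> where "\<kappa> = cinner_l2 (abs_l2 h0) u / cinner_l2 (abs_l2 h0) w"
    have "u - cnj \<kappa> *\<^sub>C w = 0"
    proof (rule orthogonal_dense_eq_zero[OF closure_test_functions[of \<alpha>]])
      fix v assume "v \<in> test_functions \<alpha>"
      then obtain h R where v: "v = abs_l2 h" and h: "continuous_on half_line h" "\<And>t. t > R \<Longrightarrow> h t = 0" "R \<ge> 0"
        unfolding test_functions_def by blast
      have sqh: "sq_integrable h" by (rule sq_integrable_compact_support[OF h(1,2)])
      define c where "c = cinner_l2 v w / cinner_l2 (abs_l2 h0) w"
      have eq: "abs_l2 (\<lambda>t. h t - c * h0 t) = v - c *\<^sub>C abs_l2 h0"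
        by (simp add: v abs_l2_scale abs_l2_diff sqh sqh0 sq_integrable_scale)
      have "cinner_l2 (abs_l2 (\<lambda>t. h t - c * h0 t)) u = 0"
      proof (rule orth[OF u, of _ "max R R0"])
        show "continuous_on half_line (\<lambda>t. h t - c * h0 t)"
          by (intro continuous_intros h h0)
        show "h t - c * h0 t = 0" if "t > max R R0" for t
          using that h(2)[of t] h0(2)[of t] by simp
        show "cinner_l2 (abs_l2 (\<lambda>t. h t - c * h0 t)) w = 0"
          using h0w unfolding eq by (simp add: cinner_diff_left cinner_scaleC_left c_def)
      qed (use h in auto)
      then have "cinner_l2 v u = c * cinner_l2 (abs_l2 h0) u"
        unfolding eq by (simp add: cinner_diff_left cinner_scaleC_left)
      then show "cinner_l2 v (u - cnj \<kappa> *\<^sub>C w) = 0"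
        by (simp add: cinner_diff_right cinner_scaleC_right c_def \<kappa>_def)
    qed
    then show ?thesis by auto
  qed
  have "ker_shift (adjoint_operator (delta_op x \<alpha>)) z = l2.span {w}"
  proof -
    have "(c *\<^sub>C w, z *\<^sub>C c *\<^sub>C w) \<in> adjoint_operator (delta_op_pre x \<alpha>)" for c
      using w_adj by (auto simp: adjoint_operator_def cinner_scaleC_right)
    with sub show ?thesis
      unfolding ker_shift_def delta_op_def adjoint_operator_closure l2.span_singleton by auto
  qed
  then show ?thesis
    using cdimension_span_singleton[OF \<open>w \<noteq> 0\<close>] by simp
qed

end

section \<open>Piecewise trigonometric solutions\<close>

text \<open>The transfer matrix of \<open>- f'' = k^2 f\<close> over a length \<open>t\<close>,
  acting on pairs of value and derivative; its determinant is 1. The entry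
  \<open>sin (k t) / k\<close> is the reason for the recurring assumption
  \<open>k \<noteq> 0\<close>.\<close>

definition flow :: "complex \<Rightarrow> real \<Rightarrow> complex \<times> complex \<Rightarrow> complex \<times> complex" where
  "flow k t s = (fst s * cos (k * of_real t) + snd s * (sin (k * of_real t) / k),
     snd s * cos (k * of_real t) - fst s * (k * sin (k * of_real t)))"

lemma flow_0 [simp]: "flow k 0 s = s"
  by (simp add: flow_def)

lemma flow_Wronskian:
  assumes "k \<noteq> 0"
  shows "fst (flow k t s) * snd (flow k t r) - snd (flow k t s) * fst (flow k t r)
    = fst s * snd r - snd s * fst r"
proof -
  define c where "c = cos (k * of_real t)"
  define d where "d = sin (k * of_real t)"
  have 1: "c * c + d * d = 1"
    using sin_cos_squared_add[of "k * of_real t"] by (simp add: c_def d_def power2_eq_square)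
  have "fst (flow k t s) * snd (flow k t r) - snd (flow k t s) * fst (flow k t r)
    = (fst s * snd r - snd s * fst r) * (c * c + d * d)"
    using assms unfolding flow_def c_def[symmetric] d_def[symmetric] by (simp add: field_simps)
  then show ?thesis using 1 by simp
qed

lemma has_vector_derivative_flow:
  assumes "k \<noteq> 0"
  shows "((\<lambda>t. fst (flow k (t - a) s)) has_vector_derivative snd (flow k (t - a) s)) (at t within A)"
    and "((\<lambda>t. snd (flow k (t - a) s)) has_vector_derivative - (k\<^sup>2 * fst (flow k (t - a) s))) (at t within A)"
proof -
  have "((\<lambda>w. fst s * cos (k * (w - of_real a)) + snd s * (sin (k * (w - of_real a)) / k))
      has_field_derivative snd (flow k (t - a) s)) (at (of_real t))"
    using assms by (auto intro!: derivative_eq_intros simp: flow_def)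
  from has_vector_derivative_real_field[OF this]
  show "((\<lambda>t. fst (flow k (t - a) s)) has_vector_derivative snd (flow k (t - a) s)) (at t within A)"
    by (simp add: flow_def)
  have "((\<lambda>w. snd s * cos (k * (w - of_real a)) - fst s * (k * sin (k * (w - of_real a))))
      has_field_derivative - (k\<^sup>2 * fst (flow k (t - a) s))) (at (of_real t))"
    using assms by (auto intro!: derivative_eq_intros simp: flow_def algebra_simps power2_eq_square)
  from has_vector_derivative_real_field[OF this]
  show "((\<lambda>t. snd (flow k (t - a) s)) has_vector_derivative - (k\<^sup>2 * fst (flow k (t - a) s))) (at t within A)"
    by (simp add: flow_def)
qed

context interaction_points
begin

text \<open>The value and the right-hand derivative at \<open>x n\<close>: each step is a free flow
  followed by the shear that encodes the delta interaction.\<close>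

primrec state :: "complex \<Rightarrow> (nat \<Rightarrow> real) \<Rightarrow> complex \<times> complex \<Rightarrow> nat \<Rightarrow> complex \<times> complex" where
  "state k \<alpha> s 0 = s"
| "state k \<alpha> s (Suc n) =
     (let r = flow k (x (Suc n) - x n) (state k \<alpha> s n)
      in (fst r, snd r + of_real (\<alpha> (Suc n)) * fst r))"

definition piece :: "real \<Rightarrow> nat" where
  "piece t = (LEAST n. t < x (Suc n))"

text \<open>Each piece includes its left end point, so at an interaction point the second component
  is the right-hand derivative.\<close>

definition sol :: "complex \<Rightarrow> (nat \<Rightarrow> real) \<Rightarrow> complex \<times> complex \<Rightarrow> real \<Rightarrow> complex \<times> complex" where
  "sol k \<alpha> s t = flow k (t - x (piece t)) (state k \<alpha> s (piece t))"

lemma piece_eq: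
  assumes "x n \<le> t" "t < x (Suc n)"
  shows "piece t = n"
  unfolding piece_def
proof (rule Least_equality)
  fix m assume "t < x (Suc m)"
  with assms(1) have "x n < x (Suc m)" by linarith
  then show "n \<le> m" by simp
qed fact

lemma sol_eq: "x n \<le> t \<Longrightarrow> t < x (Suc n) \<Longrightarrow> sol k \<alpha> s t = flow k (t - x n) (state k \<alpha> s n)"
  by (simp add: sol_def piece_eq)

lemma sol_0: "sol k \<alpha> s 0 = s"
  using sol_eq[of 0 0 k \<alpha> s] x_0 x_pos[of 1] by simp

text \<open>The flow and the shear at an interaction point both have determinant 1.\<close>

lemma state_Wronskian:
  assumes "k \<noteq> 0"
  shows "fst (state k \<alpha> s n) * snd (state k \<alpha> r n) - snd (state k \<alpha> s n) * fst (state k \<alpha> r n)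
    = fst s * snd r - snd s * fst r"
proof (induction n)
  case (Suc n)
  define r1 where "r1 = flow k (x (Suc n) - x n) (state k \<alpha> s n)"
  define r2 where "r2 = flow k (x (Suc n) - x n) (state k \<alpha> r n)"
  have "fst r1 * (snd r2 + \<alpha> (Suc n) * fst r2) - (snd r1 + \<alpha> (Suc n) * fst r1) * fst r2
      = fst r1 * snd r2 - snd r1 * fst r2"
    by (simp add: algebra_simps)
  also have "\<dots> = fst s * snd r - snd s * fst r"
    unfolding r1_def r2_def flow_Wronskian[OF assms] by (rule Suc)
  finally show ?case
    by (simp add: Let_def r1_def r2_def)
qed simp

lemma sol_Wronskian:
  assumes "k \<noteq> 0"
  shows "fst (sol k \<alpha> s t) * snd (sol k \<alpha> r t) - snd (sol k \<alpha> s t) * fst (sol k \<alpha> r t)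
    = fst s * snd r - snd s * fst r"
  unfolding sol_def by (simp only: flow_Wronskian[OF assms] state_Wronskian[OF assms])

lemma sol_at_right:
  assumes "k \<noteq> 0"
  shows "((\<lambda>t. fst (sol k \<alpha> s t)) \<longlongrightarrow> fst (state k \<alpha> s n)) (at_right (x n))"
    and "((\<lambda>t. snd (sol k \<alpha> s t)) \<longlongrightarrow> snd (state k \<alpha> s n)) (at_right (x n))"
proof -
  define S where "S t = flow k (t - x n) (state k \<alpha> s n)" for t
  have "((\<lambda>t. fst (S t)) \<longlongrightarrow> fst (S (x n))) (at_right (x n))"
    "((\<lambda>t. snd (S t)) \<longlongrightarrow> snd (S (x n))) (at_right (x n))"
    unfolding S_def
    by (rule has_vector_derivative_continuous[OF has_vector_derivative_flow(1)[OF assms], unfolded continuous_within]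
        has_vector_derivative_continuous[OF has_vector_derivative_flow(2)[OF assms], unfolded continuous_within])+
  then have lim: "((\<lambda>t. fst (S t)) \<longlongrightarrow> fst (state k \<alpha> s n)) (at_right (x n))"
    "((\<lambda>t. snd (S t)) \<longlongrightarrow> snd (state k \<alpha> s n)) (at_right (x n))"
    by (simp_all add: S_def)
  have "\<forall>\<^sub>F t in at_right (x n). S t = sol k \<alpha> s t"
    using eventually_at_right_real[OF x_less_Suc[of n]]
    by eventually_elim (simp add: S_def sol_eq[of n])
  then have ev: "\<forall>\<^sub>F t in at_right (x n). fst (S t) = fst (sol k \<alpha> s t)"
    "\<forall>\<^sub>F t in at_right (x n). snd (S t) = snd (sol k \<alpha> s t)"
    by (auto elim: eventually_mono)
  show "((\<lambda>t. fst (sol k \<alpha> s t)) \<longlongrightarrow> fst (state k \<alpha> s n)) (at_right (x n))"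
    "((\<lambda>t. snd (sol k \<alpha> s t)) \<longlongrightarrow> snd (state k \<alpha> s n)) (at_right (x n))"
    by (rule Lim_transform_eventually[OF lim(1) ev(1)]) (rule Lim_transform_eventually[OF lim(2) ev(2)])
qed

lemma sol_at_left:
  fixes s :: "complex \<times> complex" and \<alpha> :: "nat \<Rightarrow> real"
  assumes "k \<noteq> 0"
  defines "r \<equiv> \<lambda>n. flow k (x (Suc n) - x n) (state k \<alpha> s n)"
  shows "((\<lambda>t. fst (sol k \<alpha> s t)) \<longlongrightarrow> fst (r n)) (at_left (x (Suc n)))"
    and "((\<lambda>t. snd (sol k \<alpha> s t)) \<longlongrightarrow> snd (r n)) (at_left (x (Suc n)))"
proof -
  define S where "S t = flow k (t - x n) (state k \<alpha> s n)" for t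
  have "((\<lambda>t. fst (S t)) \<longlongrightarrow> fst (S (x (Suc n)))) (at_left (x (Suc n)))"
    "((\<lambda>t. snd (S t)) \<longlongrightarrow> snd (S (x (Suc n)))) (at_left (x (Suc n)))"
    unfolding S_def
    by (rule has_vector_derivative_continuous[OF has_vector_derivative_flow(1)[OF assms(1)], unfolded continuous_within]
        has_vector_derivative_continuous[OF has_vector_derivative_flow(2)[OF assms(1)], unfolded continuous_within])+
  then have lim: "((\<lambda>t. fst (S t)) \<longlongrightarrow> fst (r n)) (at_left (x (Suc n)))"
    "((\<lambda>t. snd (S t)) \<longlongrightarrow> snd (r n)) (at_left (x (Suc n)))"
    by (simp_all add: S_def r_def)
  have "\<forall>\<^sub>F t in at_left (x (Suc n)). S t = sol k \<alpha> s t"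
    using eventually_at_left_real[OF x_less_Suc[of n]]
    by eventually_elim (simp add: S_def sol_eq[of n])
  then have ev: "\<forall>\<^sub>F t in at_left (x (Suc n)). fst (S t) = fst (sol k \<alpha> s t)"
    "\<forall>\<^sub>F t in at_left (x (Suc n)). snd (S t) = snd (sol k \<alpha> s t)"
    by (auto elim: eventually_mono)
  show "((\<lambda>t. fst (sol k \<alpha> s t)) \<longlongrightarrow> fst (r n)) (at_left (x (Suc n)))"
    "((\<lambda>t. snd (sol k \<alpha> s t)) \<longlongrightarrow> snd (r n)) (at_left (x (Suc n)))"
    by (rule Lim_transform_eventually[OF lim(1) ev(1)]) (rule Lim_transform_eventually[OF lim(2) ev(2)])
qed

lemma sol_derivatives:
  assumes k: "k \<noteq> 0" and t: "t \<in> half_line - X"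
  shows "((\<lambda>t. fst (sol k \<alpha> s t)) has_vector_derivative snd (sol k \<alpha> s t)) (at t within half_line)"
    and "((\<lambda>t. snd (sol k \<alpha> s t)) has_vector_derivative - (k\<^sup>2 * fst (sol k \<alpha> s t))) (at t within half_line)"
proof -
  have t0: "0 \<le> t" using t by (simp add: half_line_def)
  obtain n where n: "x n \<le> t" "t < x (Suc n)" by (rule interval_of_point[OF t0])
  have tn: "t = 0 \<or> x n < t"
  proof (cases "n = 0")
    case True
    then show ?thesis using t0 x_0 by auto
  next
    case False
    then have "x n \<in> X" by simp
    then show ?thesis using t n(1) by force
  qed
  \<comment> \<open>Within distance \<open>d\<close> of \<open>t\<close>, the half-line stays inside
    one piece. At \<open>t = 0\<close> the half-line itself provides the left bound, so the second
    entry takes the harmless default 1.\<close>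
  define d where "d = min (x (Suc n) - t) (if t = 0 then 1 else t - x n)"
  have d: "d > 0" using n tn by (auto simp: d_def)
  have eq: "flow k (u - x n) (state k \<alpha> s n) = sol k \<alpha> s u" if "u \<in> half_line" "dist u t < d" for u
  proof -
    have "u < x (Suc n)" using that(2) by (auto simp: d_def dist_real_def)
    moreover have "x n \<le> u"
    proof (cases "t = 0")
      case True
      then have "x n = 0" using n(1) x_nonneg[of n] by simp
      then show ?thesis using that(1) by (simp add: half_line_def)
    next
      case False
      then show ?thesis using that(2) by (auto simp: d_def dist_real_def)
    qed
    ultimately show ?thesis by (simp add: sol_eq)
  qed
  have t': "t \<in> half_line" using t by simp
  have eqt: "sol k \<alpha> s t = flow k (t - x n) (state k \<alpha> s n)" using n by (rule sol_eq)
  show "((\<lambda>t. fst (sol k \<alpha> s t)) has_vector_derivative snd (sol k \<alpha> s t)) (at t within half_line)"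
    unfolding eqt
    by (rule has_vector_derivative_transform_within[OF has_vector_derivative_flow(1)[OF k] d t']) (simp add: eq)
  show "((\<lambda>t. snd (sol k \<alpha> s t)) has_vector_derivative - (k\<^sup>2 * fst (sol k \<alpha> s t))) (at t within half_line)"
    unfolding eqt
    by (rule has_vector_derivative_transform_within[OF has_vector_derivative_flow(2)[OF k] d t']) (simp add: eq)
qed

lemma delta_solution_sol:
  assumes k: "k \<noteq> 0"
  shows "delta_solution \<alpha> (k\<^sup>2) (\<lambda>t. fst (sol k \<alpha> s t)) (\<lambda>t. snd (sol k \<alpha> s t))"
  unfolding delta_solution_def
proof (intro conjI ballI allI impI)
  show "((\<lambda>t. fst (sol k \<alpha> s t)) has_vector_derivative snd (sol k \<alpha> s t)) (at t within half_line)"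
    "((\<lambda>t. snd (sol k \<alpha> s t)) has_vector_derivative - (k\<^sup>2 * fst (sol k \<alpha> s t))) (at t within half_line)"
    if "t \<in> half_line - X" for t
    using sol_derivatives[OF k that] by blast+
  have at_x: "sol k \<alpha> s (x n) = state k \<alpha> s n" for n
    using sol_eq[of n "x n" k \<alpha> s] by simp
  show "continuous_on half_line (\<lambda>t. fst (sol k \<alpha> s t))"
    unfolding continuous_on_eq_continuous_within
  proof
    fix t assume t: "t \<in> half_line"
    show "continuous (at t within half_line) (\<lambda>t. fst (sol k \<alpha> s t))"
    proof (cases "t \<in> X")
      case False
      then show ?thesis
        using t by (intro has_vector_derivative_continuous[OF sol_derivatives(1)[OF k]]) simp
    next
      case True
      then obtain m where m: "m \<ge> 1" "t = x m" by auto
      then obtain n where n: "t = x (Suc n)" by (cases m) auto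
      have "((\<lambda>t. fst (sol k \<alpha> s t)) \<longlongrightarrow> fst (sol k \<alpha> s t)) (at t)"
        unfolding filterlim_at_split n at_x
        using sol_at_right(1)[OF k, of \<alpha> s "Suc n"] sol_at_left(1)[OF k, of \<alpha> s n] by (simp add: Let_def)
      then have "isCont (\<lambda>t. fst (sol k \<alpha> s t)) t" by (simp add: isCont_def)
      then show ?thesis by (rule continuous_at_imp_continuous_at_within)
    qed
  qed
  fix m :: nat assume "m \<ge> 1"
  then obtain n where n: "m = Suc n" by (cases m) auto
  have eq: "snd (state k \<alpha> s (Suc n)) - snd (flow k (x (Suc n) - x n) (state k \<alpha> s n))
      = complex_of_real (\<alpha> (Suc n)) * fst (state k \<alpha> s (Suc n))"
    by (simp add: Let_def)
  have left: "((\<lambda>t. fst (sol k \<alpha> s t)) \<longlongrightarrow> fst (state k \<alpha> s (Suc n))) (at_left (x (Suc n)))"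
    using sol_at_left(1)[OF k, of \<alpha> s n] by (simp add: Let_def)
  show "delta_condition (\<alpha> m) (x m) (\<lambda>t. fst (sol k \<alpha> s t)) (\<lambda>t. snd (sol k \<alpha> s t))"
    unfolding delta_condition_def n
    by (intro exI conjI, rule sol_at_right[OF k], rule left, rule sol_at_right[OF k],
        rule sol_at_left[OF k], rule eq)
qed

lemma deficiency_of_sq_integrable_sol:
  assumes "k \<noteq> 0" "sq_integrable (\<lambda>t. fst (sol k \<alpha> (1, 0) t))"
  shows "cdimension (ker_shift (adjoint_operator (delta_op x \<alpha>)) (k\<^sup>2)) = 1"
proof (rule deficiency_space[OF delta_solution_sol[OF assms(1), of \<alpha> "(1, 0)"] _ _
      delta_solution_sol[OF assms(1), of \<alpha> "(0, 1)"] _ assms(2)])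
  show "fst (sol k \<alpha> (1, 0) t) * snd (sol k \<alpha> (0, 1) t) - snd (sol k \<alpha> (1, 0) t) * fst (sol k \<alpha> (0, 1) t) = 1" for t
    using sol_Wronskian[OF assms(1), of \<alpha> "(1, 0)" t "(0, 1)"] by simp
qed (simp_all add: sol_0)

end

section \<open>Perturbations of an oscillatory recurrence\<close>

text \<open>Cast to complex numbers so that the Landau symbols apply directly to the complex
  coefficients of the recurrence.\<close>

definition inv_sq :: "nat \<Rightarrow> complex" where
  "inv_sq n = of_real (1 / (real n)\<^sup>2)"

lemma bigo_inv_sqE:
  assumes "f \<in> O(inv_sq)"
  obtains K where "K \<ge> 0" "\<forall>\<^sub>F n in sequentially. cmod (f n) \<le> K / (real n)\<^sup>2"
proof -
  obtain c where c: "c > 0" "\<forall>\<^sub>F n in sequentially. cmod (f n) \<le> c * cmod (inv_sq n)"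
    using landau_o.bigE[OF assms] .
  then show ?thesis
    by (intro that[of c]) (auto simp: inv_sq_def norm_divide norm_power)
qed

lemma bigo_inv_sqI:
  assumes "\<And>n. n \<ge> 1 \<Longrightarrow> cmod (f n) \<le> K / (real n)\<^sup>2"
  shows "f \<in> O(inv_sq)"
  by (rule bigoI[of _ K], rule eventually_at_top_linorderI[of 1])
    (use assms in \<open>simp add: inv_sq_def norm_divide norm_power\<close>)

lemma bigo_inv_sq_of_real:
  assumes "f \<in> O(\<lambda>n. 1 / (real n)\<^sup>2)"
  shows "(\<lambda>n. complex_of_real (f n)) \<in> O(inv_sq)"
proof -
  obtain c where "c > 0" "\<forall>\<^sub>F n in sequentially. norm (f n) \<le> c * norm (1 / (real n)\<^sup>2)"
    using landau_o.bigE[OF assms] .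
  then show ?thesis
    by (intro bigoI[of _ c]) (simp add: inv_sq_def norm_divide norm_power)
qed

lemma bigo_1_of_real:
  assumes "f \<in> O(\<lambda>_. 1)"
  shows "(\<lambda>n::nat. complex_of_real (f n)) \<in> O(\<lambda>_. 1)"
proof -
  obtain c where "c > 0" "\<forall>\<^sub>F n in sequentially. norm (f n) \<le> c * norm (1::real)"
    using landau_o.bigE[OF assms] .
  then show ?thesis by (intro bigoI[of _ c]) simp
qed

lemma bigo_inv_sq_imp_bigo_1: "f \<in> O(inv_sq) \<Longrightarrow> f \<in> O(\<lambda>_. 1)"
proof (erule landau_o.big_trans)
  show "inv_sq \<in> O(\<lambda>_. 1)"
    by (rule bigoI[of _ 1], rule eventually_at_top_linorderI[of 1])
      (simp add: inv_sq_def norm_divide norm_power divide_le_eq)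
qed

lemma near_1_imp_bigo_1:
  assumes "(\<lambda>n. f n - 1) \<in> O(inv_sq)"
  shows "f \<in> O(\<lambda>_. 1)"
  using sum_in_bigo(1)[OF bigo_inv_sq_imp_bigo_1[OF assms] bigo_const[of 1]] by simp

lemma near_1_mult:
  assumes "(\<lambda>n. f n - 1) \<in> O(inv_sq)" "(\<lambda>n. g n - 1) \<in> O(inv_sq)"
  shows "(\<lambda>n. f n * g n - 1) \<in> O(inv_sq)"
proof -
  have "(\<lambda>n. (f n - 1) * g n + (g n - 1)) \<in> O(inv_sq)"
    by (intro sum_in_bigo landau_o.big_1_mult near_1_imp_bigo_1 assms)
  then show ?thesis by (simp add: algebra_simps)
qed

lemma near_1_tendsto:
  assumes "(\<lambda>n. f n - 1) \<in> O(inv_sq)"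
  shows "f \<longlonglongrightarrow> 1"
proof -
  obtain K where K: "\<forall>\<^sub>F n in sequentially. cmod (f n - 1) \<le> K / (real n)\<^sup>2"
    using bigo_inv_sqE[OF assms] .
  have "(\<lambda>n. f n - 1) \<longlonglongrightarrow> 0"
  proof (rule Lim_null_comparison[OF K])
    show "(\<lambda>n. K / (real n)\<^sup>2) \<longlonglongrightarrow> 0" by real_asymp
  qed
  then show ?thesis by (simp add: LIM_zero_iff)
qed

lemma near_1_inverse:
  assumes "(\<lambda>n. f n - 1) \<in> O(inv_sq)"
  shows "(\<lambda>n. inverse (f n) - 1) \<in> O(inv_sq)"
proof -
  have lim: "(\<lambda>n. inverse (f n)) \<longlonglongrightarrow> inverse 1"
    by (intro tendsto_inverse near_1_tendsto assms) simp
  then have "(\<lambda>n. inverse (f n)) \<in> O(\<lambda>_. 1)"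
    by (intro bigoI_tendsto[where c = 1]) auto
  then have 1: "(\<lambda>n. - ((f n - 1) * inverse (f n))) \<in> O(inv_sq)"
    using landau_o.big_1_mult[OF assms] by simp
  have "\<forall>\<^sub>F n in sequentially. f n \<noteq> 0"
    using tendsto_imp_eventually_ne[OF near_1_tendsto[OF assms], of 0] by simp
  then have ev: "\<forall>\<^sub>F n in sequentially. - ((f n - 1) * inverse (f n)) = inverse (f n) - 1"
    by eventually_elim (simp add: field_simps)
  show ?thesis
    by (rule landau_o.big.in_cong[OF ev, THEN iffD1, OF 1])
qed

text \<open>A discrete Gronwall estimate based on \<open>1 + c \<le> exp c\<close>.\<close>

lemma product_growth_bounded:
  fixes q c :: "nat \<Rightarrow> real"
  assumes step: "\<And>n. n \<ge> N \<Longrightarrow> q (Suc n) \<le> (1 + c n) * q n"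
    and q: "\<And>n. 0 \<le> q n" and c: "\<And>n. 0 \<le> c n" "summable c" and "n \<ge> N"
  shows "q n \<le> q N * exp (suminf c)"
proof -
  have "q n \<le> q N * exp (\<Sum>i\<in>{N..<n}. c i)"
    using \<open>n \<ge> N\<close>
  proof (induction n rule: dec_induct)
    case (step n)
    have "q (Suc n) \<le> (1 + c n) * q n" using assms(1) step by simp
    also have "\<dots> \<le> exp (c n) * q n"
      using q by (intro mult_right_mono) auto
    also have "\<dots> \<le> exp (c n) * (q N * exp (\<Sum>i\<in>{N..<n}. c i))"
      using step by (intro mult_left_mono) auto
    also have "\<dots> = q N * exp (\<Sum>i\<in>{N..<Suc n}. c i)"
      using step by (simp add: exp_add)
    finally show ?case .
  qed simp
  also have "\<dots> \<le> q N * exp (suminf c)"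
    using q c by (intro mult_left_mono) (auto intro: sum_le_suminf)
  finally show ?thesis .
qed

text \<open>The form \<open>|v|\<^sup>2 + |w|\<^sup>2 - \<tau> Re (v cnj w)\<close>, positive definite for \<open>|\<tau>| < 2\<close>, is conserved by the
  unperturbed recurrence \<open>v\<^sub>n\<^sub>+\<^sub>2 = \<tau> v\<^sub>n\<^sub>+\<^sub>1 - v\<^sub>n\<close>.\<close>

lemma oscillatory_recurrence_bounded:
  fixes v A B :: "nat \<Rightarrow> complex" and \<tau> :: real
  assumes \<tau>: "\<bar>\<tau>\<bar> < 2"
    and A: "(\<lambda>n. A n - of_real \<tau>) \<in> O(inv_sq)" and B: "(\<lambda>n. B n - 1) \<in> O(inv_sq)"
    and rec: "\<forall>\<^sub>F n in sequentially. v (n + 2) = A n * v (n + 1) - B n * v n"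
  obtains M where "\<And>n. cmod (v n) \<le> M"
proof -
  obtain K1 where K1: "K1 \<ge> 0" "\<forall>\<^sub>F n in sequentially. cmod (A n - of_real \<tau>) \<le> K1 / (real n)\<^sup>2"
    using bigo_inv_sqE[OF A] .
  obtain K2 where K2: "K2 \<ge> 0" "\<forall>\<^sub>F n in sequentially. cmod (B n - 1) \<le> K2 / (real n)\<^sup>2"
    using bigo_inv_sqE[OF B] .
  define K where "K = K1 + K2"
  have "K \<ge> 0" using K1 K2 by (simp add: K_def)
  have "\<forall>\<^sub>F n in sequentially. n \<ge> 1 \<and> v (n + 2) = A n * v (n + 1) - B n * v n
      \<and> cmod (A n - of_real \<tau>) \<le> K / (real n)\<^sup>2 \<and> cmod (B n - 1) \<le> K / (real n)\<^sup>2"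
    using K1(2) K2(2) rec eventually_ge_at_top[of 1]
  proof eventually_elim
    case (elim n)
    have "K1 / (real n)\<^sup>2 \<le> K / (real n)\<^sup>2" "K2 / (real n)\<^sup>2 \<le> K / (real n)\<^sup>2"
      using K1(1) K2(1) by (auto simp: K_def intro: divide_right_mono)
    with elim show ?case by linarith
  qed
  then obtain N where N: "\<And>n. n \<ge> N \<Longrightarrow> n \<ge> 1 \<and> v (n + 2) = A n * v (n + 1) - B n * v n
      \<and> cmod (A n - of_real \<tau>) \<le> K / (real n)\<^sup>2 \<and> cmod (B n - 1) \<le> K / (real n)\<^sup>2"
    unfolding eventually_sequentially by blast
  define Q where "Q n = (cmod (v (n + 1)))\<^sup>2 + (cmod (v n))\<^sup>2 - \<tau> * Re (v (n + 1) * cnj (v n))" for n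
  \<comment> \<open>The smallest eigenvalue of the quadratic form, positive exactly because
    \<open>|\<tau>| < 2\<close>.\<close>
  define \<delta> where "\<delta> = 1 - \<bar>\<tau>\<bar> / 2"
  have "\<delta> > 0" using \<tau> by (simp add: \<delta>_def)
  have Q_lower: "\<delta> * ((cmod (v (n + 1)))\<^sup>2 + (cmod (v n))\<^sup>2) \<le> Q n" for n
  proof -
    have "\<tau> * Re (v (n + 1) * cnj (v n)) \<le> \<bar>\<tau>\<bar> * (cmod (v (n + 1)) * cmod (v n))"
    proof -
      have "\<tau> * Re (v (n + 1) * cnj (v n)) \<le> \<bar>\<tau>\<bar> * \<bar>Re (v (n + 1) * cnj (v n))\<bar>"
        by (metis abs_ge_self abs_mult)
      also have "\<dots> \<le> \<bar>\<tau>\<bar> * cmod (v (n + 1) * cnj (v n))"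
        by (intro mult_left_mono abs_Re_le_cmod) simp
      finally show ?thesis by (simp add: norm_mult)
    qed
    also have "\<dots> \<le> \<bar>\<tau>\<bar> * (((cmod (v (n + 1)))\<^sup>2 + (cmod (v n))\<^sup>2) / 2)"
      using zero_le_power2[of "cmod (v (n + 1)) - cmod (v n)"]
      by (intro mult_left_mono) (auto simp: power2_eq_square algebra_simps)
    finally show ?thesis by (simp add: Q_def \<delta>_def algebra_simps)
  qed
  have Q_nonneg: "0 \<le> Q n" for n
    using Q_lower[of n] \<open>\<delta> > 0\<close>
    by (meson add_nonneg_nonneg less_imp_le mult_nonneg_nonneg order_trans zero_le_power2)
  \<comment> \<open>With \<open>\<epsilon> = K / n^2\<close>, the change of \<open>Q\<close> is at
    most \<open>(6 + \<epsilon>) * \<epsilon> * S^2\<close>, where 6 = 4 + 2 comes from the two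
    terms linear in the error; \<open>S^2 \<le> 2 / \<delta> * Q n\<close> turns this into a
    relative change \<open>c n\<close>.\<close>
  define c where "c n = (6 + K) * 2 * K / \<delta> * (1 / (real n)\<^sup>2)" for n
  have c: "0 \<le> c n" for n using \<open>K \<ge> 0\<close> \<open>\<delta> > 0\<close> by (simp add: c_def)
  have "summable c"
    unfolding c_def using inverse_power_summable[of 2, where ?'a = real]
    by (intro summable_mult) (simp add: inverse_eq_divide)
  have step: "Q (Suc n) \<le> (1 + c n) * Q n" if "n \<ge> N" for n
  proof -
    \<comment> \<open>\<open>w\<close> is the next value under the unperturbed recurrence, and
      \<open>e\<close> collects the errors of both coefficients.\<close>
    define v0 v1 w e where "v0 = v n" and "v1 = v (n + 1)" and "w = of_real \<tau> * v1 - v0"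
      and "e = (A n - of_real \<tau>) * v1 - (B n - 1) * v0"
    have v2: "v (Suc n + 1) = w + e"
      using N[OF that] by (simp add: w_def e_def v0_def v1_def algebra_simps)
    define S where "S = cmod v1 + cmod v0"
    define \<epsilon> where "\<epsilon> = K / (real n)\<^sup>2"
    have n1: "real n \<ge> 1" using N[OF that] by simp
    then have "1 \<le> (real n)\<^sup>2" by (simp add: one_le_power)
    then have \<epsilon>: "0 \<le> \<epsilon>" "\<epsilon> \<le> K"
      using \<open>K \<ge> 0\<close> by (auto simp: \<epsilon>_def divide_le_eq mult_le_cancel_left1)
    have S: "0 \<le> S" "cmod v1 \<le> S" by (simp_all add: S_def)
    have "cmod e \<le> cmod (A n - of_real \<tau>) * cmod v1 + cmod (B n - 1) * cmod v0"
      unfolding e_def by (metis norm_mult norm_triangle_ineq4)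
    also have "\<dots> \<le> \<epsilon> * cmod v1 + \<epsilon> * cmod v0"
      using N[OF that] by (intro add_mono mult_right_mono) (auto simp: \<epsilon>_def)
    finally have e: "cmod e \<le> \<epsilon> * S" by (simp add: S_def algebra_simps)
    have "cmod w \<le> \<bar>\<tau>\<bar> * cmod v1 + cmod v0"
      unfolding w_def by (metis norm_mult norm_of_real norm_triangle_ineq4)
    also have "\<dots> \<le> 2 * cmod v1 + 2 * cmod v0"
      using \<tau> by (intro add_mono mult_right_mono) auto
    finally have w: "cmod w \<le> 2 * S" by (simp add: S_def)
    have "Q (Suc n) = (cmod (w + e))\<^sup>2 + (cmod v1)\<^sup>2 - \<tau> * Re ((w + e) * cnj v1)"
      unfolding Q_def v2 by (simp add: v1_def)
    moreover have "Q n = (cmod v1)\<^sup>2 + (cmod v0)\<^sup>2 - \<tau> * Re (v1 * cnj v0)"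
      unfolding Q_def v0_def v1_def ..
    \<comment> \<open>All terms free of \<open>e\<close> cancel, which is the conservation law of
      the unperturbed recurrence.\<close>
    ultimately have "Q (Suc n) - Q n = 2 * Re (w * cnj e) + (cmod e)\<^sup>2 - \<tau> * Re (e * cnj v1)"
      unfolding cmod_power2 w_def by (simp add: algebra_simps power2_eq_square)
    also have "\<dots> \<le> 2 * (cmod w * cmod e) + (cmod e)\<^sup>2 + 2 * (cmod e * cmod v1)"
    proof -
      have "Re (w * cnj e) \<le> cmod w * cmod e"
        using complex_Re_le_cmod[of "w * cnj e"] by (simp add: norm_mult)
      moreover have "- (\<tau> * Re (e * cnj v1)) \<le> 2 * (cmod e * cmod v1)"
      proof -
        have "- (\<tau> * Re (e * cnj v1)) \<le> \<bar>\<tau>\<bar> * \<bar>Re (e * cnj v1)\<bar>"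
          by (metis abs_ge_minus_self abs_mult)
        also have "\<dots> \<le> 2 * cmod (e * cnj v1)"
          using \<tau> by (intro mult_mono abs_Re_le_cmod) auto
        finally show ?thesis by (simp add: norm_mult)
      qed
      ultimately show ?thesis by linarith
    qed
    also have "\<dots> \<le> 2 * ((2 * S) * (\<epsilon> * S)) + (\<epsilon> * S)\<^sup>2 + 2 * ((\<epsilon> * S) * S)"
      using e w S \<epsilon> by (intro add_mono mult_left_mono mult_mono power_mono) auto
    also have "\<dots> = (6 + \<epsilon>) * \<epsilon> * S\<^sup>2"
      by (simp add: algebra_simps power2_eq_square)
    also have "\<dots> \<le> (6 + K) * \<epsilon> * S\<^sup>2"
      using \<epsilon> by (intro mult_right_mono) auto
    also have "\<dots> \<le> (6 + K) * \<epsilon> * (2 / \<delta> * Q n)"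
    proof (intro mult_left_mono)
      have "S\<^sup>2 \<le> 2 * ((cmod v1)\<^sup>2 + (cmod v0)\<^sup>2)"
        unfolding S_def using zero_le_power2[of "cmod v1 - cmod v0"]
        by (simp add: power2_eq_square algebra_simps)
      also have "\<dots> \<le> 2 / \<delta> * Q n"
        using Q_lower[of n] \<open>\<delta> > 0\<close> by (simp add: v0_def v1_def field_simps)
      finally show "S\<^sup>2 \<le> 2 / \<delta> * Q n" .
    qed (use \<epsilon> \<open>K \<ge> 0\<close> in auto)
    also have "\<dots> = c n * Q n"
      by (simp add: c_def \<epsilon>_def field_simps)
    finally show ?thesis by (simp add: algebra_simps)
  qed
  have bound: "(cmod (v n))\<^sup>2 \<le> Q N * exp (suminf c) / \<delta>" if "n \<ge> N" for n
  proof -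
    have "\<delta> * (cmod (v n))\<^sup>2 \<le> \<delta> * ((cmod (v (n + 1)))\<^sup>2 + (cmod (v n))\<^sup>2)"
      using \<open>\<delta> > 0\<close> by (intro mult_left_mono) auto
    also have "\<dots> \<le> Q n" by (rule Q_lower)
    also have "\<dots> \<le> Q N * exp (suminf c)"
      by (rule product_growth_bounded[OF step Q_nonneg c \<open>summable c\<close> that])
    finally show ?thesis using \<open>\<delta> > 0\<close> by (simp add: field_simps)
  qed
  define M0 where "M0 = sqrt (Q N * exp (suminf c) / \<delta>)"
  \<comment> \<open>The sum bounds the finitely many initial terms, about which the eventual
    estimates say nothing.\<close>
  have "cmod (v n) \<le> max M0 (\<Sum>i<N. cmod (v i))" for n
  proof (cases "n \<ge> N")
    case True
    then have "cmod (v n) \<le> M0" unfolding M0_def using bound by (intro real_le_rsqrt)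
    then show ?thesis by simp
  next
    case False
    then have "cmod (v n) \<le> (\<Sum>i<N. cmod (v i))"
      by (intro member_le_sum) auto
    then show ?thesis by simp
  qed
  then show ?thesis by (rule that)
qed

section \<open>Harmonic spacing\<close>

text \<open>The linear Taylor coefficient vanishes, so the remainder is of order \<open>d^2\<close>.
  The restriction \<open>d \<le> 1\<close> makes the constant independent of
  \<open>d\<close>.\<close>

lemma cos_near_1:
  assumes "0 \<le> d" "d \<le> 1"
  shows "cmod (cos (k * of_real d) - 1) \<le> exp (cmod k) * (cmod k)\<^sup>2 * d\<^sup>2"
proof -
  have "cmod (cos (k * of_real d) - (\<Sum>i\<le>1. complex_of_real (cos_coeff i) * (k * of_real d) ^ i))
      \<le> exp \<bar>Im (k * of_real d)\<bar> * cmod (k * of_real d) ^ Suc 1 / fact 1"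
    by (rule Taylor_cos)
  also have "(\<Sum>i\<le>1. complex_of_real (cos_coeff i) * (k * of_real d) ^ i) = 1"
    by (simp add: cos_coeff_def)
  also have "exp \<bar>Im (k * of_real d)\<bar> * cmod (k * of_real d) ^ Suc 1 / fact 1
      = exp (\<bar>Im k\<bar> * d) * ((cmod k)\<^sup>2 * d\<^sup>2)"
    using assms by (simp add: norm_mult abs_mult power2_eq_square)
  also have "\<dots> \<le> exp (cmod k) * ((cmod k)\<^sup>2 * d\<^sup>2)"
    using assms abs_Im_le_cmod[of k] mult_mono[of "\<bar>Im k\<bar>" "cmod k" d 1]
    by (intro mult_right_mono) auto
  finally show ?thesis by (simp add: mult.assoc)
qed

text \<open>The quadratic Taylor coefficient vanishes, so the remainder is of third order. Division
  by \<open>k\<close> lowers the power of \<open>cmod k\<close> to two, which gives the same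
  constant as for the cosine.\<close>

lemma sin_near_id:
  assumes "0 \<le> d" "d \<le> 1" "k \<noteq> 0"
  shows "cmod (sin (k * of_real d) / k - of_real d) \<le> exp (cmod k) * (cmod k)\<^sup>2 * d ^ 3"
proof -
  have "cmod (sin (k * of_real d) - (\<Sum>i\<le>2. complex_of_real (sin_coeff i) * (k * of_real d) ^ i))
      \<le> exp \<bar>Im (k * of_real d)\<bar> * cmod (k * of_real d) ^ Suc 2 / fact 2"
    by (rule Taylor_sin)
  also have "(\<Sum>i\<le>2. complex_of_real (sin_coeff i) * (k * of_real d) ^ i) = k * of_real d"
    by (simp add: sin_coeff_def eval_nat_numeral)
  also have "exp \<bar>Im (k * of_real d)\<bar> * cmod (k * of_real d) ^ Suc 2 / fact 2
      = exp (\<bar>Im k\<bar> * d) * (cmod k ^ 3 * d ^ 3) / 2"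
    using assms by (simp add: norm_mult abs_mult eval_nat_numeral)
  also have "\<dots> \<le> exp (\<bar>Im k\<bar> * d) * (cmod k ^ 3 * d ^ 3)"
    using assms by simp
  also have "\<dots> \<le> exp (cmod k) * (cmod k ^ 3 * d ^ 3)"
    using assms abs_Im_le_cmod[of k] mult_mono[of "\<bar>Im k\<bar>" "cmod k" d 1]
    by (intro mult_right_mono) auto
  finally have *: "cmod (sin (k * of_real d) - k * of_real d) \<le> exp (cmod k) * (cmod k ^ 3 * d ^ 3)" .
  have "sin (k * of_real d) / k - of_real d = (sin (k * of_real d) - k * of_real d) / k"
    using assms(3) by (simp add: field_simps)
  then have "cmod (sin (k * of_real d) / k - of_real d) = cmod (sin (k * of_real d) - k * of_real d) / cmod k"
    by (simp add: norm_divide)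
  also have "\<dots> \<le> exp (cmod k) * (cmod k ^ 3 * d ^ 3) / cmod k"
    by (intro divide_right_mono *) simp
  also have "\<dots> = exp (cmod k) * (cmod k)\<^sup>2 * d ^ 3"
    using assms(3) by (simp add: eval_nat_numeral)
  finally show ?thesis .
qed

text \<open>The difference between the harmonic number and the logarithm decreases, and its first
  value is 1.\<close>

lemma harm_le_ln: "harm (Suc n) \<le> 1 + ln (real (Suc n))"
  using decseqD[OF decseq_harm_diff_ln, of 0 n] by (simp add: harm_expand)

lemma integrable_exp_minus: "integrable leb (\<lambda>t. exp (- t))"
proof -
  have "(\<lambda>t::real. exp (- t)) absolutely_integrable_on {0..}"
    using has_integral_exp_minus_to_infinity[of 1 0]
    by (intro nonnegative_absolutely_integrable_1) (auto simp: has_integral_integrable)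
  then show ?thesis
    unfolding half_line_def set_integrable_def by (subst integrable_restrict_space) auto
qed

locale harmonic_points =
  fixes x :: "nat \<Rightarrow> real"
  assumes x0: "x 0 = 0" and spacing: "n \<ge> 1 \<Longrightarrow> x n - x (n - 1) = 1 / real n"
begin

lemma spacing_Suc: "x (Suc n) - x n = 1 / real (Suc n)"
  using spacing[of "Suc n"] by simp

lemma x_harm: "x n = harm n"
proof (induction n)
  case (Suc n)
  then show ?case using spacing_Suc[of n] by (simp add: harm_Suc inverse_eq_divide)
qed (simp add: x0 harm_expand)

sublocale interaction_points x
proof
  show "x n < x (Suc n)" for n
    using spacing_Suc[of n] by (smt (verit) divide_pos_pos of_nat_0_less_iff zero_less_Suc)
  show "\<exists>n. t < x n" for t
    using filterlim_at_top_dense[THEN iffD1, OF harm_at_top]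
    by (auto simp: x_harm eventually_sequentially)
qed (rule x0)

section \<open>Decay of the solutions for the given strengths\<close>

context
  fixes k :: complex and \<alpha> :: "nat \<Rightarrow> real" and s :: "complex \<times> complex" and a :: real
  assumes k: "k \<noteq> 0"
    and \<alpha>: "(\<lambda>n. \<alpha> n - a * (real n + 1 / 2)) \<in> O(\<lambda>n. 1 / real n)"
    and a: "- 4 < a" "a < 0"
begin

definition u :: "nat \<Rightarrow> complex" where "u n = fst (state k \<alpha> s n)"
definition p :: "nat \<Rightarrow> complex" where "p n = snd (state k \<alpha> s n)"
definition cs :: "nat \<Rightarrow> complex" where "cs m = cos (k * of_real (1 / real m))"
definition sn :: "nat \<Rightarrow> complex" where "sn m = sin (k * of_real (1 / real m)) / k"
text \<open>The entry \<open>sn m\<close> divided by its leading term \<open>1 / m\<close>, so that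
  \<open>\<sigma> m\<close> is 1 up to an error of order \<open>1 / m^2\<close>.\<close>

definition \<sigma> :: "nat \<Rightarrow> complex" where "\<sigma> m = of_nat m * sn m"
text \<open>The common constant of the cosine and sine estimates.\<close>

definition K :: real where "K = exp (cmod k) * (cmod k)\<^sup>2"

lemma K_nonneg: "0 \<le> K"
  by (simp add: K_def)

lemma u_Suc: "u (Suc n) = u n * cs (Suc n) + p n * sn (Suc n)"
  unfolding u_def p_def cs_def sn_def by (simp only: state.simps Let_def spacing_Suc flow_def fst_conv)

lemma p_Suc: "p (Suc n) = p n * cs (Suc n) - u n * (k\<^sup>2 * sn (Suc n)) + of_real (\<alpha> (Suc n)) * u (Suc n)"
  unfolding u_def p_def cs_def sn_def using k
  by (simp only: state.simps Let_def spacing_Suc flow_def fst_conv snd_conv) (simp add: power2_eq_square)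

lemma cs_sn_square: "cs m * cs m + k\<^sup>2 * (sn m * sn m) = 1"
  using sin_cos_squared_add[of "k * of_real (1 / real m)"] k
  by (simp add: cs_def sn_def power2_eq_square add.commute)

text \<open>Eliminating the derivative \<open>p\<close> turns the transfer matrices into a three-term recurrence.\<close>

lemma three_term_recurrence:
  assumes "sn (Suc n) \<noteq> 0"
  shows "u (n + 2) = (cs (n + 2) + sn (n + 2) / sn (n + 1) * cs (n + 1) + sn (n + 2) * of_real (\<alpha> (n + 1))) * u (n + 1)
    - sn (n + 2) / sn (n + 1) * u n"
proof -
  define c where "c = cs (Suc n)"
  define d where "d = sn (Suc n)"
  have "d \<noteq> 0" using assms by (simp add: d_def)
  have cd: "c * c + k\<^sup>2 * (d * d) = 1" unfolding c_def d_def by (rule cs_sn_square)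
  have u1: "u (Suc n) = u n * c + p n * d" by (simp add: u_Suc c_def d_def)
  \<comment> \<open>\<open>p n * c - u n * (k^2 * d)\<close> is the left-hand derivative at
    \<open>x (Suc n)\<close>; determinant 1 expresses it through the values \<open>u n\<close> and
    \<open>u (Suc n)\<close>.\<close>
  have "d * (p n * c - u n * (k\<^sup>2 * d)) = c * (u n * c + p n * d) - u n * (c * c + k\<^sup>2 * (d * d))"
    by (simp add: algebra_simps)
  then have "d * (p n * c - u n * (k\<^sup>2 * d)) = c * u (Suc n) - u n"
    using cd u1 by simp
  then have "p n * c - u n * (k\<^sup>2 * d) = (c * u (Suc n) - u n) / d"
    using \<open>d \<noteq> 0\<close> by (simp add: field_simps)
  then have p1: "p (Suc n) = (c * u (Suc n) - u n) / d + of_real (\<alpha> (Suc n)) * u (Suc n)"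
    using p_Suc[of n] by (simp add: c_def d_def)
  have "u (n + 2) = u (Suc n) * cs (n + 2) + p (Suc n) * sn (n + 2)"
    using u_Suc[of "Suc n"] by simp
  also have "\<dots> = (cs (n + 2) + sn (n + 2) / d * c + sn (n + 2) * of_real (\<alpha> (Suc n))) * u (Suc n)
      - sn (n + 2) / d * u n"
    unfolding p1 using \<open>d \<noteq> 0\<close> by (simp add: field_simps)
  finally show ?thesis by (simp add: c_def d_def)
qed

lemma cs_near_1: "(\<lambda>n. cs (n + j) - 1) \<in> O(inv_sq)"
proof (rule bigo_inv_sqI)
  fix n :: nat assume n: "n \<ge> 1"
  have "cmod (cs (n + j) - 1) \<le> K * (1 / real (n + j))\<^sup>2"
    unfolding cs_def K_def using n by (intro cos_near_1) auto
  also have "\<dots> \<le> K * (1 / real n)\<^sup>2"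
    using n K_nonneg by (intro mult_left_mono power_mono divide_left_mono) auto
  finally show "cmod (cs (n + j) - 1) \<le> K / (real n)\<^sup>2"
    by (simp add: power_divide)
qed

lemma \<sigma>_near_1: "(\<lambda>n. \<sigma> (n + j) - 1) \<in> O(inv_sq)"
proof (rule bigo_inv_sqI)
  fix n :: nat assume n: "n \<ge> 1"
  define m where "m = n + j"
  have m: "m \<ge> 1" "n \<le> m" using n by (simp_all add: m_def)
  have "\<sigma> m - 1 = of_nat m * (sn m - of_real (1 / real m))"
    using m by (simp add: \<sigma>_def right_diff_distrib)
  then have "cmod (\<sigma> m - 1) = real m * cmod (sn m - of_real (1 / real m))"
    by (simp only: norm_mult norm_of_nat)
  also have "\<dots> \<le> real m * (K * (1 / real m) ^ 3)"
    unfolding sn_def K_def using m k by (intro mult_left_mono sin_near_id) auto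
  also have "\<dots> = K * (1 / real m)\<^sup>2"
    using m by (simp add: power2_eq_square power3_eq_cube)
  also have "\<dots> \<le> K * (1 / real n)\<^sup>2"
    using n m K_nonneg by (intro mult_left_mono power_mono divide_left_mono) auto
  finally show "cmod (\<sigma> (n + j) - 1) \<le> K / (real n)\<^sup>2"
    by (simp add: power_divide m_def)
qed

text \<open>Needed wherever \<open>sn (n + 1)\<close> is divided by: it may vanish for small
  \<open>n\<close>, and eventually it is comparable with \<open>1 / n\<close>.\<close>

lemma \<sigma>_large: "\<forall>\<^sub>F n in sequentially. 1 / 2 \<le> cmod (\<sigma> (n + 1))"
proof -
  have "(\<lambda>n. cmod (\<sigma> (n + 1))) \<longlonglongrightarrow> cmod 1"
    by (intro tendsto_norm near_1_tendsto \<sigma>_near_1)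
  then have "\<forall>\<^sub>F n in sequentially. 1 / 2 < cmod (\<sigma> (n + 1))"
    by (rule order_tendstoD) simp
  then show ?thesis by eventually_elim simp
qed

lemma u_bound: obtains M where "M \<ge> 0" "\<And>n. sqrt (real n) * cmod (u n) \<le> M"
proof -
  \<comment> \<open>\<open>g1\<close>, \<open>g2\<close>, \<open>g3\<close> are the real factors
    that rescaling by square roots puts on the three summands of the middle coefficient in
    \<open>three_term_recurrence\<close>, and \<open>gB\<close> is the one on the last coefficient.
    Their complex partners are all 1 + O(1/n^2), so only the sum \<open>g1 + g2 + g3\<close> and
    \<open>gB\<close> have to be expanded to that order.\<close>
  define g1 where "g1 n = sqrt (real n + 2) / sqrt (real n + 1)" for n :: nat
  define g2 where "g2 n = g1 n * (real n + 1) / (real n + 2)" for n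
  define g3 where "g3 n = g1 n * \<alpha> (n + 1) / (real n + 2)" for n
  define gB where "gB n = sqrt (real n + 2) / sqrt (real n) * (real n + 1) / (real n + 2)" for n :: nat
  define \<rho> where "\<rho> n = \<sigma> (n + 2) * inverse (\<sigma> (n + 1))" for n
  define A where "A n = of_real (g1 n) * cs (n + 2) + of_real (g2 n) * (\<rho> n * cs (n + 1))
    + of_real (g3 n) * \<sigma> (n + 2)" for n
  define B where "B n = of_real (gB n) * \<rho> n" for n
  have \<rho>: "(\<lambda>n. \<rho> n - 1) \<in> O(inv_sq)"
    unfolding \<rho>_def by (intro near_1_mult near_1_inverse \<sigma>_near_1)
  have g1: "g1 \<in> O(\<lambda>_. 1)" unfolding g1_def by real_asymp
  have g2: "g2 \<in> O(\<lambda>_. 1)" unfolding g2_def g1_def by real_asymp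
  \<comment> \<open>The share of the unspecified error of the strengths: O(1/n) times the spacing of
    order 1/n.\<close>
  define \<beta> where "\<beta> n = g1 n * (\<alpha> (n + 1) - a * (real (n + 1) + 1 / 2)) / (real n + 2)" for n
  have g3_eq: "g3 n = g1 n * (a * (real n + 3 / 2)) / (real n + 2) + \<beta> n" for n
  proof -
    have R: "real (n + 1) + 1 / 2 = real n + 3 / 2" by simp
    show ?thesis
      unfolding g3_def \<beta>_def R right_diff_distrib diff_divide_distrib by simp
  qed
  have \<beta>: "\<beta> \<in> O(\<lambda>n. 1 / (real n)\<^sup>2)"
  proof -
    have "(\<lambda>n. \<alpha> (Suc n) - a * (real (Suc n) + 1 / 2)) \<in> O(\<lambda>n. 1 / real (Suc n))"
      using landau_o.big.compose[OF \<alpha> filterlim_Suc] by simp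
    moreover have "(\<lambda>n. g1 n / (real n + 2)) \<in> O(\<lambda>n. 1 / real n)"
      unfolding g1_def by real_asymp
    ultimately have "(\<lambda>n. (\<alpha> (Suc n) - a * (real (Suc n) + 1 / 2)) * (g1 n / (real n + 2)))
        \<in> O(\<lambda>n. 1 / real (Suc n) * (1 / real n))"
      by (rule landau_o.big.mult)
    also have "(\<lambda>n. 1 / real (Suc n) * (1 / real n)) \<in> O(\<lambda>n. 1 / (real n)\<^sup>2)"
      by real_asymp
    finally show ?thesis
      by (simp add: \<beta>_def[abs_def] mult.commute)
  qed
  have \<beta>1: "\<beta> \<in> O(\<lambda>_. 1)"
    by (rule landau_o.big_trans[OF \<beta>]) real_asymp
  have "(\<lambda>n. g1 n * (real n + 3 / 2) / (real n + 2)) \<in> O(\<lambda>_. 1)"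
    unfolding g1_def by real_asymp
  from landau_o.big.mult_in_1[OF bigo_const[of a] this]
  have "(\<lambda>n. a * (g1 n * (real n + 3 / 2) / (real n + 2))) \<in> O(\<lambda>_. 1)" .
  from sum_in_bigo(1)[OF this \<beta>1] have g3: "g3 \<in> O(\<lambda>_. 1)"
    by (simp add: g3_eq[abs_def] mult.left_commute)
  \<comment> \<open>As \<open>1 + (n+1)/(n+2) = 2 (n + 3/2)/(n+2)\<close>, the sum without
    \<open>\<beta>\<close> is \<open>2 + a\<close> times
    \<open>(n + 3/2) / sqrt ((n+1)(n+2))\<close>. This quotient of the arithmetic and the geometric
    mean of \<open>n+1\<close> and \<open>n+2\<close> is 1 + O(1/n^2), which is where the shift 1/2
    in the strengths is essential.\<close>
  have sum: "(\<lambda>n. g1 n + g2 n + g3 n - (2 + a)) \<in> O(\<lambda>n. 1 / (real n)\<^sup>2)"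
  proof -
    have "(\<lambda>n. g1 n * (real n + 3 / 2) / (real n + 2) - 1) \<in> O(\<lambda>n. 1 / (real n)\<^sup>2)"
      unfolding g1_def by real_asymp
    then have "(\<lambda>n. (2 + a) * (g1 n * (real n + 3 / 2) / (real n + 2) - 1)) \<in> O(\<lambda>n. 1 / (real n)\<^sup>2)"
      by (cases "2 + a = 0") simp_all
    from sum_in_bigo(1)[OF this \<beta>] have "(\<lambda>n. (2 + a) * (g1 n * (real n + 3 / 2) / (real n + 2) - 1) + \<beta> n)
        \<in> O(\<lambda>n. 1 / (real n)\<^sup>2)" .
    also have "(\<lambda>n. (2 + a) * (g1 n * (real n + 3 / 2) / (real n + 2) - 1) + \<beta> n)
        = (\<lambda>n. g1 n + g2 n + g3 n - (2 + a))"
    proof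
      fix n
      have "(2 + a) * (g * (q - 1 / 2) / q) = g + g * (q - 1) / q + g * (a * (q - 1 / 2)) / q"
        if "q \<noteq> 0" for g q :: real
        using that by (simp add: field_simps)
      from this[of "real n + 2" "g1 n"]
      have eq: "(2 + a) * (g1 n * (real n + 3 / 2) / (real n + 2)) = g1 n + g2 n + g1 n * (a * (real n + 3 / 2)) / (real n + 2)"
        by (simp add: g2_def add_nonneg_eq_0_iff add.commute)
      show "(2 + a) * (g1 n * (real n + 3 / 2) / (real n + 2) - 1) + \<beta> n = g1 n + g2 n + g3 n - (2 + a)"
        unfolding g3_eq right_diff_distrib eq by simp
    qed
    finally show ?thesis .
  qed
  have A: "(\<lambda>n. A n - of_real (2 + a)) \<in> O(inv_sq)"
  proof -
    have "(\<lambda>n. (cs (n + 2) - 1) * of_real (g1 n) + (\<rho> n * cs (n + 1) - 1) * of_real (g2 n)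
        + (\<sigma> (n + 2) - 1) * of_real (g3 n) + complex_of_real (g1 n + g2 n + g3 n - (2 + a))) \<in> O(inv_sq)"
      by (intro sum_in_bigo(1) landau_o.big_1_mult bigo_1_of_real g1 g2 g3 cs_near_1 \<sigma>_near_1
          near_1_mult \<rho> bigo_inv_sq_of_real sum)
    then show ?thesis
      by (rule back_subst[of "\<lambda>f. f \<in> O(inv_sq)"]) (simp add: A_def fun_eq_iff algebra_simps)
  qed
  \<comment> \<open>For positive \<open>n\<close>, \<open>gB n = (n+1) / sqrt (n (n+2))\<close> is
    again a quotient of an arithmetic and a geometric mean.\<close>
  have "(\<lambda>n. complex_of_real (gB n - 1)) \<in> O(inv_sq)"
    unfolding gB_def by (rule bigo_inv_sq_of_real) real_asymp
  then have B: "(\<lambda>n. B n - 1) \<in> O(inv_sq)"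
    unfolding B_def by (intro near_1_mult \<rho>) simp
  define v where "v n = of_real (sqrt (real n)) * u n" for n
  have rec: "\<forall>\<^sub>F n in sequentially. v (n + 2) = A n * v (n + 1) - B n * v n"
    using \<sigma>_large eventually_ge_at_top[of 1]
  proof eventually_elim
    case (elim n)
    then have \<sigma>0: "\<sigma> (n + 1) \<noteq> 0" by auto
    then have sn1: "sn (Suc n) \<noteq> 0" by (auto simp: \<sigma>_def)
    note rec = three_term_recurrence[OF this]
    define w where "w = complex_of_real (sqrt (real n + 2))"
    have e: "complex_of_real (real n + 2) = of_nat (n + 2)" "complex_of_real (real n + 1) = of_nat (n + 1)"
      by simp_all
    have nz: "of_nat (n + 2) \<noteq> (0 :: complex)" "of_nat (n + 1) \<noteq> (0 :: complex)"
      by (simp_all only: of_nat_eq_0_iff)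
    have sn2: "sn (n + 2) = \<sigma> (n + 2) / of_real (real n + 2)"
      unfolding \<sigma>_def e by (simp only: nonzero_mult_div_cancel_left[OF nz(1)])
    have cancel: "s2 / s1 = N1 / N2 * (N2 * s2 * inverse (N1 * s1))"
      if "N1 \<noteq> 0" "N2 \<noteq> 0" "s1 \<noteq> 0" for s1 s2 N1 N2 :: complex
      using that by (simp add: field_simps)
    have \<rho>n: "sn (n + 2) / sn (n + 1) = of_real ((real n + 1) / (real n + 2)) * \<rho> n"
      unfolding \<rho>_def \<sigma>_def of_real_divide e
      by (rule cancel[OF nz(2,1)]) (use sn1 in simp)
    have "sqrt (real n + 2) = g1 n * sqrt (real n + 1)"
      by (simp add: g1_def add_nonneg_eq_0_iff)
    then have w1: "w = of_real (g1 n) * of_real (sqrt (real (n + 1)))"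
      unfolding w_def of_real_mult[symmetric] by (simp add: add.commute)
    have "sqrt (real n + 2) * ((real n + 1) / (real n + 2)) = gB n * sqrt (real n)"
      using elim(2) by (simp add: gB_def)
    then have wB: "w * of_real ((real n + 1) / (real n + 2)) = of_real (gB n) * of_real (sqrt (real n))"
      unfolding w_def of_real_mult[symmetric] by (rule arg_cong)
    have w2: "w * of_real ((real n + 1) / (real n + 2)) = of_real (g2 n) * of_real (sqrt (real (n + 1)))"
      unfolding w1 g2_def by simp
    have w3: "w * (\<sigma> (n + 2) / of_real (real n + 2) * of_real (\<alpha> (n + 1)))
        = of_real (g3 n) * \<sigma> (n + 2) * of_real (sqrt (real (n + 1)))"
      unfolding w1 g3_def by simp
    have "v (n + 2) = w * u (n + 2)"
      by (simp add: v_def w_def add.commute)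
    also have "\<dots> = w * cs (n + 2) * u (n + 1) + (w * of_real ((real n + 1) / (real n + 2))) * \<rho> n * cs (n + 1) * u (n + 1)
        + w * (\<sigma> (n + 2) / of_real (real n + 2) * of_real (\<alpha> (n + 1))) * u (n + 1)
        - (w * of_real ((real n + 1) / (real n + 2))) * \<rho> n * u n"
      unfolding rec \<rho>n unfolding sn2 by (simp add: algebra_simps)
    also have "\<dots> = (of_real (g1 n) * of_real (sqrt (real (n + 1)))) * cs (n + 2) * u (n + 1)
        + (of_real (g2 n) * of_real (sqrt (real (n + 1)))) * \<rho> n * cs (n + 1) * u (n + 1)
        + (of_real (g3 n) * \<sigma> (n + 2) * of_real (sqrt (real (n + 1)))) * u (n + 1)
        - (of_real (gB n) * of_real (sqrt (real n))) * \<rho> n * u n"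
      unfolding w3 w2[symmetric] wB[symmetric] w1[symmetric] ..
    also have "\<dots> = A n * v (n + 1) - B n * v n"
      unfolding A_def B_def v_def by (simp add: algebra_simps)
    finally show ?case .
  qed
  \<comment> \<open>The range of \<open>a\<close> is exactly the oscillatory regime of the limiting
    recurrence.\<close>
  have "\<bar>2 + a\<bar> < 2" using a by simp
  then obtain M where M: "\<And>n. cmod (v n) \<le> M"
    using oscillatory_recurrence_bounded[OF _ A B rec] by blast
  have "0 \<le> M" using order_trans[OF norm_ge_zero M[of 0]] .
  moreover have "sqrt (real n) * cmod (u n) \<le> M" for n
    using M[of n] by (simp add: v_def norm_mult)
  ultimately show ?thesis by (rule that)
qed

text \<open>Between interaction points the solution is \<open>u n\<close> times a cosine plus
  \<open>p n\<close> times a sine over \<open>k\<close>. The derivative \<open>p n\<close> may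
  exceed \<open>u n\<close> by a factor of order \<open>n\<close>, but the sine term is of order
  \<open>1 / n\<close>, so the bound on \<open>u\<close> controls the whole piece.\<close>

lemma sol_bound:
  obtains N L where "\<And>t. t \<ge> x N \<Longrightarrow> (cmod (fst (sol k \<alpha> s t)))\<^sup>2 \<le> L * exp (- t)"
proof -
  obtain M where M: "M \<ge> 0" "\<And>n. sqrt (real n) * cmod (u n) \<le> M" by (rule u_bound, rule that)
  obtain N0 where N0: "\<And>n. n \<ge> N0 \<Longrightarrow> 1 / 2 \<le> cmod (\<sigma> (n + 1))"
    using \<sigma>_large unfolding eventually_sequentially by blast
  define N where "N = max 1 N0"
  \<comment> \<open>\<open>1 + K\<close> bounds the cosine as well as \<open>n + 1\<close> times the
    sine over \<open>k\<close>, and \<open>2 * (1 + (1 + K))\<close> bounds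
    \<open>cmod (p n) / (n + 1)\<close> in units of \<open>m\<close>.\<close>
  define c where "c = (1 + K) + (1 + K) * (2 * (1 + (1 + K)))"
  have c: "c \<ge> 0" using K_nonneg by (simp add: c_def)
  have pointwise: "(cmod (fst (sol k \<alpha> s t)))\<^sup>2 \<le> 2 * exp 1 * (c * M)\<^sup>2 * exp (- t)" if t: "t \<ge> x N" for t
  proof -
    have "t \<ge> 0" using t x_nonneg[of N] by linarith
    then obtain n where n: "x n \<le> t" "t < x (Suc n)" by (rule interval_of_point)
    have "x N < x (Suc n)" using t n by linarith
    then have nN: "n \<ge> N" by simp
    then have n1: "n \<ge> 1" and \<sigma>n: "1 / 2 \<le> cmod (\<sigma> (n + 1))" using N0 by (auto simp: N_def)
    define d where "d = t - x n"
    have d: "0 \<le> d" "d \<le> 1 / real (Suc n)" "d \<le> 1"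
    proof -
      show "0 \<le> d" "d \<le> 1 / real (Suc n)" using n spacing_Suc[of n] by (simp_all add: d_def)
      moreover have "1 / real (Suc n) \<le> 1" by simp
      ultimately show "d \<le> 1" by linarith
    qed
    define m where "m = M / sqrt (real n)"
    have um: "cmod (u n) \<le> m"
      using M(2)[of n] n1 by (simp add: m_def field_simps)
    have um': "cmod (u (Suc n)) \<le> m"
    proof -
      have "sqrt (real n) * cmod (u (Suc n)) \<le> sqrt (real (Suc n)) * cmod (u (Suc n))"
        by (intro mult_right_mono) auto
      then have "sqrt (real n) * cmod (u (Suc n)) \<le> M" using M(2)[of "Suc n"] by linarith
      then show ?thesis using n1 by (simp add: m_def field_simps)
    qed
    have m0: "0 \<le> m" using um norm_ge_zero order_trans by blast
    have cos_le: "cmod (cos (k * of_real r)) \<le> 1 + K" if "0 \<le> r" "r \<le> 1" for r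
    proof -
      have "cmod (cos (k * of_real r)) \<le> cmod 1 + cmod (cos (k * of_real r) - 1)"
        using norm_triangle_ineq[of 1 "cos (k * of_real r) - 1"] by simp
      also have "\<dots> \<le> 1 + K * r\<^sup>2"
        using cos_near_1[OF that, of k] by (simp add: K_def)
      also have "\<dots> \<le> 1 + K * 1"
        using that K_nonneg by (intro add_left_mono mult_left_mono) (auto simp: power_le_one)
      finally show ?thesis by simp
    qed
    have sin_le: "cmod (sin (k * of_real d) / k) \<le> (1 + K) / real (Suc n)"
    proof -
      have "cmod (sin (k * of_real d) / k) \<le> cmod (of_real d) + cmod (sin (k * of_real d) / k - of_real d)"
        using norm_triangle_ineq[of "of_real d" "sin (k * of_real d) / k - of_real d"] by simp
      also have "\<dots> \<le> d + K * d ^ 3"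
        using sin_near_id[OF d(1,3) k] d(1) by (simp add: K_def)
      also have "\<dots> \<le> d + K * d"
        using d K_nonneg power_decreasing[of 1 3 d] by (intro add_left_mono mult_left_mono) auto
      also have "\<dots> = (1 + K) * d" by (simp add: algebra_simps)
      also have "\<dots> \<le> (1 + K) * (1 / real (Suc n))"
        using d K_nonneg by (intro mult_left_mono) auto
      finally show ?thesis by simp
    qed
    have half: "P \<le> 2 * Q" if "P * (1 / 2) \<le> Q" for P Q :: real
      using that by simp
    \<comment> \<open>The derivative is recovered from two neighbouring values by solving
      \<open>u_Suc\<close> for \<open>p n\<close>; the lower bound on \<open>\<sigma>\<close>
      controls the division.\<close>
    have "cmod (p n) / real (Suc n) * (1 / 2) \<le> cmod (p n) / real (Suc n) * cmod (\<sigma> (n + 1))"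
      using \<sigma>n by (intro mult_left_mono) auto
    also have "\<dots> = cmod (p n * sn (Suc n))"
    proof -
      have "cmod (\<sigma> (n + 1)) = real (Suc n) * cmod (sn (Suc n))"
        unfolding \<sigma>_def norm_mult norm_of_nat by simp
      then show ?thesis by (simp add: norm_mult del: of_nat_Suc)
    qed
    also have "p n * sn (Suc n) = u (Suc n) - u n * cs (Suc n)"
      by (simp add: u_Suc)
    also have "cmod \<dots> \<le> cmod (u (Suc n)) + cmod (u n) * cmod (cs (Suc n))"
      by (metis norm_mult norm_triangle_ineq4)
    also have "\<dots> \<le> m + m * (1 + K)"
      using um um' m0 unfolding cs_def by (intro add_mono mult_mono cos_le) auto
    finally have "cmod (p n) / real (Suc n) \<le> 2 * (m + m * (1 + K))"
      by (rule half)
    also have "\<dots> = 2 * (1 + (1 + K)) * m" by (simp add: algebra_simps)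
    finally have pn: "cmod (p n) / real (Suc n) \<le> 2 * (1 + (1 + K)) * m" .
    have "fst (sol k \<alpha> s t) = u n * cos (k * of_real d) + p n * (sin (k * of_real d) / k)"
      unfolding sol_eq[OF n] flow_def u_def p_def d_def by simp
    then have "cmod (fst (sol k \<alpha> s t)) \<le> cmod (u n) * cmod (cos (k * of_real d)) + cmod (p n) * cmod (sin (k * of_real d) / k)"
      by (metis norm_mult norm_triangle_ineq)
    also have "\<dots> \<le> m * (1 + K) + cmod (p n) * ((1 + K) / real (Suc n))"
      using um m0 by (intro add_mono mult_mono mult_left_mono cos_le sin_le d(1,3)) auto
    also have "\<dots> = m * (1 + K) + (1 + K) * (cmod (p n) / real (Suc n))"
      by simp
    also have "\<dots> \<le> m * (1 + K) + (1 + K) * (2 * (1 + (1 + K)) * m)"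
      using pn K_nonneg by (intro add_left_mono mult_left_mono) auto
    also have "\<dots> = c * m" by (simp add: c_def algebra_simps)
    finally have "(cmod (fst (sol k \<alpha> s t)))\<^sup>2 \<le> (c * m)\<^sup>2"
      by (intro power_mono) auto
    also have "\<dots> = (c * M)\<^sup>2 * (1 / real n)"
      by (simp add: m_def power_mult_distrib power_divide)
    also have "\<dots> \<le> (c * M)\<^sup>2 * (2 * exp 1 * exp (- t))"
    proof (rule mult_left_mono)
      \<comment> \<open>\<open>t\<close> lies below \<open>x (Suc n)\<close>, the harmonic number
        with index \<open>n + 1\<close>. Hence \<open>exp t\<close> is at most
        \<open>exp 1 * (n + 1)\<close>, and \<open>n + 1 \<le> 2 * n\<close> gives the factor
        \<open>2 * exp 1\<close>.\<close>
      have "t \<le> 1 + ln (real (Suc n))"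
        using n(2) harm_le_ln[of n] by (simp add: x_harm)
      then have "exp t \<le> exp (1 + ln (real (Suc n)))" by simp
      also have "\<dots> = exp 1 * real (Suc n)" by (simp only: exp_add exp_ln of_nat_0_less_iff zero_less_Suc)
      also have "\<dots> \<le> exp 1 * (2 * real n)"
        using n1 by (intro mult_left_mono) auto
      finally show "1 / real n \<le> 2 * exp 1 * exp (- t)"
        using n1 by (simp add: exp_minus field_simps)
    qed simp
    finally show ?thesis by (simp add: mult_ac)
  qed
  show ?thesis by (rule that[OF pointwise])
qed

lemma sq_integrable_sol: "sq_integrable (\<lambda>t. fst (sol k \<alpha> s t))"
proof -
  define f where "f t = fst (sol k \<alpha> s t)" for t
  obtain N L where "\<And>t. t \<ge> x N \<Longrightarrow> (cmod (fst (sol k \<alpha> s t)))\<^sup>2 \<le> L * exp (- t)"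
    by (rule sol_bound, rule that)
  then have NL: "(cmod (f t))\<^sup>2 \<le> L * exp (- t)" if "t \<ge> x N" for t
    using that by (simp add: f_def)
  have cont: "continuous_on half_line f"
    using delta_solution_sol[OF k, of \<alpha> s] by (simp add: delta_solution_def f_def[abs_def])
  have meas: "f \<in> borel_measurable leb"
    by (rule continuous_imp_measurable_on_sets_lebesgue[OF cont half_line_sets])
  have "bounded ((\<lambda>t. (cmod (f t))\<^sup>2) ` {0..x N})"
    by (intro compact_imp_bounded compact_continuous_image continuous_intros continuous_on_subset[OF cont])
      (auto simp: half_line_def)
  then obtain M where "\<forall>y\<in>(\<lambda>t. (cmod (f t))\<^sup>2) ` {0..x N}. norm y \<le> M"
    unfolding bounded_iff by (elim exE)
  then have M: "(cmod (f t))\<^sup>2 \<le> M" if "t \<in> {0..x N}" for t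
    using that by simp
  have "(cmod (f 0))\<^sup>2 \<le> M" by (rule M) simp
  then have "M \<ge> 0" by (rule order_trans[OF zero_le_power2])
  have L: "L \<ge> 0"
  proof -
    have "0 \<le> L * exp (- x N)" using order_trans[OF zero_le_power2 NL[OF order_refl]] .
    then show ?thesis by (simp add: zero_le_mult_iff)
  qed
  \<comment> \<open>On the initial interval the constant bound \<open>M\<close> is absorbed through
    \<open>exp (x N - t) \<ge> 1\<close>, so that one multiple of \<open>exp (- t)\<close> dominates
    on the whole half-line.\<close>
  have le: "(cmod (f t))\<^sup>2 \<le> (L + M * exp (x N)) * exp (- t)" if "t \<ge> 0" for t
  proof (cases "t \<ge> x N")
    case True
    have "(cmod (f t))\<^sup>2 \<le> L * exp (- t)" by (rule NL[OF True])
    also have "\<dots> \<le> (L + M * exp (x N)) * exp (- t)"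
      using \<open>M \<ge> 0\<close> by (intro mult_right_mono) auto
    finally show ?thesis .
  next
    case False
    then have "(cmod (f t))\<^sup>2 \<le> M * 1" using M[of t] that by simp
    also have "\<dots> \<le> M * exp (x N - t)" using False \<open>M \<ge> 0\<close> by (intro mult_left_mono) auto
    also have "\<dots> = M * exp (x N) * exp (- t)" by (simp add: exp_diff exp_minus field_simps)
    also have "\<dots> \<le> (L + M * exp (x N)) * exp (- t)" using L by (intro mult_right_mono) auto
    finally show ?thesis .
  qed
  have "integrable leb (\<lambda>t. (cmod (f t))\<^sup>2)"
  proof (rule Bochner_Integration.integrable_bound)
    show "integrable leb (\<lambda>t. (L + M * exp (x N)) * exp (- t))"
      using integrable_exp_minus by simp
    show "(\<lambda>t. (cmod (f t))\<^sup>2) \<in> borel_measurable leb" using meas by measurable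
    show "AE t in leb. norm ((cmod (f t))\<^sup>2) \<le> norm ((L + M * exp (x N)) * exp (- t))"
    proof (rule AE_I2)
      fix t assume "t \<in> space leb"
      then have "t \<ge> 0" by (simp add: half_line_def)
      from le[OF this] show "norm ((cmod (f t))\<^sup>2) \<le> norm ((L + M * exp (x N)) * exp (- t))"
        by (metis abs_ge_self abs_power2 order_trans real_norm_def)
    qed
  qed
  with meas show ?thesis by (simp add: sq_integrable_def f_def[abs_def])
qed

end

end

theorem proposition5p13:
  fixes x \<alpha> :: "nat \<Rightarrow> real" and a :: real
  assumes "x 0 = 0"
    and "\<And>n. n \<ge> 1 \<Longrightarrow> x n - x (n - 1) = 1 / real n"
    and "(\<lambda>n. \<alpha> n - a * (real n + 1 / 2)) \<in> O(\<lambda>n. 1 / real n)"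
    and "- 4 < a" and "a < 0"
  shows "symmetric_operator (delta_op x \<alpha>)
    \<and> deficiency_plus (delta_op x \<alpha>) = 1
    \<and> deficiency_minus (delta_op x \<alpha>) = 1"
proof -
  interpret harmonic_points x
    using assms(1,2) by unfold_locales
  \<comment> \<open>The estimates ask of the spectral parameter only that its root \<open>k\<close>
    be nonzero, so both imaginary units are covered by the same argument.\<close>
  have "cdimension (ker_shift (adjoint_operator (delta_op x \<alpha>)) z) = 1" if "z \<noteq> 0" for z
  proof -
    have k: "csqrt z \<noteq> 0" using that by simp
    show ?thesis
      using deficiency_of_sq_integrable_sol[OF k sq_integrable_sol[OF k assms(3-5)]]
      unfolding power2_csqrt .
  qed
  from this[of \<i>] this[of "- \<i>"] show ?thesis
    using symmetric_operator_delta_op by (simp add: deficiency_plus_def deficiency_minus_def)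
qed

end
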